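(* Let $G$ be any infinite connected quasi-transitive graph with distinguished vertex $0$, let $p_c=p_c(G\times\mathbb{Z})$ be the critical point of homogeneous Bernoulli bond percolation on $G\times\mathbb{Z}$, and consider the Stack Model on $G\times\mathbb{Z}$ defined by i.i.d. random variables $\{X_n;\,n\in\mathbb{Z}\}$ supported on $\mathbb{N}=\{1,2,3,\dots\}$ with common distribution that of $X$. If $E\log|B_G(X)|<\infty$, then $$\theta^{\Lambda}(p,q)=0\qquad\text{for } p\in[0,p_c),\ q\in[0,1),$$ for $\nu$-almost every environment $\Lambda$.
   Context: Quasi-transitive: a graph $G=(V,E)$ (with finite vertex degrees) is quasi-transitive if there is a finite set $V_0\subset V$ such that for every $w\in V$ there exist $x\in V_0$ and an automorphism $\tau$ of $G$ with $\tau(w)=x$. Product graph: $G\times\mathbb{Z}$ is the Cartesian (box) product: its vertex set is $V\times\mathbb{Z}$, and $(v_1,v_2)$, $(w_1,w_2)$ are adjacent iff either $v_1=w_1$ and $|v_2-w_2|=1$, or $v_1\sim w_1$ in $G$ and $v_2=w_2$. A vertex of $G$ is distinguished and called $0$; the origin $(0,0)$ of $G\times\mathbb{Z}$ is also denoted $0$. Balls and boxes: $B_G(r)=\{v\in V: d_G(0,v)\le r\}$, where $d_G$ is graph distance, and for $a\in\mathbb{Z}$, $B(a,r)=B_G(r)\times([a-r,a+r]\cap\mathbb{Z})\subset G\times\mathbb{Z}$. Homogeneous percolation: each edge of $G\times\mathbb{Z}$ is open independently with probability $p$; $\theta(p)$ is the probability that there is an infinite open path starting from the origin, and $p_c(G\times\mathbb{Z})=\sup\{p\in[0,1]:\theta(p)=0\}$.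 Environment: $\{X_n;n\in\mathbb{Z}\}$ are i.i.d. with values in $\mathbb{N}$, defined on $(\Xi,\mathcal{G},\nu)$ with $\Xi=\mathbb{N}^{\mathbb{Z}}$ and $\mathcal{G}=\sigma(X_n,n\in\mathbb{Z})$; $E$ is expectation with respect to $\nu$. An element $\Lambda\in\Xi$ is called an environment. Stack Model: given $\Lambda$, let $Z(0)=0$, $Z(n)=X_0+2\sum_{i=1}^{n-1}X_i+X_n$ for $n\ge1$, and $Z(n)=-X_0-2\sum_{i=1}^{-n-1}X_{-i}-X_n$ for $n\le-1$. Let $B_n=B(Z(n),X_n)$ and $R=R(\Lambda)=\bigcup_{n\in\mathbb{Z}}B_n$. Given $\Lambda$, under the quenched measure $\mathbb{P}^{\Lambda}_{p,q}$ the edges of $G\times\mathbb{Z}$ are open independently, each edge in $R$ (i.e. with both endpoints in $R$) with probability $q$ and every other edge with probability $p$. $\theta^{\Lambda}(p,q)$ is the $\mathbb{P}^{\Lambda}_{p,q}$-probability that there is an infinite open path starting from the origin of $G\times\mathbb{Z}$. *)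

theory Defs
  imports "HOL-Probability.Probability"
begin

section \<open>Undirected simple graphs on a vertex set, possibly infinite\<close>

definition simple_graph :: "'a set \<Rightarrow> 'a set set \<Rightarrow> bool" where
  "simple_graph V E \<longleftrightarrow> (\<forall>e\<in>E. e \<subseteq> V \<and> card e = 2)"

definition adj_rel :: "'a set set \<Rightarrow> ('a \<times> 'a) set" where
  "adj_rel E = {(u, v). {u, v} \<in> E}"

definition locally_finite_graph :: "'a set \<Rightarrow> 'a set set \<Rightarrow> bool" where
  "locally_finite_graph V E \<longleftrightarrow> (\<forall>v\<in>V. finite {w\<in>V. {v, w} \<in> E})"

definition connected_graph :: "'a set \<Rightarrow> 'a set set \<Rightarrow> bool" where
  "connected_graph V E \<longleftrightarrow> (\<forall>u\<in>V. \<forall>v\<in>V. (u, v) \<in> (adj_rel E)\<^sup>*)"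

definition graph_automorphism :: "'a set \<Rightarrow> 'a set set \<Rightarrow> ('a \<Rightarrow> 'a) \<Rightarrow> bool" where
  "graph_automorphism V E \<tau> \<longleftrightarrow>
     bij_betw \<tau> V V \<and> (\<forall>u\<in>V. \<forall>v\<in>V. {\<tau> u, \<tau> v} \<in> E \<longleftrightarrow> {u, v} \<in> E)"

definition quasi_transitive :: "'a set \<Rightarrow> 'a set set \<Rightarrow> bool" where
  "quasi_transitive V E \<longleftrightarrow>
     (\<exists>V\<^sub>0. finite V\<^sub>0 \<and> V\<^sub>0 \<subseteq> V \<and>
        (\<forall>w\<in>V. \<exists>x\<in>V\<^sub>0. \<exists>\<tau>. graph_automorphism V E \<tau> \<and> \<tau> w = x))"

text \<open>The distance is the least length of a walk; it is \<open>\<infinity>\<close> if there is none.\<close>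

definition graph_dist :: "'a set set \<Rightarrow> 'a \<Rightarrow> 'a \<Rightarrow> enat" where
  "graph_dist E u v = (INF n\<in>{n. (u, v) \<in> adj_rel E ^^ n}. enat n)"

definition graph_ball :: "'a set \<Rightarrow> 'a set set \<Rightarrow> 'a \<Rightarrow> nat \<Rightarrow> 'a set" where
  "graph_ball V E v\<^sub>0 r = {v\<in>V. graph_dist E v\<^sub>0 v \<le> enat r}"

text \<open>The edge set of the box product of the graph with the integer line; the vertex set
  of the product is \<open>V \<times> UNIV\<close>.\<close>

definition prod_Z_edges :: "'a set \<Rightarrow> 'a set set \<Rightarrow> ('a \<times> int) set set" where
  "prod_Z_edges V E =
     {{(v1, v2), (w1, w2)} | v1 v2 w1 w2.
        v1 \<in> V \<and> w1 \<in> V \<and> (v1 = w1 \<and> \<bar>v2 - w2\<bar> = 1 \<or> {v1, w1} \<in> E \<and> v2 = w2)}"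

lemma prod_Z_edges_iff:
  "{(v1, v2), (w1, w2)} \<in> prod_Z_edges V E \<longleftrightarrow>
     v1 \<in> V \<and> w1 \<in> V \<and> (v1 = w1 \<and> \<bar>v2 - w2\<bar> = 1 \<or> {v1, w1} \<in> E \<and> v2 = w2)"
  unfolding prod_Z_edges_def
  by (auto simp: doubleton_eq_iff insert_commute abs_minus_commute; metis insert_commute)

section \<open>Independent bond percolation\<close>

text \<open>A configuration assigns \<open>True\<close> (open) or \<open>False\<close> (closed) to each edge;
  \<open>pr e\<close> is the probability that the edge \<open>e\<close> is open.\<close>

definition percolation_measure :: "'b set set \<Rightarrow> ('b set \<Rightarrow> real) \<Rightarrow> ('b set \<Rightarrow> bool) measure" where
  "percolation_measure F pr = (\<Pi>\<^sub>M e\<in>F. measure_pmf (bernoulli_pmf (pr e)))"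

text \<open>Paths are self-avoiding, so that an infinite path visits infinitely many vertices.\<close>

definition infinite_open_path_from :: "'b set set \<Rightarrow> 'b \<Rightarrow> ('b set \<Rightarrow> bool) \<Rightarrow> bool" where
  "infinite_open_path_from F x \<omega> \<longleftrightarrow>
     (\<exists>\<gamma> :: nat \<Rightarrow> 'b. \<gamma> 0 = x \<and> inj \<gamma> \<and>
        (\<forall>i. {\<gamma> i, \<gamma> (Suc i)} \<in> F \<and> \<omega> {\<gamma> i, \<gamma> (Suc i)}))"

definition percolation_prob :: "'b set set \<Rightarrow> ('b set \<Rightarrow> real) \<Rightarrow> 'b \<Rightarrow> real" where
  "percolation_prob F pr x =
     measure (percolation_measure F pr)
       {\<omega> \<in> space (percolation_measure F pr). infinite_open_path_from F x \<omega>}"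

definition theta :: "'a set \<Rightarrow> 'a set set \<Rightarrow> 'a \<Rightarrow> real \<Rightarrow> real" where
  "theta V E v\<^sub>0 p = percolation_prob (prod_Z_edges V E) (\<lambda>_. p) (v\<^sub>0, 0)"

definition p_crit :: "'a set \<Rightarrow> 'a set set \<Rightarrow> 'a \<Rightarrow> real" where
  "p_crit V E v\<^sub>0 = Sup {p \<in> {0..1}. theta V E v\<^sub>0 p = 0}"

section \<open>The Stack Model\<close>

text \<open>The environment space consists of the bi-infinite sequences of positive integers,
  with the \<open>\<sigma>\<close>-algebra generated by the coordinates.\<close>

definition env_space :: "(int \<Rightarrow> nat) measure" where
  "env_space = (\<Pi>\<^sub>M n\<in>UNIV. count_space {1..})"

text \<open>The coordinates \<open>\<Lambda> n\<close> of the environment play the role of the random variables \<open>X\<^sub>n\<close>.\<close>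

definition iid_environment :: "(int \<Rightarrow> nat) measure \<Rightarrow> bool" where
  "iid_environment \<nu> \<longleftrightarrow>
     prob_space \<nu> \<and> sets \<nu> = sets env_space \<and>
     prob_space.indep_vars \<nu> (\<lambda>n. count_space {1..}) (\<lambda>n \<Lambda>. \<Lambda> n) UNIV \<and>
     (\<forall>n. distr \<nu> (count_space {1..}) (\<lambda>\<Lambda>. \<Lambda> n) = distr \<nu> (count_space {1..}) (\<lambda>\<Lambda>. \<Lambda> 0))"

definition stack_center :: "(int \<Rightarrow> nat) \<Rightarrow> int \<Rightarrow> int" where
  "stack_center \<Lambda> n =
     (if n = 0 then 0
      else if n \<ge> 1 then int (\<Lambda> 0) + 2 * (\<Sum>i=1..n - 1. int (\<Lambda> i)) + int (\<Lambda> n)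
      else - int (\<Lambda> 0) - 2 * (\<Sum>i=1..- n - 1. int (\<Lambda> (- i))) - int (\<Lambda> n))"

definition prod_box :: "'a set \<Rightarrow> 'a set set \<Rightarrow> 'a \<Rightarrow> int \<Rightarrow> nat \<Rightarrow> ('a \<times> int) set" where
  "prod_box V E v\<^sub>0 a r = graph_ball V E v\<^sub>0 r \<times> {a - int r..a + int r}"

definition stack_region :: "'a set \<Rightarrow> 'a set set \<Rightarrow> 'a \<Rightarrow> (int \<Rightarrow> nat) \<Rightarrow> ('a \<times> int) set" where
  "stack_region V E v\<^sub>0 \<Lambda> = (\<Union>n. prod_box V E v\<^sub>0 (stack_center \<Lambda> n) (\<Lambda> n))"

definition stack_theta ::
  "'a set \<Rightarrow> 'a set set \<Rightarrow> 'a \<Rightarrow> (int \<Rightarrow> nat) \<Rightarrow> real \<Rightarrow> real \<Rightarrow> real" where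
  "stack_theta V E v\<^sub>0 \<Lambda> p q =
     percolation_prob (prod_Z_edges V E)
       (\<lambda>e. if e \<subseteq> stack_region V E v\<^sub>0 \<Lambda> then q else p) (v\<^sub>0, 0)"

end

theory Submission imports Defs begin

text \<open>
  Finite edge sets: probabilities of events that depend on a finite edge set are finite sums over
  the sets of open edges, and the infinite measure enters only through exhaustion.

  Subcritical decay is obtained by the argument of Duminil-Copin and Tassion: if every finite
  \<open>S \<ni> x\<close> had \<open>\<phi>\<^sub>p(x, S) = p \<Sum>\<^sub>y\<^sub>z P\<^sub>p(x \<leftrightarrow> y in S) \<ge> 1\<close>, the sum being over the boundary edges of
  \<open>S\<close>, then Russo's formula would give percolation at every \<open>p' > p\<close>; and a set with
  \<open>\<phi>\<^sub>p(x, S) < 1\<close> for each of the finitely many orbits of vertices gives exponential decay,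
  uniformly in the starting vertex.

  By independence and the moment condition, almost every environment has infinitely many windows of
  \<open>N\<close> boxes of the same small size such that the box at distance \<open>k\<close> before the window has size at
  most \<open>2 exp(2 \<epsilon> k)\<close>. At such a window all edges are closed with probability bounded below, and then
  a path can pass it only through edges outside the stack; by exponential decay this jump has
  probability at most \<open>1/2\<close>. As these events are nearly independent for windows far apart, the
  cluster of the origin does not reach arbitrarily far boxes. An infinite path that visits finitely
  many boxes is eventually a path of homogeneous subcritical percolation.
\<close>

section \<open>Finite product expectations\<close>

text \<open>The moment condition is consumed in a race of exponentials. The ball of a box has at
  least as many vertices as its radius, so the box has at most twice the square of the size of its
  ball; a logarithmic bound linear in the distance \<open>k\<close> gives the growth rate
  \<open>exp (2 * \<epsilon>)\<close>, against a subcritical decay rate \<open>r < 1\<close>. Hence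
  \<open>\<epsilon>\<close> depends on \<open>p\<close> through \<open>r\<close>, and an environment
  is called good only if it serves all \<open>\<epsilon>\<close> of the form
  \<open>1 / (m + 1)\<close>; this makes the null set independent of \<open>p\<close> and
  \<open>q\<close>.

  A window has \<open>N\<close> boxes so that the jumps over it start in the tail of a convergent
  series. Their common size is an atom of the law, so that the price of closing a window is the same
  at all of them.

  The dependence between windows is avoided by a recursion: if \<open>u a\<close> is the probability
  of reaching a box of index at least \<open>a\<close>, a finite edge set nearly realises it, and a
  window beyond that set yields \<open>u b \<le> (1 - \<delta>) * u a + \<eta>\<close>. No rate for
  the spacing of windows enters.

  A configuration is its set of open edges, so that monotonicity, restriction and independence read
  as inclusion, intersection and disjointness.\<close>

definition bexp :: "('e \<Rightarrow> real) \<Rightarrow> 'e set \<Rightarrow> ('e set \<Rightarrow> real) \<Rightarrow> real" where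
  "bexp pr F f = (\<Sum>\<omega>\<in>Pow F. (\<Prod>e\<in>\<omega>. pr e) * (\<Prod>e\<in>F - \<omega>. 1 - pr e) * f \<omega>)"

abbreviation bprob :: "('e \<Rightarrow> real) \<Rightarrow> 'e set \<Rightarrow> ('e set \<Rightarrow> bool) \<Rightarrow> real" where
  "bprob pr F A \<equiv> bexp pr F (\<lambda>\<omega>. of_bool (A \<omega>))"

lemma of_bool_leI: "(A \<Longrightarrow> B) \<Longrightarrow> (of_bool A :: real) \<le> of_bool B"
  by simp

lemma of_bool_bex_le_sum:
  assumes "finite X"
  shows "(of_bool (\<exists>x\<in>X. B x) :: real) \<le> (\<Sum>x\<in>X. of_bool (B x))"
proof (cases "\<exists>x\<in>X. B x")
  case True
  then obtain x where x: "x \<in> X" "B x" by blast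
  have "of_bool (B x) \<le> (\<Sum>x\<in>X. of_bool (B x) :: real)"
    using x assms by (intro member_le_sum) auto
  then show ?thesis using True x by simp
qed (simp add: sum_nonneg)

lemma bexp_empty [simp]: "bexp pr {} f = f {}"
  by (simp add: bexp_def)

text \<open>Conditioning on the state of one edge; the inductions over the edge set all run on this
  recursion.\<close>

lemma bexp_insert:
  assumes "finite F" "e \<notin> F"
  shows "bexp pr (insert e F) f = pr e * bexp pr F (\<lambda>\<omega>. f (insert e \<omega>)) + (1 - pr e) * bexp pr F f"
proof -
  have disj: "Pow F \<inter> insert e ` Pow F = {}" using assms by auto
  have inj: "inj_on (insert e) (Pow F)"
    using assms by (auto simp: inj_on_def insert_ident)
  have "bexp pr (insert e F) f =
      (\<Sum>\<omega>\<in>Pow F. (\<Prod>e\<in>\<omega>. pr e) * (\<Prod>e\<in>insert e F - \<omega>. 1 - pr e) * f \<omega>) +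
      (\<Sum>\<omega>\<in>Pow F. (\<Prod>e\<in>insert e \<omega>. pr e) * (\<Prod>e\<in>insert e F - insert e \<omega>. 1 - pr e) * f (insert e \<omega>))"
    unfolding bexp_def Pow_insert
    using assms disj by (subst sum.union_disjoint) (auto simp: sum.reindex[OF inj])
  also have "(\<Sum>\<omega>\<in>Pow F. (\<Prod>e\<in>\<omega>. pr e) * (\<Prod>e\<in>insert e F - \<omega>. 1 - pr e) * f \<omega>) = (1 - pr e) * bexp pr F f"
    unfolding bexp_def sum_distrib_left
  proof (rule sum.cong[OF refl])
    fix \<omega> assume w: "\<omega> \<in> Pow F"
    then have "insert e F - \<omega> = insert e (F - \<omega>)" using assms by auto
    moreover have "e \<notin> F - \<omega>" "finite (F - \<omega>)" using assms by auto
    ultimately show "(\<Prod>e\<in>\<omega>. pr e) * (\<Prod>e\<in>insert e F - \<omega>. 1 - pr e) * f \<omega> =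
      (1 - pr e) * ((\<Prod>e\<in>\<omega>. pr e) * (\<Prod>e\<in>F - \<omega>. 1 - pr e) * f \<omega>)"
      by simp
  qed
  also have "(\<Sum>\<omega>\<in>Pow F. (\<Prod>e\<in>insert e \<omega>. pr e) * (\<Prod>e\<in>insert e F - insert e \<omega>. 1 - pr e) * f (insert e \<omega>))
      = pr e * bexp pr F (\<lambda>\<omega>. f (insert e \<omega>))"
    unfolding bexp_def sum_distrib_left
  proof (rule sum.cong[OF refl])
    fix \<omega> assume w: "\<omega> \<in> Pow F"
    then have "insert e F - insert e \<omega> = F - \<omega>" "e \<notin> \<omega>" "finite \<omega>"
      using assms by (auto intro: finite_subset)
    then show "(\<Prod>e\<in>insert e \<omega>. pr e) * (\<Prod>e\<in>insert e F - insert e \<omega>. 1 - pr e) * f (insert e \<omega>) =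
      pr e * ((\<Prod>e\<in>\<omega>. pr e) * (\<Prod>e\<in>F - \<omega>. 1 - pr e) * f (insert e \<omega>))"
      by simp
  qed
  finally show ?thesis by simp
qed

lemma bexp_cong:
  assumes "\<And>e. e \<in> F \<Longrightarrow> pr e = pr' e" "\<And>\<omega>. \<omega> \<subseteq> F \<Longrightarrow> f \<omega> = g \<omega>"
  shows "bexp pr F f = bexp pr' F g"
  unfolding bexp_def
proof (intro sum.cong refl)
  fix \<omega> assume "\<omega> \<in> Pow F"
  then have "(\<Prod>e\<in>\<omega>. pr e) = (\<Prod>e\<in>\<omega>. pr' e)" "f \<omega> = g \<omega>"
    "(\<Prod>e\<in>F-\<omega>. 1 - pr e) = (\<Prod>e\<in>F-\<omega>. 1 - pr' e)"
    using assms by (auto intro!: prod.cong)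
  then show "(\<Prod>e\<in>\<omega>. pr e) * (\<Prod>e\<in>F-\<omega>. 1 - pr e) * f \<omega> = (\<Prod>e\<in>\<omega>. pr' e) * (\<Prod>e\<in>F-\<omega>. 1 - pr' e) * g \<omega>"
    by simp
qed

lemma bexp_add: "bexp pr F (\<lambda>\<omega>. f \<omega> + g \<omega>) = bexp pr F f + bexp pr F g"
  by (simp add: bexp_def distrib_left sum.distrib)

lemma bexp_diff: "bexp pr F (\<lambda>\<omega>. f \<omega> - g \<omega>) = bexp pr F f - bexp pr F g"
  by (simp add: bexp_def right_diff_distrib sum_subtractf)

lemma bexp_cmult: "bexp pr F (\<lambda>\<omega>. c * f \<omega>) = c * bexp pr F f"
  by (simp add: bexp_def sum_distrib_left algebra_simps)

lemma bexp_sum: "bexp pr F (\<lambda>\<omega>. \<Sum>i\<in>I. f i \<omega>) = (\<Sum>i\<in>I. bexp pr F (f i))"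
  unfolding bexp_def sum_distrib_left by (rule sum.swap)

lemma bexp_const: "finite F \<Longrightarrow> bexp pr F (\<lambda>_. c) = c"
  by (induction F rule: finite_induct) (auto simp: bexp_insert algebra_simps)

lemma bexp_mono:
  assumes "\<And>e. e \<in> F \<Longrightarrow> 0 \<le> pr e \<and> pr e \<le> 1" "\<And>\<omega>. \<omega> \<subseteq> F \<Longrightarrow> f \<omega> \<le> g \<omega>"
  shows "bexp pr F f \<le> bexp pr F g"
  unfolding bexp_def
  using assms by (intro sum_mono mult_left_mono mult_nonneg_nonneg prod_nonneg) (auto simp: subset_iff)

lemma bexp_nonneg:
  assumes "\<And>e. e \<in> F \<Longrightarrow> 0 \<le> pr e \<and> pr e \<le> 1" "\<And>\<omega>. \<omega> \<subseteq> F \<Longrightarrow> 0 \<le> f \<omega>"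
  shows "0 \<le> bexp pr F f"
  unfolding bexp_def
  using assms by (intro sum_nonneg mult_nonneg_nonneg prod_nonneg) (auto simp: subset_iff)

lemma bprob_le_1:
  assumes "finite F" "\<And>e. e \<in> F \<Longrightarrow> 0 \<le> pr e \<and> pr e \<le> 1"
  shows "bprob pr F A \<le> 1"
proof -
  have "bprob pr F A \<le> bexp pr F (\<lambda>_. 1)"
    using assms by (intro bexp_mono) auto
  then show ?thesis using assms by (simp add: bexp_const)
qed

lemma bprob_not:
  assumes "finite F"
  shows "bprob pr F (\<lambda>\<omega>. \<not> A \<omega>) = 1 - bprob pr F A"
proof -
  have "bprob pr F (\<lambda>\<omega>. \<not> A \<omega>) = bexp pr F (\<lambda>\<omega>. 1 - of_bool (A \<omega>))"
    by (intro bexp_cong) auto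
  then show ?thesis using assms by (simp add: bexp_diff bexp_const)
qed

text \<open>Fubini for two disjoint edge sets.\<close>

lemma bexp_Un:
  assumes "finite F" "finite F'" "F \<inter> F' = {}"
  shows "bexp pr (F \<union> F') f = bexp pr F (\<lambda>\<omega>. bexp pr F' (\<lambda>\<omega>'. f (\<omega> \<union> \<omega>')))"
  using assms
proof (induction F arbitrary: f rule: finite_induct)
  case (insert e F)
  then have "e \<notin> F \<union> F'" "finite (F \<union> F')" "F \<inter> F' = {}" by auto
  then show ?case using insert
    by (simp add: bexp_insert)
qed simp

lemma bexp_restrict:
  assumes "finite F" "F1 \<subseteq> F"
  shows "bexp pr F (\<lambda>\<omega>. f (\<omega> \<inter> F1)) = bexp pr F1 f"
proof -
  have fin: "finite F1" "finite (F - F1)" using assms finite_subset by auto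
  have "bexp pr F (\<lambda>\<omega>. f (\<omega> \<inter> F1)) = bexp pr (F1 \<union> (F - F1)) (\<lambda>\<omega>. f (\<omega> \<inter> F1))"
    using assms by (simp add: Un_absorb1)
  also have "\<dots> = bexp pr F1 (\<lambda>\<omega>. bexp pr (F - F1) (\<lambda>\<omega>'. f ((\<omega> \<union> \<omega>') \<inter> F1)))"
    using fin by (intro bexp_Un) auto
  also have "\<dots> = bexp pr F1 (\<lambda>\<omega>. bexp pr (F - F1) (\<lambda>\<omega>'. f \<omega>))"
  proof (intro bexp_cong refl arg_cong[where f = f])
    fix \<omega> \<omega>' assume "\<omega> \<subseteq> F1" "\<omega>' \<subseteq> F - F1"
    then show "(\<omega> \<union> \<omega>') \<inter> F1 = \<omega>" by auto
  qed
  also have "\<dots> = bexp pr F1 f" using fin by (simp add: bexp_const)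
  finally show ?thesis .
qed

text \<open>Independence over disjoint edge sets, by Fubini. It is stated for functions rather than
  events, so that one factor may itself be a product and be split again.\<close>

lemma bexp_indep:
  assumes "finite F" "F1 \<subseteq> F" "F2 \<subseteq> F" "F1 \<inter> F2 = {}"
  shows "bexp pr F (\<lambda>\<omega>. f (\<omega> \<inter> F1) * g (\<omega> \<inter> F2)) = bexp pr F1 f * bexp pr F2 g"
proof -
  have fin: "finite F1" "finite F2"
    using finite_subset[OF assms(2,1)] finite_subset[OF assms(3,1)] by auto
  have "bexp pr F (\<lambda>\<omega>. f (\<omega> \<inter> F1) * g (\<omega> \<inter> F2)) =
    bexp pr F (\<lambda>\<omega>. (\<lambda>\<omega>. f (\<omega> \<inter> F1) * g (\<omega> \<inter> F2)) (\<omega> \<inter> (F1 \<union> F2)))"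
    by (simp add: inf_assoc Int_absorb1)
  also have "\<dots> = bexp pr (F1 \<union> F2) (\<lambda>\<omega>. f (\<omega> \<inter> F1) * g (\<omega> \<inter> F2))"
    using assms by (intro bexp_restrict) auto
  also have "\<dots> = bexp pr F1 (\<lambda>\<omega>. bexp pr F2 (\<lambda>\<omega>'. f ((\<omega> \<union> \<omega>') \<inter> F1) * g ((\<omega> \<union> \<omega>') \<inter> F2)))"
    using fin assms by (intro bexp_Un) auto
  also have "\<dots> = bexp pr F1 (\<lambda>\<omega>. bexp pr F2 (\<lambda>\<omega>'. f \<omega> * g \<omega>'))"
  proof (intro bexp_cong refl)
    fix \<omega> \<omega>' assume "\<omega> \<subseteq> F1" "\<omega>' \<subseteq> F2"
    then have "(\<omega> \<union> \<omega>') \<inter> F1 = \<omega>" "(\<omega> \<union> \<omega>') \<inter> F2 = \<omega>'" using assms by auto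
    then show "f ((\<omega> \<union> \<omega>') \<inter> F1) * g ((\<omega> \<union> \<omega>') \<inter> F2) = f \<omega> * g \<omega>'" by simp
  qed
  also have "\<dots> = bexp pr F1 f * bexp pr F2 g"
    by (simp add: bexp_cmult) (simp add: mult.commute[of _ "bexp pr F2 g"] bexp_cmult)
  finally show ?thesis .
qed

text \<open>Invariance under relabelling of the edges; it serves for the action of graph
  automorphisms.\<close>

lemma bexp_image:
  assumes "inj_on h F"
  shows "bexp pr (h ` F) f = bexp (\<lambda>e. pr (h e)) F (\<lambda>\<omega>. f (h ` \<omega>))"
proof -
  have inj: "inj_on ((`) h) (Pow F)"
    using assms by (rule inj_on_image_Pow)
  have P: "Pow (h ` F) = (`) h ` Pow F" by (simp add: image_Pow_surj)
  show ?thesis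
    unfolding bexp_def P sum.reindex[OF inj] o_def
  proof (intro sum.cong refl)
    fix \<omega> assume w: "\<omega> \<in> Pow F"
    have i: "inj_on h \<omega>" "inj_on h (F - \<omega>)" using assms w by (auto intro: inj_on_subset)
    have "h ` F - h ` \<omega> = h ` (F - \<omega>)"
      using assms w by (simp add: inj_on_image_set_diff)
    then show "(\<Prod>e\<in>h ` \<omega>. pr e) * (\<Prod>e\<in>h ` F - h ` \<omega>. 1 - pr e) * f (h ` \<omega>) =
      (\<Prod>e\<in>\<omega>. pr (h e)) * (\<Prod>e\<in>F - \<omega>. 1 - pr (h e)) * f (h ` \<omega>)"
      using i by (simp add: prod.reindex)
  qed
qed

lemma bprob_all_open:
  assumes "finite F" "K \<subseteq> F"
  shows "bprob pr F (\<lambda>\<omega>. K \<subseteq> \<omega>) = (\<Prod>e\<in>K. pr e)"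
proof -
  have "bprob pr F (\<lambda>\<omega>. K \<subseteq> \<omega>) = bprob pr F (\<lambda>\<omega>. K \<subseteq> \<omega> \<inter> K)"
    by (intro bexp_cong) auto
  also have "\<dots> = bprob pr K (\<lambda>\<omega>. K \<subseteq> \<omega>)"
    using assms by (intro bexp_restrict) auto
  also have "\<dots> = (\<Sum>\<omega>\<in>{K}. (\<Prod>e\<in>\<omega>. pr e) * (\<Prod>e\<in>K - \<omega>. 1 - pr e))"
    unfolding bexp_def using finite_subset[OF assms(2,1)]
    by (intro sum.mono_neutral_cong_right) auto
  finally show ?thesis by simp
qed

lemma bprob_all_closed:
  assumes "finite F" "K \<subseteq> F"
  shows "bprob pr F (\<lambda>\<omega>. \<omega> \<inter> K = {}) = (\<Prod>e\<in>K. 1 - pr e)"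
proof -
  have "bprob pr F (\<lambda>\<omega>. \<omega> \<inter> K = {}) = bprob pr K (\<lambda>\<omega>. \<omega> = {})"
    using assms by (intro bexp_restrict) auto
  also have "\<dots> = (\<Sum>\<omega>\<in>{{}}. (\<Prod>e\<in>\<omega>. pr e) * (\<Prod>e\<in>K - \<omega>. 1 - pr e))"
    unfolding bexp_def using finite_subset[OF assms(2,1)]
    by (intro sum.mono_neutral_cong_right) auto
  finally show ?thesis by simp
qed

text \<open>Russo's formula.\<close>
lemma bexp_has_field_derivative:
  assumes "finite F"
  shows "((\<lambda>t. bexp (\<lambda>_. t) F f) has_field_derivative
     (\<Sum>e\<in>F. bexp (\<lambda>_. t) F (\<lambda>\<omega>. f (insert e \<omega>) - f (\<omega> - {e})))) (at t)"
  using assms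
proof (induction F arbitrary: f rule: finite_induct)
  case (insert a F)
  let ?D = "\<lambda>f F. (\<Sum>e\<in>F. bexp (\<lambda>_. t) F (\<lambda>\<omega>. f (insert e \<omega>) - f (\<omega> - {e})))"
  let ?fa = "\<lambda>\<omega>. f (insert a \<omega>)"
  \<comment> \<open>The product rule for this recursion yields the term of the edge \<open>a\<close>
    plus a mixture of the derivatives for \<open>?fa\<close> and \<open>f\<close>; this is why the
    induction keeps the function arbitrary.\<close>
  have eq: "(\<lambda>t. bexp (\<lambda>_. t) (insert a F) f) =
    (\<lambda>t. t * bexp (\<lambda>_. t) F ?fa + (1 - t) * bexp (\<lambda>_. t) F f)"
    using insert by (simp add: bexp_insert)
  have sum: "(\<Sum>e\<in>F. bexp (\<lambda>_. t) (insert a F) (\<lambda>\<omega>. f (insert e \<omega>) - f (\<omega> - {e}))) =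
     t * ?D ?fa F + (1 - t) * ?D f F"
    unfolding sum_distrib_left sum.distrib[symmetric]
  proof (intro sum.cong refl)
    fix e assume e: "e \<in> F"
    then have "\<omega> \<subseteq> F \<Longrightarrow> insert a \<omega> - {e} = insert a (\<omega> - {e})" for \<omega> using insert by auto
    then have "bexp (\<lambda>_. t) F (\<lambda>\<omega>. f (insert e (insert a \<omega>)) - f (insert a \<omega> - {e})) =
       bexp (\<lambda>_. t) F (\<lambda>\<omega>. ?fa (insert e \<omega>) - ?fa (\<omega> - {e}))"
      by (intro bexp_cong) (auto simp: insert_commute)
    then show "bexp (\<lambda>_. t) (insert a F) (\<lambda>\<omega>. f (insert e \<omega>) - f (\<omega> - {e})) =
      t * bexp (\<lambda>_. t) F (\<lambda>\<omega>. ?fa (insert e \<omega>) - ?fa (\<omega> - {e})) +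
      (1 - t) * bexp (\<lambda>_. t) F (\<lambda>\<omega>. f (insert e \<omega>) - f (\<omega> - {e}))"
      using insert by (simp add: bexp_insert)
  qed
  have a: "bexp (\<lambda>_. t) (insert a F) (\<lambda>\<omega>. f (insert a \<omega>) - f (\<omega> - {a})) =
     bexp (\<lambda>_. t) F ?fa - bexp (\<lambda>_. t) F f"
  proof -
    have "bexp (\<lambda>_. t) F (\<lambda>\<omega>. f (insert a \<omega>) - f (\<omega> - {a})) =
      bexp (\<lambda>_. t) F (\<lambda>\<omega>. f (insert a \<omega>) - f \<omega>)"
      using insert by (intro bexp_cong) (auto intro!: arg_cong[where f = f])
    moreover have "bexp (\<lambda>_. t) F (\<lambda>\<omega>. f (insert a \<omega>) - f (insert a \<omega> - {a})) =
      bexp (\<lambda>_. t) F (\<lambda>\<omega>. f (insert a \<omega>) - f \<omega>)"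
      using insert by (intro bexp_cong) (auto intro!: arg_cong[where f = f])
    ultimately show ?thesis
      using insert by (simp add: bexp_insert bexp_diff algebra_simps)
  qed
  have "((\<lambda>t. t * bexp (\<lambda>_. t) F ?fa + (1 - t) * bexp (\<lambda>_. t) F f) has_field_derivative
     bexp (\<lambda>_. t) F ?fa - bexp (\<lambda>_. t) F f + (t * ?D ?fa F + (1 - t) * ?D f F)) (at t)"
    by (rule derivative_eq_intros insert.IH refl)+ (simp add: algebra_simps)
  then show ?case
    unfolding eq using insert sum a by simp
qed simp

text \<open>For an increasing event every summand in Russo's formula is nonnegative; this takes the
  place of a coupling.\<close>

lemma bprob_mono_param:
  assumes "finite F" "0 \<le> p" "p \<le> p'" "p' \<le> 1"
    and inc: "\<And>\<omega> \<omega>'. \<omega> \<subseteq> \<omega>' \<Longrightarrow> A \<omega> \<Longrightarrow> A \<omega>'"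
  shows "bprob (\<lambda>_. p) F A \<le> bprob (\<lambda>_. p') F A"
proof (rule DERIV_nonneg_imp_nondecreasing[OF \<open>p \<le> p'\<close>])
  fix t assume t: "p \<le> t" "t \<le> p'"
  let ?D = "(\<Sum>e\<in>F. bexp (\<lambda>_. t) F (\<lambda>\<omega>. of_bool (A (insert e \<omega>)) - of_bool (A (\<omega> - {e}))))"
  have "?D \<ge> 0"
  proof (intro sum_nonneg bexp_nonneg)
    fix e \<omega> show "0 \<le> (of_bool (A (insert e \<omega>)) - of_bool (A (\<omega> - {e})) :: real)"
      using inc[of "\<omega> - {e}" "insert e \<omega>"] by auto
  qed (use t assms in auto)
  then show "\<exists>y. ((\<lambda>t. bprob (\<lambda>_. t) F A) has_field_derivative y) (at t) \<and> 0 \<le> y"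
    using bexp_has_field_derivative[OF \<open>finite F\<close>, of "\<lambda>\<omega>. of_bool (A \<omega>)"] by blast
qed

lemma bprob_mono_edges:
  assumes "finite F" "F1 \<subseteq> F" "\<And>e. e \<in> F \<Longrightarrow> 0 \<le> pr e \<and> pr e \<le> 1"
    and inc: "\<And>\<omega> \<omega>'. \<omega> \<subseteq> \<omega>' \<Longrightarrow> A \<omega> \<Longrightarrow> A \<omega>'"
  shows "bprob pr F1 A \<le> bprob pr F A"
proof -
  have "bprob pr F1 A = bprob pr F (\<lambda>\<omega>. A (\<omega> \<inter> F1))"
    using assms by (subst bexp_restrict) auto
  also have "\<dots> \<le> bprob pr F A"
  proof (intro bexp_mono)
    fix \<omega> show "of_bool (A (\<omega> \<inter> F1)) \<le> (of_bool (A \<omega>) :: real)"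
      using inc[of "\<omega> \<inter> F1" \<omega>] by auto
  qed (use assms in auto)
  finally show ?thesis .
qed

section \<open>From finite edge sets to the infinite product measure\<close>

lemma prob_space_percolation: "prob_space (percolation_measure I pr)"
  unfolding percolation_measure_def by (intro prob_space_PiM prob_space_measure_pmf)

lemma space_percolation [simp]: "space (percolation_measure I pr) = PiE I (\<lambda>_. UNIV)"
  by (simp add: percolation_measure_def space_PiM)

lemma cylinder_singleton_measure:
  assumes "finite F" "F \<subseteq> I" "S \<subseteq> F" and pr: "\<And>e. e \<in> F \<Longrightarrow> 0 \<le> pr e \<and> pr e \<le> 1"
  defines "M \<equiv> percolation_measure I pr"
  shows "{\<omega>\<in>space M. {e\<in>F. \<omega> e} = S} \<in> sets M"
    and "measure M {\<omega>\<in>space M. {e\<in>F. \<omega> e} = S} = (\<Prod>e\<in>S. pr e) * (\<Prod>e\<in>F - S. 1 - pr e)"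
proof -
  interpret product_prob_space "\<lambda>e. measure_pmf (bernoulli_pmf (pr e))" I
    by (intro product_prob_spaceI prob_space_measure_pmf)
  let ?M = "\<lambda>e. measure_pmf (bernoulli_pmf (pr e))"
  let ?X = "\<lambda>e. {e \<in> S}"
  have eq: "{\<omega>\<in>space M. {e\<in>F. \<omega> e} = S} = {\<omega>\<in>space (PiM I ?M). \<forall>e\<in>F. \<omega> e \<in> ?X e}"
    using assms by (auto simp: percolation_measure_def)
  have eq2: "{\<omega>\<in>space (PiM I ?M). \<forall>e\<in>F. \<omega> e \<in> ?X e} = prod_emb I ?M F (Pi\<^sub>E F ?X)"
    unfolding prod_emb_def using assms by (auto simp: space_PiM Pi_iff)
  show "{\<omega>\<in>space M. {e\<in>F. \<omega> e} = S} \<in> sets M"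
    unfolding eq eq2 unfolding M_def percolation_measure_def
    using assms by (intro sets_PiM_I) auto
  have "measure M {\<omega>\<in>space M. {e\<in>F. \<omega> e} = S} = (\<Prod>e\<in>F. measure (?M e) (?X e))"
    unfolding eq eq2 unfolding M_def percolation_measure_def
    using assms by (intro measure_PiM_emb) auto
  also have "\<dots> = (\<Prod>e\<in>F. if e \<in> S then pr e else 1 - pr e)"
    using pr by (intro prod.cong) (auto simp: measure_pmf_single)
  also have "\<dots> = (\<Prod>e\<in>S. pr e) * (\<Prod>e\<in>F - S. 1 - pr e)"
  proof -
    have "(\<Prod>e\<in>F. if e \<in> S then pr e else 1 - pr e) =
       (\<Prod>e\<in>S. if e \<in> S then pr e else 1 - pr e) * (\<Prod>e\<in>F - S. if e \<in> S then pr e else 1 - pr e)"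
      by (subst prod.subset_diff[OF \<open>S \<subseteq> F\<close> \<open>finite F\<close>]) (rule mult.commute)
    moreover have "(\<Prod>e\<in>F - S. if e \<in> S then pr e else 1 - pr e) = (\<Prod>e\<in>F - S. 1 - pr e)"
      by (intro prod.cong) auto
    ultimately show ?thesis by simp
  qed
  finally show "measure M {\<omega>\<in>space M. {e\<in>F. \<omega> e} = S} = (\<Prod>e\<in>S. pr e) * (\<Prod>e\<in>F - S. 1 - pr e)" .
qed

lemma cylinder_measure:
  assumes "finite F" "F \<subseteq> I" and pr: "\<And>e. e \<in> F \<Longrightarrow> 0 \<le> pr e \<and> pr e \<le> 1"
  defines "M \<equiv> percolation_measure I pr"
  shows "{\<omega>\<in>space M. A {e\<in>F. \<omega> e}} \<in> sets M"
    and "measure M {\<omega>\<in>space M. A {e\<in>F. \<omega> e}} = bprob pr F A"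
proof -
  interpret prob_space M unfolding M_def by (rule prob_space_percolation)
  let ?C = "\<lambda>S. {\<omega>\<in>space M. {e\<in>F. \<omega> e} = S}"
  have eq: "{\<omega>\<in>space M. A {e\<in>F. \<omega> e}} = (\<Union>S\<in>{S\<in>Pow F. A S}. ?C S)" by auto
  have fin: "finite {S\<in>Pow F. A S}" using assms by simp
  have C: "?C S \<in> sets M" if "S \<subseteq> F" for S
    unfolding M_def using assms that by (intro cylinder_singleton_measure) auto
  show "{\<omega>\<in>space M. A {e\<in>F. \<omega> e}} \<in> sets M"
    unfolding eq using C fin by (intro sets.finite_UN) auto
  have "measure M {\<omega>\<in>space M. A {e\<in>F. \<omega> e}} = (\<Sum>S\<in>{S\<in>Pow F. A S}. measure M (?C S))"
    unfolding eq using C fin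
    by (intro finite_measure_finite_Union) (auto simp: disjoint_family_on_def)
  also have "\<dots> = (\<Sum>S\<in>{S\<in>Pow F. A S}. (\<Prod>e\<in>S. pr e) * (\<Prod>e\<in>F - S. 1 - pr e))"
    unfolding M_def using assms by (intro sum.cong refl cylinder_singleton_measure) auto
  also have "\<dots> = bprob pr F A"
    unfolding bexp_def using assms by (intro sum.mono_neutral_cong_left) auto
  finally show "measure M {\<omega>\<in>space M. A {e\<in>F. \<omega> e}} = bprob pr F A" .
qed

text \<open>An increasing event that is witnessed by finitely many open edges is the increasing
  union of cylinder events along an exhaustion of \<open>I\<close>. Continuity from below therefore
  gives its measurability and turns a bound uniform over finite edge sets into a bound for the
  infinite product.\<close>

lemma finitary_event_measure_le:
  assumes "countable I" and pr: "\<And>e. e \<in> I \<Longrightarrow> 0 \<le> pr e \<and> pr e \<le> 1"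
    and inc: "\<And>\<omega> \<omega>'. \<omega> \<subseteq> \<omega>' \<Longrightarrow> A \<omega> \<Longrightarrow> A \<omega>'"
    and finitary: "\<And>\<omega>. A \<omega> \<Longrightarrow> \<exists>F. finite F \<and> F \<subseteq> \<omega> \<and> A F"
    and bound: "\<And>F. finite F \<Longrightarrow> F \<subseteq> I \<Longrightarrow> bprob pr F A \<le> \<eta>"
  defines "M \<equiv> percolation_measure I pr"
  shows "{\<omega>\<in>space M. A {e\<in>I. \<omega> e}} \<in> sets M" and "measure M {\<omega>\<in>space M. A {e\<in>I. \<omega> e}} \<le> \<eta>"
proof -
  interpret prob_space M unfolding M_def by (rule prob_space_percolation)
  obtain F :: "nat \<Rightarrow> 'a set set" where F: "\<And>n. finite (F n)" "\<And>n. F n \<subseteq> I" "incseq F" "I = (\<Union>n. F n)"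
  proof -
    let ?F = "\<lambda>n. {e\<in>I. to_nat_on I e < n}"
    have "finite (?F n)" for n
    proof -
      have "to_nat_on I ` ?F n \<subseteq> {..<n}" by auto
      then show ?thesis
        using assms by (intro inj_on_finite[of "to_nat_on I" "?F n" "{..<n}"] inj_on_subset[OF inj_on_to_nat_on]) auto
    qed
    moreover have "I = (\<Union>n. ?F n)" by auto
    ultimately show ?thesis by (intro that[of ?F]) (auto simp: incseq_def)
  qed
  let ?C = "\<lambda>n. {\<omega>\<in>space M. A {e\<in>F n. \<omega> e}}"
  have pr': "0 \<le> pr e \<and> pr e \<le> 1" if "e \<in> F n" for e n
    using pr F(2) that by blast
  have C: "?C n \<in> sets M" for n
    unfolding M_def using F(1,2) pr' by (intro cylinder_measure)
  have eq: "{\<omega>\<in>space M. A {e\<in>I. \<omega> e}} = (\<Union>n. ?C n)"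
  proof (intro equalityI subsetI)
    fix \<omega> assume w: "\<omega> \<in> {\<omega>\<in>space M. A {e\<in>I. \<omega> e}}"
    then obtain F0 where F0: "finite F0" "F0 \<subseteq> {e\<in>I. \<omega> e}" "A F0" using finitary by blast
    have "\<forall>e\<in>F0. \<exists>n. e \<in> F n" using F0(2) F(4) by blast
    then obtain N where N: "\<And>e. e \<in> F0 \<Longrightarrow> e \<in> F (N e)" by metis
    have "F0 \<subseteq> F (Max (N ` F0))"
    proof
      fix e assume e: "e \<in> F0"
      then have "N e \<le> Max (N ` F0)" using F0(1) by simp
      then show "e \<in> F (Max (N ` F0))" using N[OF e] F(3) by (auto simp: incseq_def)
    qed
    then obtain n where "F0 \<subseteq> F n" by blast
    then have "F0 \<subseteq> {e\<in>F n. \<omega> e}" using F0 by auto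
    then show "\<omega> \<in> (\<Union>n. ?C n)" using inc F0 w by blast
  next
    fix \<omega> assume "\<omega> \<in> (\<Union>n. ?C n)"
    then obtain n where n: "\<omega> \<in> ?C n" by blast
    moreover have "{e\<in>F n. \<omega> e} \<subseteq> {e\<in>I. \<omega> e}" using F by auto
    ultimately show "\<omega> \<in> {\<omega>\<in>space M. A {e\<in>I. \<omega> e}}" using inc by blast
  qed
  show "{\<omega>\<in>space M. A {e\<in>I. \<omega> e}} \<in> sets M" unfolding eq using C by auto
  have "incseq ?C"
  proof (intro incseq_SucI subsetI)
    fix n \<omega> assume "\<omega> \<in> ?C n"
    moreover have "{e\<in>F n. \<omega> e} \<subseteq> {e\<in>F (Suc n). \<omega> e}"
      using F(3) by (auto simp: incseq_Suc_iff)
    ultimately show "\<omega> \<in> ?C (Suc n)" using inc by blast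
  qed
  then have "(\<lambda>n. measure M (?C n)) \<longlonglongrightarrow> measure M (\<Union>n. ?C n)"
    using C by (intro finite_Lim_measure_incseq) auto
  moreover have "measure M (?C n) \<le> \<eta>" for n
    unfolding M_def using bound[OF F(1,2)] by (subst cylinder_measure(2)[OF F(1,2) pr'])
  ultimately show "measure M {\<omega>\<in>space M. A {e\<in>I. \<omega> e}} \<le> \<eta>"
    unfolding eq by (intro LIMSEQ_le_const2) auto
qed

section \<open>Sharpness of the phase transition\<close>

definition conn :: "'b set set \<Rightarrow> 'b \<Rightarrow> 'b \<Rightarrow> bool" where
  "conn \<omega> x y \<longleftrightarrow> (x, y) \<in> (adj_rel \<omega>)\<^sup>*"

definition edges_in :: "'b set \<Rightarrow> 'b set set \<Rightarrow> 'b set set" where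
  "edges_in S \<omega> = {e\<in>\<omega>. e \<subseteq> S}"

definition touching :: "'b set \<Rightarrow> 'b set set \<Rightarrow> 'b set set" where
  "touching S \<omega> = {e\<in>\<omega>. e \<inter> S \<noteq> {}}"

lemma conn_refl [simp]: "conn \<omega> x x"
  by (simp add: conn_def)

lemma conn_trans: "conn \<omega> x y \<Longrightarrow> conn \<omega> y z \<Longrightarrow> conn \<omega> x z"
  by (auto simp: conn_def)

lemma conn_sym: "conn \<omega> x y \<longleftrightarrow> conn \<omega> y x"
proof -
  have "sym (adj_rel \<omega>)" by (auto simp: sym_def adj_rel_def insert_commute)
  then show ?thesis unfolding conn_def by (meson sym_rtrancl symD)
qed

lemma conn_edge: "{x, y} \<in> \<omega> \<Longrightarrow> conn \<omega> x y"
  by (auto simp: conn_def adj_rel_def)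

lemma conn_mono: "conn \<omega> x y \<Longrightarrow> \<omega> \<subseteq> \<omega>' \<Longrightarrow> conn \<omega>' x y"
  unfolding conn_def by (rule rtrancl_mono[THEN subsetD]) (auto simp: adj_rel_def)

lemma conn_induct [consumes 1, case_names refl step]:
  assumes "conn \<omega> x y" "P x" "\<And>u v. conn \<omega> x u \<Longrightarrow> {u, v} \<in> \<omega> \<Longrightarrow> P u \<Longrightarrow> P v"
  shows "P y"
  using assms unfolding conn_def by (induction rule: rtrancl_induct) (auto simp: adj_rel_def)

lemma conn_finitary:
  assumes "conn \<omega> x y"
  shows "\<exists>F. finite F \<and> F \<subseteq> \<omega> \<and> conn F x y"
  using assms
proof (induction rule: conn_induct)
  case refl
  show ?case by (intro exI[of _ "{}"]) auto
next
  case (step u v)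
  then obtain F where F: "finite F" "F \<subseteq> \<omega>" "conn F x u" by blast
  moreover have "conn (insert {u, v} F) x v"
    using conn_trans[OF conn_mono[OF F(3)] conn_edge, of "insert {u, v} F" v] by blast
  ultimately show ?case using step by (intro exI[of _ "insert {u, v} F"]) auto
qed

text \<open>A path that starts outside \<open>S\<close> and finds no edge into \<open>S\<close>
  never meets \<open>S\<close>, so the edges inside \<open>S\<close> can be discarded. This is what
  makes the cut event below independent of the state inside \<open>S\<close>.\<close>

lemma conn_no_crossing:
  assumes "conn \<omega> v y" "v \<notin> S" "\<And>y z. y \<in> S \<Longrightarrow> z \<notin> S \<Longrightarrow> {y, z} \<notin> \<omega>"
  shows "y \<notin> S \<and> conn (\<omega> - edges_in S \<omega>) v y"
  using assms(1)
proof (induction rule: conn_induct)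
  case (step u w)
  then have "w \<notin> S" using assms(3)[of w u] by (auto simp: insert_commute)
  then have "{u, w} \<in> \<omega> - edges_in S \<omega>" using step by (auto simp: edges_in_def)
  then show ?case using step \<open>w \<notin> S\<close> conn_trans conn_edge by metis
qed (use assms in auto)

text \<open>There is no vertex set: a vertex on no edge is merely a cluster by itself. The locale is
  interpreted twice, for the edges of the base graph and for those of its product with the
  integers.\<close>

locale lf_edges =
  fixes EE :: "'b set set"
  assumes two: "e \<in> EE \<Longrightarrow> card e = 2"
    and locfin: "finite {e\<in>EE. v \<in> e}"
begin

lemma finite_Union_edges:
  assumes "finite F" "F \<subseteq> EE"
  shows "finite (\<Union>F)"
proof (rule finite_Union[OF assms(1)])
  fix e assume "e \<in> F"
  then have "card e = 2" using assms two by auto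
  then show "finite e" using card.infinite by fastforce
qed

lemma finite_touching: "finite S \<Longrightarrow> finite (touching S EE)"
proof -
  assume "finite S"
  then have "finite (\<Union>v\<in>S. {e\<in>EE. v \<in> e})" using locfin by auto
  moreover have "touching S EE \<subseteq> (\<Union>v\<in>S. {e\<in>EE. v \<in> e})" by (auto simp: touching_def)
  ultimately show ?thesis by (rule finite_subset[rotated])
qed

lemma edges_in_subset_touching: "edges_in S EE \<subseteq> touching S EE"
proof
  fix e assume "e \<in> edges_in S EE"
  then have "e \<in> EE" "e \<inter> S = e" "e \<noteq> {}" using two[of e] by (auto simp: edges_in_def)
  then show "e \<in> touching S EE" by (simp add: touching_def)
qed

lemma finite_edges_in: "finite S \<Longrightarrow> finite (edges_in S EE)"
  using edges_in_subset_touching finite_touching finite_subset by blast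

text \<open>Boundary edges are oriented with the inner endpoint first. By \<open>inj_on_bd\<close>
  each of them is still counted once, so sums over \<open>bd S\<close> are sums over edges.\<close>

definition bd :: "'b set \<Rightarrow> ('b \<times> 'b) set" where
  "bd S = {(y, z). y \<in> S \<and> z \<notin> S \<and> {y, z} \<in> EE}"

lemma inj_on_bd: "inj_on (\<lambda>(y, z). {y, z}) (bd S)"
  by (auto simp: inj_on_def bd_def doubleton_eq_iff)

lemma finite_bd: "finite S \<Longrightarrow> finite (bd S)"
proof -
  assume "finite S"
  moreover have "(\<lambda>(y, z). {y, z}) ` bd S \<subseteq> touching S EE"
    by (auto simp: bd_def touching_def)
  ultimately show ?thesis
    using finite_touching inj_on_bd finite_imageD finite_subset by metis
qed

text \<open>The expected number of open boundary edges of \<open>S\<close> whose inner end is joined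
  to \<open>x\<close> inside \<open>S\<close>: a boundary edge is independent of the edges inside
  \<open>S\<close>, whence the factor \<open>p\<close> in front.\<close>

definition phi :: "real \<Rightarrow> 'b \<Rightarrow> 'b set \<Rightarrow> real" where
  "phi p x S = p * (\<Sum>(y, z)\<in>bd S. bprob (\<lambda>_. p) (edges_in S EE) (\<lambda>\<omega>. conn \<omega> x y))"

section \<open>The differential inequality for the escape from a finite set\<close>

context
  fixes \<Lambda> :: "'b set" and x :: 'b
  assumes fin: "finite \<Lambda>" and x: "x \<in> \<Lambda>"
begin

definition escapes :: "'b set set \<Rightarrow> 'b \<Rightarrow> bool" where
  "escapes \<omega> v \<longleftrightarrow> (\<exists>y. y \<notin> \<Lambda> \<and> conn \<omega> v y)"

text \<open>What remains of \<open>\<Lambda>\<close> after all clusters meeting its complement are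
  explored from outside. Such an exploration does not look at the edges inside the remaining
  set.\<close>

definition cut :: "'b set set \<Rightarrow> 'b set" where
  "cut \<omega> = {v\<in>\<Lambda>. \<not> escapes \<omega> v}"

lemma escapes_mono: "escapes \<omega> v \<Longrightarrow> \<omega> \<subseteq> \<omega>' \<Longrightarrow> escapes \<omega>' v"
  unfolding escapes_def by (metis conn_mono)

text \<open>All edges leaving the cut are closed, so no escaping path enters it, and conversely
  closed boundary edges imprison \<open>S\<close>. The point of the form is that the right-hand side
  sees \<open>\<omega>\<close> only through \<open>\<omega> - edges_in S \<omega>\<close>.\<close>

lemma cut_eq_iff:
  assumes "S \<subseteq> \<Lambda>"
  shows "cut \<omega> = S \<longleftrightarrow> (\<forall>y z. y \<in> S \<and> z \<notin> S \<longrightarrow> {y, z} \<notin> \<omega> - edges_in S \<omega>) \<and>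
    (\<forall>v\<in>\<Lambda> - S. escapes (\<omega> - edges_in S \<omega>) v)"
proof
  assume c: "cut \<omega> = S"
  have nc: "{y, z} \<notin> \<omega>" if "y \<in> S" "z \<notin> S" for y z
  proof
    assume "{y, z} \<in> \<omega>"
    then have yz: "conn \<omega> y z" by (rule conn_edge)
    have "escapes \<omega> z"
      using that c by (cases "z \<in> \<Lambda>") (auto simp: cut_def escapes_def intro: exI[of _ z])
    then have "escapes \<omega> y" using yz conn_trans by (fastforce simp: escapes_def)
    then show False using that c by (auto simp: cut_def)
  qed
  moreover have "escapes (\<omega> - edges_in S \<omega>) v" if "v \<in> \<Lambda> - S" for v
  proof -
    have "escapes \<omega> v" using that c by (auto simp: cut_def)
    then obtain y where "y \<notin> \<Lambda>" "conn \<omega> v y" by (auto simp: escapes_def)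
    then show ?thesis
      using conn_no_crossing[of \<omega> v y S] that nc by (auto simp: escapes_def)
  qed
  ultimately show "(\<forall>y z. y \<in> S \<and> z \<notin> S \<longrightarrow> {y, z} \<notin> \<omega> - edges_in S \<omega>) \<and>
    (\<forall>v\<in>\<Lambda> - S. escapes (\<omega> - edges_in S \<omega>) v)" by auto
next
  assume r: "(\<forall>y z. y \<in> S \<and> z \<notin> S \<longrightarrow> {y, z} \<notin> \<omega> - edges_in S \<omega>) \<and>
    (\<forall>v\<in>\<Lambda> - S. escapes (\<omega> - edges_in S \<omega>) v)"
  then have nc: "{y, z} \<notin> \<omega>" if "y \<in> S" "z \<notin> S" for y z
    using that by (auto simp: edges_in_def)
  have "\<not> escapes \<omega> v" if "v \<in> S" for v
  proof
    assume "escapes \<omega> v"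
    then obtain y where y: "y \<notin> \<Lambda>" "conn \<omega> v y" by (auto simp: escapes_def)
    have "y \<in> S" using y(2) that
    proof (induction rule: conn_induct)
      case (step u w) then show ?case using nc[of u w] by auto
    qed
    then show False using y assms by auto
  qed
  moreover have "escapes \<omega> v" if "v \<in> \<Lambda> - S" for v
    using r that escapes_mono[of "\<omega> - edges_in S \<omega>" v \<omega>] by auto
  ultimately show "cut \<omega> = S" using assms by (auto simp: cut_def)
qed

text \<open>The cut event is decided by the edges not inside \<open>S\<close>, the connection by the
  edges inside \<open>S\<close>.\<close>

lemma bexp_cut_conn:
  assumes "S \<subseteq> \<Lambda>"
  shows "bexp pr (touching \<Lambda> EE) (\<lambda>\<omega>. of_bool (cut \<omega> = S) * of_bool (conn (edges_in S \<omega>) x y)) =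
    bprob pr (touching \<Lambda> EE) (\<lambda>\<omega>. cut \<omega> = S) * bprob pr (edges_in S EE) (\<lambda>\<omega>. conn \<omega> x y)"
proof -
  let ?F = "touching \<Lambda> EE"
  let ?I = "edges_in S EE"
  let ?Q = "\<lambda>\<omega>. (\<forall>y z. y \<in> S \<and> z \<notin> S \<longrightarrow> {y, z} \<notin> \<omega>) \<and> (\<forall>v\<in>\<Lambda> - S. escapes \<omega> v)"
  have I: "?I \<subseteq> ?F"
    using edges_in_subset_touching[of S] assms by (auto simp: touching_def)
  have finF: "finite ?F" using fin finite_touching by auto
  have Q: "cut \<omega> = S \<longleftrightarrow> ?Q (\<omega> \<inter> (?F - ?I))" if "\<omega> \<subseteq> ?F" for \<omega>
  proof -
    have "\<omega> \<inter> (?F - ?I) = \<omega> - edges_in S \<omega>" using that by (auto simp: edges_in_def touching_def)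
    then show ?thesis using cut_eq_iff[OF assms] by simp
  qed
  have C: "edges_in S \<omega> = \<omega> \<inter> ?I" if "\<omega> \<subseteq> ?F" for \<omega>
    using that by (auto simp: edges_in_def touching_def)
  have "bexp pr ?F (\<lambda>\<omega>. of_bool (cut \<omega> = S) * of_bool (conn (edges_in S \<omega>) x y)) =
    bexp pr ?F (\<lambda>\<omega>. of_bool (?Q (\<omega> \<inter> (?F - ?I))) * of_bool (conn (\<omega> \<inter> ?I) x y))"
    using Q C by (intro bexp_cong) auto
  also have "\<dots> = bprob pr (?F - ?I) ?Q * bprob pr ?I (\<lambda>\<omega>. conn \<omega> x y)"
    by (rule bexp_indep[OF finF _ I]) auto
  also have "bprob pr (?F - ?I) ?Q = bprob pr ?F (\<lambda>\<omega>. ?Q (\<omega> \<inter> (?F - ?I)))"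
    by (rule bexp_restrict[OF finF, symmetric]) auto
  also have "\<dots> = bprob pr ?F (\<lambda>\<omega>. cut \<omega> = S)"
    using Q by (intro bexp_cong) auto
  finally show ?thesis .
qed

text \<open>The idea of the differential inequality: an edge joining the cluster of \<open>x\<close> inside \<open>cut \<omega>\<close> to the complement of \<open>cut \<omega>\<close>
  is pivotal for the event that \<open>x\<close> escapes.\<close>

lemma pivotal_sum_ge:
  defines "piv e \<omega> \<equiv> (of_bool (escapes (insert e \<omega>) x) - of_bool (escapes (\<omega> - {e}) x) :: real)"
  shows "(\<Sum>S | S \<subseteq> \<Lambda> \<and> x \<in> S. \<Sum>(y, z)\<in>bd S. of_bool (cut \<omega> = S) * of_bool (conn (edges_in S \<omega>) x y))
    \<le> (\<Sum>e\<in>touching \<Lambda> EE. piv e \<omega>)"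
proof -
  have piv0: "0 \<le> piv e \<omega>" for e
    using escapes_mono[of "\<omega> - {e}" x "insert e \<omega>"] by (auto simp: piv_def)
  have finF: "finite (touching \<Lambda> EE)" using fin finite_touching by auto
  show ?thesis
  proof (cases "x \<in> cut \<omega>")
    case False
    then have "(\<Sum>S | S \<subseteq> \<Lambda> \<and> x \<in> S. \<Sum>(y, z)\<in>bd S. of_bool (cut \<omega> = S) * of_bool (conn (edges_in S \<omega>) x y)) = (0::real)"
      by (intro sum.neutral ballI) (auto simp: case_prod_unfold)
    then show ?thesis using piv0 by (simp add: sum_nonneg)
  next
    case True
    let ?S = "cut \<omega>"
    have S: "?S \<subseteq> \<Lambda>" by (auto simp: cut_def)
    have "(\<Sum>S | S \<subseteq> \<Lambda> \<and> x \<in> S. \<Sum>(y, z)\<in>bd S. of_bool (cut \<omega> = S) * of_bool (conn (edges_in S \<omega>) x y)) =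
      (\<Sum>S\<in>{?S}. \<Sum>(y, z)\<in>bd S. of_bool (cut \<omega> = S) * of_bool (conn (edges_in S \<omega>) x y) :: real)"
      using fin S True by (intro sum.mono_neutral_right) (auto simp: case_prod_unfold intro!: sum.neutral)
    also have "\<dots> = (\<Sum>(y, z)\<in>bd ?S. of_bool (conn (edges_in ?S \<omega>) x y))" by simp
    also have "\<dots> \<le> (\<Sum>(y, z)\<in>bd ?S. piv {y, z} \<omega>)"
    proof (rule sum_mono, clarsimp simp: piv0)
      fix y z assume yz: "(y, z) \<in> bd ?S" and c: "conn (edges_in ?S \<omega>) x y"
      have "conn \<omega> x y" using c by (rule conn_mono) (auto simp: edges_in_def)
      moreover have "escapes \<omega> z"
        using yz by (cases "z \<in> \<Lambda>") (auto simp: bd_def cut_def escapes_def intro: exI[of _ z])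
      ultimately have "escapes (insert {y, z} \<omega>) x"
        unfolding escapes_def by (meson conn_edge conn_mono conn_trans insertI1 subset_insertI)
      moreover have "\<not> escapes (\<omega> - {{y, z}}) x"
        using True escapes_mono[of "\<omega> - {{y, z}}" x \<omega>] by (auto simp: cut_def)
      ultimately show "1 \<le> piv {y, z} \<omega>" by (simp add: piv_def)
    qed
    also have "\<dots> = (\<Sum>e\<in>(\<lambda>(y, z). {y, z}) ` bd ?S. piv e \<omega>)"
      by (subst sum.reindex[OF inj_on_bd]) (simp add: case_prod_unfold)
    also have "\<dots> \<le> (\<Sum>e\<in>touching \<Lambda> EE. piv e \<omega>)"
      using finF piv0 S by (intro sum_mono2) (auto simp: bd_def touching_def)
    finally show ?thesis .
  qed
qed

text \<open>The differential inequality \<open>g' \<ge> 1 - g\<close> for the escape probability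
  \<open>g\<close>, its left side being the derivative in Russo's formula. The event that
  \<open>x\<close> does not escape splits according to the value \<open>S\<close> of the cut; given
  that value, the expected number of pivotal boundary edges is the sum over \<open>bd S\<close>,
  which is at least 1.\<close>

lemma escape_derivative_ge:
  assumes t: "0 \<le> t" "t \<le> 1"
    and phi: "\<And>S. S \<subseteq> \<Lambda> \<Longrightarrow> x \<in> S \<Longrightarrow> (\<Sum>(y, z)\<in>bd S. bprob (\<lambda>_. t) (edges_in S EE) (\<lambda>\<omega>. conn \<omega> x y)) \<ge> 1"
  shows "(\<Sum>e\<in>touching \<Lambda> EE. bexp (\<lambda>_. t) (touching \<Lambda> EE) (\<lambda>\<omega>. of_bool (escapes (insert e \<omega>) x) - of_bool (escapes (\<omega> - {e}) x)))
    \<ge> 1 - bprob (\<lambda>_. t) (touching \<Lambda> EE) (\<lambda>\<omega>. escapes \<omega> x)"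
proof -
  let ?F = "touching \<Lambda> EE"
  let ?Ss = "{S. S \<subseteq> \<Lambda> \<and> x \<in> S}"
  have finF: "finite ?F" using fin finite_touching by auto
  have finS: "finite ?Ss" using fin by simp
  have "1 - bprob (\<lambda>_. t) ?F (\<lambda>\<omega>. escapes \<omega> x) = bprob (\<lambda>_. t) ?F (\<lambda>\<omega>. \<not> escapes \<omega> x)"
    using finF by (simp add: bprob_not)
  also have "\<dots> = bexp (\<lambda>_. t) ?F (\<lambda>\<omega>. \<Sum>S\<in>?Ss. of_bool (cut \<omega> = S))"
  proof (intro bexp_cong refl)
    fix \<omega>
    have "(\<Sum>S\<in>?Ss. of_bool (cut \<omega> = S)) = (of_bool (cut \<omega> \<in> ?Ss) :: real)"
      using finS by (simp add: of_bool_def)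
    also have "cut \<omega> \<in> ?Ss \<longleftrightarrow> \<not> escapes \<omega> x" using x by (auto simp: cut_def)
    finally show "of_bool (\<not> escapes \<omega> x) = (\<Sum>S\<in>?Ss. of_bool (cut \<omega> = S) :: real)" by simp
  qed
  also have "\<dots> = (\<Sum>S\<in>?Ss. bprob (\<lambda>_. t) ?F (\<lambda>\<omega>. cut \<omega> = S))" by (rule bexp_sum)
  also have "\<dots> \<le> (\<Sum>S\<in>?Ss. bprob (\<lambda>_. t) ?F (\<lambda>\<omega>. cut \<omega> = S) *
     (\<Sum>(y, z)\<in>bd S. bprob (\<lambda>_. t) (edges_in S EE) (\<lambda>\<omega>. conn \<omega> x y)))"
  proof (rule sum_mono)
    fix S assume "S \<in> ?Ss"
    then have "S \<subseteq> \<Lambda>" "x \<in> S" by auto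
    moreover have "0 \<le> bprob (\<lambda>_. t) ?F (\<lambda>\<omega>. cut \<omega> = S)" using t by (intro bexp_nonneg) auto
    ultimately have "bprob (\<lambda>_. t) ?F (\<lambda>\<omega>. cut \<omega> = S) * 1 \<le> bprob (\<lambda>_. t) ?F (\<lambda>\<omega>. cut \<omega> = S) *
     (\<Sum>(y, z)\<in>bd S. bprob (\<lambda>_. t) (edges_in S EE) (\<lambda>\<omega>. conn \<omega> x y))"
      using phi by (intro mult_left_mono)
    then show "bprob (\<lambda>_. t) ?F (\<lambda>\<omega>. cut \<omega> = S) \<le> bprob (\<lambda>_. t) ?F (\<lambda>\<omega>. cut \<omega> = S) *
     (\<Sum>(y, z)\<in>bd S. bprob (\<lambda>_. t) (edges_in S EE) (\<lambda>\<omega>. conn \<omega> x y))"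
      by simp
  qed
  also have "\<dots> = (\<Sum>S\<in>?Ss. \<Sum>(y, z)\<in>bd S. bexp (\<lambda>_. t) ?F (\<lambda>\<omega>. of_bool (cut \<omega> = S) * of_bool (conn (edges_in S \<omega>) x y)))"
    unfolding sum_distrib_left case_prod_unfold
    by (intro sum.cong refl) (simp add: bexp_cut_conn)
  also have "\<dots> = bexp (\<lambda>_. t) ?F (\<lambda>\<omega>. \<Sum>S\<in>?Ss. \<Sum>(y, z)\<in>bd S. of_bool (cut \<omega> = S) * of_bool (conn (edges_in S \<omega>) x y))"
    by (simp add: bexp_sum case_prod_unfold)
  also have "\<dots> \<le> bexp (\<lambda>_. t) ?F (\<lambda>\<omega>. \<Sum>e\<in>?F. of_bool (escapes (insert e \<omega>) x) - of_bool (escapes (\<omega> - {e}) x))"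
    using t pivotal_sum_ge by (intro bexp_mono) auto
  also have "\<dots> = (\<Sum>e\<in>?F. bexp (\<lambda>_. t) ?F (\<lambda>\<omega>. of_bool (escapes (insert e \<omega>) x) - of_bool (escapes (\<omega> - {e}) x)))"
    by (rule bexp_sum)
  finally show ?thesis .
qed

text \<open>Integrating \<open>g' \<ge> 1 - g\<close>: the function \<open>(1 - g t) * exp t\<close>
  is nonincreasing from \<open>p\<close> to \<open>p'\<close>, and it is at most
  \<open>exp p\<close> at the start.\<close>

lemma escape_prob_ge:
  assumes p: "0 \<le> p" "p \<le> p'" "p' \<le> 1"
    and phi: "\<And>S. S \<subseteq> \<Lambda> \<Longrightarrow> x \<in> S \<Longrightarrow> phi p x S \<ge> 1"
  shows "bprob (\<lambda>_. p') (touching \<Lambda> EE) (\<lambda>\<omega>. escapes \<omega> x) \<ge> 1 - exp (p - p')"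
proof -
  let ?F = "touching \<Lambda> EE"
  let ?g = "\<lambda>t. bprob (\<lambda>_. t) ?F (\<lambda>\<omega>. escapes \<omega> x)"
  let ?h = "\<lambda>t. (1 - ?g t) * exp t"
  have finF: "finite ?F" using fin finite_touching by auto
  \<comment> \<open>The factor \<open>p \<le> 1\<close> of \<open>phi\<close> may be dropped from a
    lower bound, and the remaining connection probabilities increase with the parameter; so the
    hypothesis at \<open>p\<close> holds at every later \<open>t\<close>.\<close>
  have phi_t: "(\<Sum>(y, z)\<in>bd S. bprob (\<lambda>_. t) (edges_in S EE) (\<lambda>\<omega>. conn \<omega> x y)) \<ge> 1"
    if t: "p \<le> t" "t \<le> p'" and S: "S \<subseteq> \<Lambda>" "x \<in> S" for t S
  proof -
    have "finite S" using S fin finite_subset by auto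
    let ?s = "\<Sum>(y, z)\<in>bd S. bprob (\<lambda>_. p) (edges_in S EE) (\<lambda>\<omega>. conn \<omega> x y)"
    have "0 \<le> ?s" using p by (auto intro!: sum_nonneg bexp_nonneg)
    then have "p * ?s \<le> ?s" using p by (intro mult_left_le_one_le) auto
    then have "1 \<le> ?s" using phi[OF S] by (simp add: phi_def)
    also have "\<dots> \<le> (\<Sum>(y, z)\<in>bd S. bprob (\<lambda>_. t) (edges_in S EE) (\<lambda>\<omega>. conn \<omega> x y))"
      unfolding case_prod_unfold
      using p t \<open>finite S\<close> by (intro sum_mono bprob_mono_param finite_edges_in) (auto intro: conn_mono)
    finally show ?thesis .
  qed
  have "?h p' \<le> ?h p"
  proof (rule DERIV_nonpos_imp_nonincreasing[OF p(2)])
    fix t assume t: "p \<le> t" "t \<le> p'"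
    let ?D = "\<Sum>e\<in>?F. bexp (\<lambda>_. t) ?F (\<lambda>\<omega>. of_bool (escapes (insert e \<omega>) x) - of_bool (escapes (\<omega> - {e}) x))"
    have g: "(?g has_field_derivative ?D) (at t)"
      using bexp_has_field_derivative[OF finF, of "\<lambda>\<omega>. of_bool (escapes \<omega> x)" t] by simp
    have "(?h has_field_derivative ((0 - ?D) * exp t + exp t * (1 - ?g t))) (at t)"
      using DERIV_mult[OF DERIV_diff[OF DERIV_const[of 1] g] DERIV_exp] .
    moreover have "1 - ?g t \<le> ?D"
      using escape_derivative_ge[of t] phi_t[OF t] t p by auto
    then have "exp t * (1 - ?g t) \<le> exp t * ?D" by (intro mult_left_mono) auto
    then have "(0 - ?D) * exp t + exp t * (1 - ?g t) \<le> 0" by (simp only: left_diff_distrib mult.commute[of _ "exp t"]) simp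
    ultimately show "\<exists>y. (?h has_field_derivative y) (at t) \<and> y \<le> 0" by blast
  qed
  also have "?h p \<le> exp p"
    using p finF by (simp add: bexp_nonneg)
  finally have "1 - ?g p' \<le> exp p / exp p'" by (simp add: field_simps)
  then show ?thesis by (simp add: exp_diff)
qed

end

end

section \<open>Exponential decay from finite sets with small \<open>phi\<close>\<close>

context lf_edges
begin

definition nbhd :: "nat \<Rightarrow> 'b \<Rightarrow> 'b set" where
  "nbhd n x = {y. \<exists>m\<le>n. (x, y) \<in> adj_rel EE ^^ m}"

lemma nbhd_self [simp]: "x \<in> nbhd n x"
  by (auto simp: nbhd_def intro: exI[of _ 0])

lemma nbhd_mono: "m \<le> n \<Longrightarrow> nbhd m x \<subseteq> nbhd n x"
  unfolding nbhd_def using order_trans by blast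

lemma nbhd_trans: "y \<in> nbhd m x \<Longrightarrow> z \<in> nbhd n y \<Longrightarrow> z \<in> nbhd (m + n) x"
  unfolding nbhd_def
proof safe
  fix k l assume "k \<le> m" "(x, y) \<in> adj_rel EE ^^ k" "l \<le> n" "(y, z) \<in> adj_rel EE ^^ l"
  then show "\<exists>k\<le>m + n. (x, z) \<in> adj_rel EE ^^ k"
    by (intro exI[of _ "k + l"]) (auto simp: relpow_add)
qed

lemma nbhd_edge: "{x, y} \<in> EE \<Longrightarrow> y \<in> nbhd (Suc 0) x"
  by (auto simp: nbhd_def adj_rel_def intro!: exI[of _ 1])

lemma nbhd_step: "y \<in> nbhd n x \<Longrightarrow> {y, z} \<in> EE \<Longrightarrow> z \<in> nbhd (Suc n) x"
  using nbhd_trans[of y n x z 1] nbhd_edge by simp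

lemma finite_neighbours: "finite {w. {v, w} \<in> EE}"
proof -
  have "(\<lambda>w. {v, w}) ` {w. {v, w} \<in> EE} \<subseteq> {e\<in>EE. v \<in> e}" by auto
  then have "finite ((\<lambda>w. {v, w}) ` {w. {v, w} \<in> EE})" using locfin finite_subset by blast
  moreover have "inj_on (\<lambda>w. {v, w}) {w. {v, w} \<in> EE}" by (auto simp: inj_on_def doubleton_eq_iff)
  ultimately show ?thesis using finite_imageD by blast
qed

lemma finite_nbhd: "finite (nbhd n x)"
proof (induction n)
  case 0
  have "nbhd 0 x \<subseteq> {x}" by (auto simp: nbhd_def)
  then show ?case using finite_subset by blast
next
  case (Suc n)
  have "nbhd (Suc n) x \<subseteq> nbhd n x \<union> (\<Union>y\<in>nbhd n x. {w. {y, w} \<in> EE})"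
  proof
    fix z assume "z \<in> nbhd (Suc n) x"
    then obtain m where m: "m \<le> Suc n" "(x, z) \<in> adj_rel EE ^^ m" by (auto simp: nbhd_def)
    show "z \<in> nbhd n x \<union> (\<Union>y\<in>nbhd n x. {w. {y, w} \<in> EE})"
    proof (cases "m \<le> n")
      case True then show ?thesis using m by (auto simp: nbhd_def)
    next
      case False
      then have "m = Suc n" using m by simp
      then obtain y where "(x, y) \<in> adj_rel EE ^^ n" "(y, z) \<in> adj_rel EE" using m by auto
      then show ?thesis by (auto simp: nbhd_def adj_rel_def)
    qed
  qed
  moreover have "finite (nbhd n x \<union> (\<Union>y\<in>nbhd n x. {w. {y, w} \<in> EE}))"
    using Suc finite_neighbours by auto
  ultimately show ?case by (rule finite_subset)
qed

text \<open>The Simon-Lieb inequality, obtained without the BK inequality: let \<open>C\<close> be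
  the cluster of \<open>x\<close> inside \<open>S\<close>. After its last visit to \<open>C\<close>
  a path to \<open>T\<close> crosses an open boundary edge and continues on edges not touching
  \<open>C\<close>. The value of \<open>C\<close>, that edge and the continuation depend on disjoint
  edge sets. The continuation lives on a subset of \<open>F\<close> that varies with
  \<open>C\<close>, hence the bound is required for all \<open>F' \<subseteq> F\<close>.\<close>

lemma decay_step:
  assumes p: "0 \<le> p" "p \<le> 1" and S: "finite S" "x \<in> S" "T \<inter> S = {}"
    and F: "finite F" "F \<subseteq> EE" and \<beta>: "0 \<le> \<beta>"
    and bound: "\<And>y z F'. (y, z) \<in> bd S \<Longrightarrow> F' \<subseteq> F \<Longrightarrow> bprob (\<lambda>_. p) F' (\<lambda>\<omega>. \<exists>w\<in>T. conn \<omega> z w) \<le> \<beta>"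
  shows "bprob (\<lambda>_. p) F (\<lambda>\<omega>. \<exists>w\<in>T. conn \<omega> x w) \<le> phi p x S * \<beta>"
proof -
  define clus where "clus \<omega> = {v. conn (edges_in S \<omega>) x v}" for \<omega>
  let ?P = "bprob (\<lambda>_. p)" and ?E = "bexp (\<lambda>_. p)"
  define h where "h C z \<omega> \<longleftrightarrow> (\<exists>w\<in>T. conn (\<omega> - touching C \<omega>) z w)" for C z \<omega>
  let ?term = "\<lambda>C y z \<omega>. of_bool (clus \<omega> = C \<and> y \<in> C) * (of_bool ({y, z} \<in> \<omega>) * of_bool (h C z \<omega>)) :: real"
  have clus_S: "clus \<omega> \<subseteq> S" for \<omega>
  proof
    fix v assume "v \<in> clus \<omega>"
    then have "conn (edges_in S \<omega>) x v" by (simp add: clus_def)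
    then show "v \<in> S" by (induction rule: conn_induct) (use S in \<open>auto simp: edges_in_def\<close>)
  qed
  have pointwise: "of_bool (\<exists>w\<in>T. conn \<omega> x w) \<le> (\<Sum>(y, z)\<in>bd S. \<Sum>C\<in>Pow S. ?term C y z \<omega>)"
    if w: "\<omega> \<subseteq> F" for \<omega>
  proof (cases "\<exists>w\<in>T. conn \<omega> x w")
    case True
    then obtain w where wT: "w \<in> T" "conn \<omega> x w" by auto
    \<comment> \<open>Along the path the pair \<open>(y, z)\<close> is renewed at each exit from the
      cluster, so that at the end it records the last one.\<close>
    have "w \<in> clus \<omega> \<or> (\<exists>y z. (y, z) \<in> bd S \<and> y \<in> clus \<omega> \<and> {y, z} \<in> \<omega> \<and>
       conn (\<omega> - touching (clus \<omega>) \<omega>) z w)"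
      using wT(2)
    proof (induction rule: conn_induct)
      case refl then show ?case by (simp add: clus_def)
    next
      case (step u v)
      show ?case
      proof (cases "v \<in> clus \<omega>")
        case v: False
        show ?thesis
        proof (cases "u \<in> clus \<omega>")
          case True
          have "v \<notin> S"
          proof
            assume "v \<in> S"
            then have "{u, v} \<in> edges_in S \<omega>" using True clus_S step by (auto simp: edges_in_def)
            then have "v \<in> clus \<omega>"
              using True by (auto simp: clus_def intro: conn_trans conn_edge)
            then show False using v by simp
          qed
          then have "(u, v) \<in> bd S" using True clus_S step w F by (auto simp: bd_def)
          then show ?thesis using True step by (intro disjI2 exI[of _ u] exI[of _ v]) simp
        next
          case False
          then obtain y z where yz: "(y, z) \<in> bd S" "y \<in> clus \<omega>" "{y, z} \<in> \<omega>"
            "conn (\<omega> - touching (clus \<omega>) \<omega>) z u" using step by auto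
          have "{u, v} \<in> \<omega> - touching (clus \<omega>) \<omega>" using step False v by (auto simp: touching_def)
          then have "conn (\<omega> - touching (clus \<omega>) \<omega>) z v"
            using yz(4) conn_trans conn_edge by metis
          then show ?thesis using yz by blast
        qed
      qed simp
    qed
    moreover have "w \<notin> clus \<omega>" using clus_S wT S by auto
    ultimately obtain y z where yz: "(y, z) \<in> bd S" "y \<in> clus \<omega>" "{y, z} \<in> \<omega>" "h (clus \<omega>) z \<omega>"
      using wT by (auto simp: h_def)
    have "1 \<le> ?term (clus \<omega>) y z \<omega>" using yz by simp
    also have "\<dots> \<le> (\<Sum>C\<in>Pow S. ?term C y z \<omega>)"
      using S clus_S by (intro member_le_sum[of _ _ "\<lambda>C. ?term C y z \<omega>"]) auto
    also have "\<dots> \<le> (\<Sum>(y, z)\<in>bd S. \<Sum>C\<in>Pow S. ?term C y z \<omega>)"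
    proof -
      have "(\<lambda>(y, z). \<Sum>C\<in>Pow S. ?term C y z \<omega>) (y, z) \<le> (\<Sum>(y, z)\<in>bd S. \<Sum>C\<in>Pow S. ?term C y z \<omega>)"
        using yz finite_bd[OF S(1)] by (intro member_le_sum) (auto intro!: sum_nonneg)
      then show ?thesis by (simp only: case_prod_conv)
    qed
    finally show ?thesis using True by simp
  next
    case False
    then show ?thesis by (auto intro!: sum_nonneg)
  qed
  have term_le: "?E F (?term C y z) \<le> ?P F (\<lambda>\<omega>. clus \<omega> = C \<and> y \<in> C) * (p * \<beta>)"
    if yz: "(y, z) \<in> bd S" for C y z
  proof (cases "y \<in> C \<and> {y, z} \<in> F")
    case False
    then have "?E F (?term C y z) = ?E F (\<lambda>_. 0)" by (intro bexp_cong) auto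
    also have "\<dots> = 0" using F by (simp add: bexp_const)
    also have "\<dots> \<le> ?P F (\<lambda>\<omega>. clus \<omega> = C \<and> y \<in> C) * (p * \<beta>)"
      using p \<beta> by (auto intro!: mult_nonneg_nonneg bexp_nonneg)
    finally show ?thesis .
  next
    case True
    let ?FC = "touching C (edges_in S F)" and ?G = "F - touching C F"
    \<comment> \<open>That the cluster equals \<open>C\<close> means that open edges inside
      \<open>S\<close> join up \<open>C\<close> and that none leads from \<open>C\<close> to the
      rest of \<open>S\<close>; all edges concerned touch \<open>C\<close>.\<close>
    have clus_dep: "clus \<omega> = C \<longleftrightarrow> clus (\<omega> \<inter> ?FC) = C" if w: "\<omega> \<subseteq> F" for \<omega>
    proof
      assume c: "clus \<omega> = C"
      have "v \<in> clus (\<omega> \<inter> ?FC)" if v: "v \<in> C" for v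
      proof -
        have "conn (edges_in S \<omega>) x v" using v c by (auto simp: clus_def)
        then have "conn (edges_in S (\<omega> \<inter> ?FC)) x v \<and> v \<in> C"
        proof (induction rule: conn_induct)
          case refl then show ?case using c by (auto simp: clus_def)
        next
          case (step u v)
          then have "{u, v} \<in> edges_in S (\<omega> \<inter> ?FC)" using w by (auto simp: touching_def edges_in_def)
          moreover have "v \<in> C" using step c by (auto simp: clus_def intro: conn_trans conn_edge)
          ultimately show ?case using step conn_trans conn_edge by metis
        qed
        then show ?thesis by (simp add: clus_def)
      qed
      moreover have "clus (\<omega> \<inter> ?FC) \<subseteq> clus \<omega>"
        by (auto simp: clus_def edges_in_def elim: conn_mono)
      ultimately show "clus (\<omega> \<inter> ?FC) = C" using c by auto
    next
      assume c: "clus (\<omega> \<inter> ?FC) = C"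
      have "v \<in> C" if v: "v \<in> clus \<omega>" for v
      proof -
        have "conn (edges_in S \<omega>) x v" using v by (auto simp: clus_def)
        then show "v \<in> C"
        proof (induction rule: conn_induct)
          case refl then show ?case using c by (auto simp: clus_def)
        next
          case (step u v)
          then have "{u, v} \<in> edges_in S (\<omega> \<inter> ?FC)" using w by (auto simp: touching_def edges_in_def)
          moreover have "conn (edges_in S (\<omega> \<inter> ?FC)) x u" using step c by (auto simp: clus_def)
          ultimately have "v \<in> clus (\<omega> \<inter> ?FC)"
            unfolding clus_def by (blast intro: conn_trans conn_edge)
          then show ?case using c by simp
        qed
      qed
      moreover have "clus (\<omega> \<inter> ?FC) \<subseteq> clus \<omega>"
        by (auto simp: clus_def edges_in_def elim: conn_mono)
      ultimately show "clus \<omega> = C" using c by auto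
    qed
    have h_dep: "h C z \<omega> \<longleftrightarrow> (\<exists>w\<in>T. conn (\<omega> \<inter> ?G) z w)" if w: "\<omega> \<subseteq> F" for \<omega>
    proof -
      have "\<omega> - touching C \<omega> = \<omega> \<inter> ?G" using w by (auto simp: touching_def)
      then show ?thesis by (simp add: h_def)
    qed
    have sub: "?FC \<subseteq> F" by (auto simp: touching_def edges_in_def)
    have yzF: "{y, z} \<in> F" "{y, z} \<notin> ?FC" "{y, z} \<notin> ?G" "?G \<subseteq> F - ?FC"
      using yz True by (auto simp: bd_def touching_def edges_in_def)
    have "?E F (?term C y z) = ?E F (\<lambda>\<omega>. of_bool (clus (\<omega> \<inter> ?FC) = C) *
       (\<lambda>\<omega>. of_bool ({y, z} \<in> \<omega> \<inter> {{y, z}}) * of_bool (\<exists>w\<in>T. conn (\<omega> \<inter> ?G) z w)) (\<omega> \<inter> (F - ?FC)))"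
    proof (intro bexp_cong refl)
      fix \<omega> assume w: "\<omega> \<subseteq> F"
      have "\<omega> \<inter> (F - ?FC) \<inter> ?G = \<omega> \<inter> ?G" "{y, z} \<in> \<omega> \<longleftrightarrow> {y, z} \<in> (\<omega> \<inter> (F - ?FC)) \<inter> {{y, z}}"
        using yzF by auto
      then show "?term C y z \<omega> = of_bool (clus (\<omega> \<inter> ?FC) = C) *
       (\<lambda>\<omega>. of_bool ({y, z} \<in> \<omega> \<inter> {{y, z}}) * of_bool (\<exists>w\<in>T. conn (\<omega> \<inter> ?G) z w)) (\<omega> \<inter> (F - ?FC))"
        using clus_dep[OF w] h_dep[OF w] True by simp
    qed
    also have "\<dots> = ?P ?FC (\<lambda>\<omega>. clus \<omega> = C) *
      ?E (F - ?FC) (\<lambda>\<omega>. of_bool ({y, z} \<in> \<omega> \<inter> {{y, z}}) * of_bool (\<exists>w\<in>T. conn (\<omega> \<inter> ?G) z w))"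
      using F sub by (intro bexp_indep) auto
    also have "?E (F - ?FC) (\<lambda>\<omega>. of_bool ({y, z} \<in> \<omega> \<inter> {{y, z}}) * of_bool (\<exists>w\<in>T. conn (\<omega> \<inter> ?G) z w)) =
      ?P {{y, z}} (\<lambda>\<omega>. {y, z} \<in> \<omega>) * ?P ?G (\<lambda>\<omega>. \<exists>w\<in>T. conn \<omega> z w)"
      using F yzF by (intro bexp_indep) auto
    also have "?P {{y, z}} (\<lambda>\<omega>. {y, z} \<in> \<omega>) = p" by (simp add: bexp_insert)
    also have "?P ?FC (\<lambda>\<omega>. clus \<omega> = C) = ?P F (\<lambda>\<omega>. clus (\<omega> \<inter> ?FC) = C)"
      using F sub by (subst bexp_restrict) auto
    also have "\<dots> = ?P F (\<lambda>\<omega>. clus \<omega> = C \<and> y \<in> C)"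
      using clus_dep True by (intro bexp_cong) auto
    also have "?P F (\<lambda>\<omega>. clus \<omega> = C \<and> y \<in> C) * (p * ?P ?G (\<lambda>\<omega>. \<exists>w\<in>T. conn \<omega> z w)) \<le>
      ?P F (\<lambda>\<omega>. clus \<omega> = C \<and> y \<in> C) * (p * \<beta>)"
      using p bound[OF yz, of ?G] by (intro mult_left_mono bexp_nonneg) auto
    finally show ?thesis .
  qed
  \<comment> \<open>The cluster has exactly one value, so summing over the values that contain
    \<open>y\<close> gives back the probability that \<open>x\<close> is joined to \<open>y\<close>
    inside \<open>S\<close>.\<close>
  have sumC: "(\<Sum>C\<in>Pow S. ?P F (\<lambda>\<omega>. clus \<omega> = C \<and> y \<in> C)) \<le> ?P (edges_in S EE) (\<lambda>\<omega>. conn \<omega> x y)" for y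
  proof -
    have "(\<Sum>C\<in>Pow S. ?P F (\<lambda>\<omega>. clus \<omega> = C \<and> y \<in> C)) =
      ?E F (\<lambda>\<omega>. \<Sum>C\<in>Pow S. of_bool (clus \<omega> = C \<and> y \<in> C))" by (rule bexp_sum[symmetric])
    also have "\<dots> = ?P F (\<lambda>\<omega>. conn (edges_in S \<omega>) x y)"
    proof (intro bexp_cong refl)
      fix \<omega>
      have "(\<Sum>C\<in>Pow S. of_bool (clus \<omega> = C \<and> y \<in> C)) = (\<Sum>C\<in>{clus \<omega>}. of_bool (clus \<omega> = C \<and> y \<in> C) :: real)"
        using S clus_S by (intro sum.mono_neutral_right) auto
      then show "(\<Sum>C\<in>Pow S. of_bool (clus \<omega> = C \<and> y \<in> C)) = (of_bool (conn (edges_in S \<omega>) x y) :: real)"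
        by (simp add: clus_def)
    qed
    also have "\<dots> = ?P F (\<lambda>\<omega>. conn (\<omega> \<inter> edges_in S F) x y)"
    proof (intro bexp_cong refl)
      fix \<omega> assume "\<omega> \<subseteq> F"
      then have "edges_in S \<omega> = \<omega> \<inter> edges_in S F" by (auto simp: edges_in_def)
      then show "(of_bool (conn (edges_in S \<omega>) x y) :: real) = of_bool (conn (\<omega> \<inter> edges_in S F) x y)" by simp
    qed
    also have "\<dots> = ?P (edges_in S F) (\<lambda>\<omega>. conn \<omega> x y)"
      using F by (intro bexp_restrict) (auto simp: edges_in_def)
    also have "\<dots> \<le> ?P (edges_in S EE) (\<lambda>\<omega>. conn \<omega> x y)"
      using F p finite_edges_in[OF S(1)]
      by (intro bprob_mono_edges) (auto simp: edges_in_def intro: conn_mono)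
    finally show ?thesis .
  qed
  have "?P F (\<lambda>\<omega>. \<exists>w\<in>T. conn \<omega> x w) \<le> ?E F (\<lambda>\<omega>. \<Sum>(y, z)\<in>bd S. \<Sum>C\<in>Pow S. ?term C y z \<omega>)"
    using p pointwise by (intro bexp_mono) auto
  also have "\<dots> = (\<Sum>(y, z)\<in>bd S. \<Sum>C\<in>Pow S. ?E F (?term C y z))"
    by (simp add: case_prod_unfold bexp_sum)
  also have "\<dots> \<le> (\<Sum>(y, z)\<in>bd S. \<Sum>C\<in>Pow S. ?P F (\<lambda>\<omega>. clus \<omega> = C \<and> y \<in> C) * (p * \<beta>))"
    using term_le by (intro sum_mono) (auto intro!: sum_mono)
  also have "\<dots> = (\<Sum>(y, z)\<in>bd S. (\<Sum>C\<in>Pow S. ?P F (\<lambda>\<omega>. clus \<omega> = C \<and> y \<in> C)) * (p * \<beta>))"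
    by (simp add: sum_distrib_right)
  also have "\<dots> \<le> (\<Sum>(y, z)\<in>bd S. ?P (edges_in S EE) (\<lambda>\<omega>. conn \<omega> x y) * (p * \<beta>))"
    using sumC p \<beta> by (intro sum_mono) (auto intro!: mult_right_mono)
  also have "\<dots> = phi p x S * \<beta>"
    by (simp add: phi_def sum_distrib_left sum_distrib_right case_prod_unfold algebra_simps)
  finally show ?thesis .
qed

text \<open>Each passage out of a set \<open>S\<close> costs a factor \<open>\<rho>\<close> and
  advances by at most \<open>L\<close>, because \<open>S\<close> and the outer ends of its boundary
  edges lie within distance \<open>L\<close>. The set \<open>W\<close>, closed under adjacency,
  keeps the next starting vertex among those for which such a set is supplied.\<close>

lemma decay_iterate:
  assumes p: "0 \<le> p" "p \<le> 1" and \<rho>: "0 \<le> \<rho>"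
    and closed: "\<And>x y. x \<in> W \<Longrightarrow> {x, y} \<in> EE \<Longrightarrow> y \<in> W"
    and S: "\<And>x. x \<in> W \<Longrightarrow> \<exists>S. finite S \<and> x \<in> S \<and> S \<subseteq> nbhd L x \<and> (\<forall>(y, z)\<in>bd S. z \<in> nbhd L x) \<and> phi p x S \<le> \<rho>"
    and "x \<in> W" "finite F" "F \<subseteq> EE"
  shows "bprob (\<lambda>_. p) F (\<lambda>\<omega>. \<exists>w. w \<notin> nbhd (k * L) x \<and> conn \<omega> x w) \<le> \<rho> ^ k"
  using \<open>x \<in> W\<close> \<open>finite F\<close> \<open>F \<subseteq> EE\<close>
proof (induction k arbitrary: x F)
  case 0
  then show ?case using bprob_le_1[of F "\<lambda>_. p"] p by simp
next
  case (Suc k)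
  obtain S where S: "finite S" "x \<in> S" "S \<subseteq> nbhd L x" "\<And>y z. (y, z) \<in> bd S \<Longrightarrow> z \<in> nbhd L x"
    "phi p x S \<le> \<rho>"
    using S[OF Suc.prems(1)] by blast
  have W: "y \<in> W" if "y \<in> nbhd n x" for y n
  proof -
    obtain m where "(x, y) \<in> adj_rel EE ^^ m" using \<open>y \<in> nbhd n x\<close> by (auto simp: nbhd_def)
    then show ?thesis
      by (induction m arbitrary: y) (use Suc.prems(1) closed in \<open>auto simp: adj_rel_def\<close>)
  qed
  have "bprob (\<lambda>_. p) F (\<lambda>\<omega>. \<exists>w\<in>- nbhd (Suc k * L) x. conn \<omega> x w) \<le> phi p x S * \<rho> ^ k"
  proof (rule decay_step[OF p S(1,2)])
    show "- nbhd (Suc k * L) x \<inter> S = {}" using S(3) nbhd_mono[of L "Suc k * L" x] by auto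
    fix y z F' assume yz: "(y, z) \<in> bd S" and F': "F' \<subseteq> F"
    \<comment> \<open>As \<open>z\<close> is within distance \<open>L\<close> of \<open>x\<close>,
      the ball of radius \<open>k * L\<close> about \<open>z\<close> lies in the ball of radius
      \<open>Suc k * L\<close> about \<open>x\<close>.\<close>
    have "bprob (\<lambda>_. p) F' (\<lambda>\<omega>. \<exists>w\<in>- nbhd (Suc k * L) x. conn \<omega> z w) \<le>
      bprob (\<lambda>_. p) F' (\<lambda>\<omega>. \<exists>w. w \<notin> nbhd (k * L) z \<and> conn \<omega> z w)"
      using p nbhd_trans[OF S(4)[OF yz], of _ "k * L"] by (intro bexp_mono) (auto simp: of_bool_def)
    also have "\<dots> \<le> \<rho> ^ k"
      using Suc W[OF S(4)[OF yz]] F' finite_subset by (intro Suc.IH) blast+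
    finally show "bprob (\<lambda>_. p) F' (\<lambda>\<omega>. \<exists>w\<in>- nbhd (Suc k * L) x. conn \<omega> z w) \<le> \<rho> ^ k" .
  qed (use Suc \<rho> in auto)
  also have "\<dots> \<le> \<rho> * \<rho> ^ k" using S(5) \<rho> by (intro mult_right_mono) auto
  finally show ?case by (simp add: Bex_def)
qed

end

section \<open>Infinite clusters and the absence of percolation\<close>

context lf_edges
begin

text \<open>Koenig's lemma along geodesics: only steps that raise the distance \<open>d\<close> from
  \<open>x\<close> by one are allowed. They still reach the whole cluster, and a path of such steps
  has \<open>d (\<gamma> n) = n\<close>, hence is injective.\<close>

lemma koenig:
  assumes \<omega>: "\<omega> \<subseteq> EE" and inf: "infinite {v. conn \<omega> x v}"
  shows "\<exists>\<gamma> :: nat \<Rightarrow> 'b. \<gamma> 0 = x \<and> inj \<gamma> \<and> (\<forall>i. {\<gamma> i, \<gamma> (Suc i)} \<in> \<omega>)"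
proof -
  let ?R = "adj_rel \<omega>"
  define d where "d v = (LEAST n. (x, v) \<in> ?R ^^ n)" for v
  define T where "T = {(u, v). {u, v} \<in> \<omega> \<and> d v = Suc (d u)}"
  have d_le: "d v \<le> n" if "(x, v) \<in> ?R ^^ n" for v n
    unfolding d_def using that by (rule Least_le)
  have d_rel: "(x, v) \<in> ?R ^^ d v" if "conn \<omega> x v" for v
    using that unfolding d_def conn_def rtrancl_power by (auto intro: LeastI)
  have T_reach: "(x, v) \<in> T\<^sup>*" if "(x, v) \<in> ?R ^^ n" "d v = n" for v n
    using that
  proof (induction n arbitrary: v)
    case (Suc n)
    then obtain u where u: "(x, u) \<in> ?R ^^ n" "(u, v) \<in> ?R" by auto
    have "conn \<omega> x u" using u(1) unfolding conn_def rtrancl_power by auto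
    then have "(x, u) \<in> ?R ^^ d u" by (rule d_rel)
    then have "(x, v) \<in> ?R ^^ Suc (d u)" using u(2) by auto
    then have "Suc n \<le> Suc (d u)" using d_le Suc(3) by metis
    then have "d u = n" using d_le[OF u(1)] by simp
    then show ?case using Suc u by (auto simp: T_def adj_rel_def intro: rtrancl_into_rtrancl)
  qed simp
  define good where "good v \<longleftrightarrow> infinite (T\<^sup>* `` {v})" for v
  have "{v. conn \<omega> x v} \<subseteq> T\<^sup>* `` {x}" using T_reach d_rel by auto
  then have gx: "good x" using inf finite_subset by (auto simp: good_def)
  have step: "\<exists>v. (u, v) \<in> T \<and> good v" if "good u" for u
  proof (rule ccontr)
    assume "\<not> (\<exists>v. (u, v) \<in> T \<and> good v)"
    then have f: "finite (T\<^sup>* `` {v})" if "v \<in> T `` {u}" for v using that by (auto simp: good_def)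
    have "T `` {u} \<subseteq> {w. {u, w} \<in> EE}" using \<omega> by (auto simp: T_def)
    then have "finite (T `` {u})" using finite_neighbours finite_subset by blast
    then have "finite (insert u (\<Union>v\<in>T `` {u}. T\<^sup>* `` {v}))" using f by auto
    moreover have "T\<^sup>* `` {u} \<subseteq> insert u (\<Union>v\<in>T `` {u}. T\<^sup>* `` {v})"
      by (auto elim: converse_rtranclE)
    ultimately show False using that finite_subset by (auto simp: good_def)
  qed
  have "\<exists>\<gamma>. \<forall>n. (good (\<gamma> n) \<and> (n = 0 \<longrightarrow> \<gamma> n = x)) \<and> (\<gamma> n, \<gamma> (Suc n)) \<in> T"
    using gx step by (intro dependent_nat_choice) auto
  then obtain \<gamma> where \<gamma>: "\<gamma> 0 = x" "\<And>n. (\<gamma> n, \<gamma> (Suc n)) \<in> T" by auto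
  have "d x = 0" using d_le[of x 0] by simp
  then have "d (\<gamma> n) = n" for n
    by (induction n) (use \<gamma> in \<open>auto simp: T_def\<close>)
  then have "inj \<gamma>" by (metis injI)
  then show ?thesis using \<gamma> by (auto simp: T_def)
qed

lemma path_conn:
  assumes "\<And>i. {\<gamma> i, \<gamma> (Suc i)} \<in> \<omega>"
  shows "conn \<omega> (\<gamma> m) (\<gamma> (m + n))"
  by (induction n) (use assms in \<open>auto intro: conn_trans conn_edge\<close>)

lemma injective_sequence_leaves:
  fixes \<gamma> :: "nat \<Rightarrow> 'b"
  assumes "inj \<gamma>" "finite \<Lambda>"
  shows "\<exists>i\<ge>m. \<gamma> i \<notin> \<Lambda>"
proof (rule ccontr)
  assume "\<not> ?thesis"
  then have "\<gamma> ` {m..} \<subseteq> \<Lambda>" by auto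
  then have "finite (\<gamma> ` {m..})" using assms finite_subset by blast
  then have "finite {m..}" using assms finite_imageD inj_on_subset by blast
  then show False using infinite_Ici by auto
qed

text \<open>Up to its first exit from \<open>\<Lambda>\<close> a path uses only edges with an
  endpoint in \<open>\<Lambda>\<close>; for finite \<open>\<Lambda>\<close> escape is thus decided
  by finitely many edges.\<close>

lemma escape_touching:
  assumes "x \<in> \<Lambda>" "\<omega> \<subseteq> EE" "y \<notin> \<Lambda>" "conn \<omega> x y"
  shows "\<exists>y. y \<notin> \<Lambda> \<and> conn (\<omega> \<inter> touching \<Lambda> EE) x y"
proof -
  have "(y \<in> \<Lambda> \<and> conn (\<omega> \<inter> touching \<Lambda> EE) x y) \<or> (\<exists>y. y \<notin> \<Lambda> \<and> conn (\<omega> \<inter> touching \<Lambda> EE) x y)"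
    using assms(4)
  proof (induction rule: conn_induct)
    case (step u v)
    show ?case
    proof (cases "u \<in> \<Lambda> \<and> conn (\<omega> \<inter> touching \<Lambda> EE) x u")
      case True
      then have "{u, v} \<in> \<omega> \<inter> touching \<Lambda> EE" using step assms by (auto simp: touching_def)
      then have "conn (\<omega> \<inter> touching \<Lambda> EE) x v" using True conn_trans conn_edge by metis
      then show ?thesis by auto
    qed (use step in auto)
  qed (use assms in auto)
  then show ?thesis using assms by auto
qed

lemma conn_iff_nbhd: "conn EE x y \<longleftrightarrow> (\<exists>n. y \<in> nbhd n x)"
  unfolding conn_def rtrancl_power nbhd_def by auto

lemma finite_subset_nbhd:
  assumes "finite A" "\<And>y. y \<in> A \<Longrightarrow> conn EE x y"
  shows "\<exists>n. A \<subseteq> nbhd n x"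
proof -
  have "\<forall>y\<in>A. \<exists>n. y \<in> nbhd n x" using assms conn_iff_nbhd by auto
  then obtain N where N: "\<And>y. y \<in> A \<Longrightarrow> y \<in> nbhd (N y) x" by metis
  have "A \<subseteq> nbhd (Max (N ` A)) x"
  proof
    fix y assume y: "y \<in> A"
    then have "N y \<le> Max (N ` A)" using assms by (intro Max_ge) auto
    then show "y \<in> nbhd (Max (N ` A)) x" using N[OF y] nbhd_mono by blast
  qed
  then show ?thesis by blast
qed

text \<open>The escapes from growing balls decrease to the existence of an infinite open path: a
  finite cluster would fit into some ball, and an infinite one contains a path by Koenig's
  lemma.\<close>

lemma escape_limit_zero:
  assumes p: "0 \<le> p" "p \<le> 1" and perc: "percolation_prob EE (\<lambda>_. p) x = 0"
  shows "(\<lambda>n. bprob (\<lambda>_. p) (touching (nbhd n x) EE) (\<lambda>\<omega>. \<exists>y. y \<notin> nbhd n x \<and> conn \<omega> x y)) \<longlonglongrightarrow> 0"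
proof -
  define M where "M = percolation_measure EE (\<lambda>_. p)"
  interpret prob_space M unfolding M_def by (rule prob_space_percolation)
  let ?F = "\<lambda>n. touching (nbhd n x) EE"
  let ?A = "\<lambda>n \<omega>. \<exists>y. y \<notin> nbhd n x \<and> conn \<omega> x y"
  let ?C = "\<lambda>n. {\<omega>\<in>space M. ?A n {e\<in>?F n. \<omega> e}}"
  let ?D = "{\<omega>\<in>space M. infinite_open_path_from EE x \<omega>}"
  have cyl: "?C n \<in> sets M" "measure M (?C n) = bprob (\<lambda>_. p) (?F n) (?A n)" for n
    unfolding M_def using p finite_touching[OF finite_nbhd, of n x]
    by (intro cylinder_measure; auto simp: touching_def)+
  have C_iff: "?A n {e\<in>?F n. \<omega> e} \<longleftrightarrow> ?A n {e\<in>EE. \<omega> e}" for n \<omega>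
  proof
    assume "?A n {e\<in>?F n. \<omega> e}"
    moreover have "{e\<in>?F n. \<omega> e} \<subseteq> {e\<in>EE. \<omega> e}" by (auto simp: touching_def)
    ultimately show "?A n {e\<in>EE. \<omega> e}" by (blast intro: conn_mono)
  next
    assume "?A n {e\<in>EE. \<omega> e}"
    then obtain y where "y \<notin> nbhd n x" "conn {e\<in>EE. \<omega> e} x y" by auto
    then have "?A n ({e\<in>EE. \<omega> e} \<inter> ?F n)" by (intro escape_touching) auto
    moreover have "{e\<in>EE. \<omega> e} \<inter> ?F n = {e\<in>?F n. \<omega> e}" by (auto simp: touching_def)
    ultimately show "?A n {e\<in>?F n. \<omega> e}" by simp
  qed
  have D: "?D = (\<Inter>n. ?C n)"
  proof (intro equalityI subsetI)
    fix \<omega> assume "\<omega> \<in> ?D"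
    then obtain \<gamma> :: "nat \<Rightarrow> 'b" where \<gamma>: "\<gamma> 0 = x" "inj \<gamma>" "\<And>i. {\<gamma> i, \<gamma> (Suc i)} \<in> {e\<in>EE. \<omega> e}"
      and w: "\<omega> \<in> space M"
      by (auto simp: infinite_open_path_from_def)
    have "?A n {e\<in>EE. \<omega> e}" for n
      using injective_sequence_leaves[OF \<gamma>(2) finite_nbhd[of n x], of 0] path_conn[of \<gamma> "{e\<in>EE. \<omega> e}" 0, OF \<gamma>(3)] \<gamma>(1)
      by auto
    then show "\<omega> \<in> (\<Inter>n. ?C n)" using C_iff w by auto
  next
    fix \<omega> assume w: "\<omega> \<in> (\<Inter>n. ?C n)"
    let ?w = "{e\<in>EE. \<omega> e}"
    have A: "?A n ?w" for n using w C_iff by auto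
    have "infinite {v. conn ?w x v}"
    proof
      assume fin: "finite {v. conn ?w x v}"
      have "conn EE x v" if "conn ?w x v" for v using that by (rule conn_mono) auto
      then obtain m where "{v. conn ?w x v} \<subseteq> nbhd m x" using finite_subset_nbhd[OF fin] by blast
      then show False using A[of m] by blast
    qed
    then obtain \<gamma> :: "nat \<Rightarrow> 'b" where "\<gamma> 0 = x" "inj \<gamma>" "\<And>i. {\<gamma> i, \<gamma> (Suc i)} \<in> ?w"
      using koenig[of ?w x] by auto
    then show "\<omega> \<in> ?D" using w by (auto simp: infinite_open_path_from_def)
  qed
  have "decseq ?C"
  proof (intro decseq_SucI subsetI)
    fix n \<omega> assume "\<omega> \<in> ?C (Suc n)"
    then have "\<omega> \<in> space M" "?A (Suc n) {e\<in>EE. \<omega> e}" using C_iff by auto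
    then have "\<omega> \<in> space M" "?A n {e\<in>EE. \<omega> e}" using nbhd_mono[of n "Suc n" x] by auto
    then show "\<omega> \<in> ?C n" using C_iff by auto
  qed
  then have "(\<lambda>n. measure M (?C n)) \<longlonglongrightarrow> measure M (\<Inter>n. ?C n)"
    using cyl by (intro finite_Lim_measure_decseq) auto
  moreover have "measure M (\<Inter>n. ?C n) = 0"
    using perc unfolding percolation_prob_def M_def[symmetric] D by simp
  ultimately show ?thesis using cyl by simp
qed

text \<open>Otherwise the differential inequality makes \<open>x\<close> escape from every large
  ball with probability at least \<open>1 - exp (p - p')\<close> at parameter \<open>p'\<close>.
  Opening a fixed finite connection \<open>K\<close> from \<open>o'\<close> to \<open>x\<close>
  costs only the factor \<open>p' ^ card K\<close>, so \<open>o'\<close> would percolate at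
  \<open>p'\<close>.\<close>

lemma phi_less_1_of_no_percolation:
  assumes p: "0 \<le> p" "p < p'" "p' \<le> 1" and perc: "percolation_prob EE (\<lambda>_. p') o' = 0"
    and x: "conn EE o' x"
  shows "\<exists>n S. S \<subseteq> nbhd n o' \<and> x \<in> S \<and> phi p x S < 1"
proof (rule ccontr)
  assume neg: "\<not> ?thesis"
  let ?P = "bprob (\<lambda>_. p')"
  obtain K where K: "finite K" "K \<subseteq> EE" "conn K o' x" using conn_finitary[OF x] by auto
  obtain n0 where n0: "x \<in> nbhd n0 o'" using x conn_iff_nbhd by auto
  let ?c = "p' ^ card K * (1 - exp (p - p'))"
  have c: "?c > 0" using p by simp
  have bound: "?c \<le> ?P (touching (nbhd n o') EE) (\<lambda>\<omega>. \<exists>y. y \<notin> nbhd n o' \<and> conn \<omega> o' y)" if n: "n \<ge> n0" for n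
  proof -
    let ?L = "nbhd n o'" let ?T = "touching ?L EE" let ?F = "?T \<union> K"
    let ?B = "\<lambda>v \<omega>. \<exists>y. y \<notin> ?L \<and> conn \<omega> v y"
    have finT: "finite ?T" by (intro finite_touching finite_nbhd)
    then have finF: "finite ?F" using K by auto
    have x: "x \<in> ?L" using nbhd_mono[OF n] n0 by auto
    have mono: "?B v \<omega>" if "?B v \<omega>'" "\<omega>' \<subseteq> \<omega>" for v \<omega> \<omega>'
      using that by (blast intro: conn_mono)
    have "1 - exp (p - p') \<le> ?P ?T (\<lambda>\<omega>. escapes ?L \<omega> x)"
      using p x neg by (intro escape_prob_ge finite_nbhd) (auto simp: not_less)
    also have "\<dots> = ?P ?T (?B x)" by (simp add: escapes_def[OF finite_nbhd x])
    also have "\<dots> \<le> ?P ?F (?B x)"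
      using finF p mono by (intro bprob_mono_edges) auto
    \<comment> \<open>Declaring \<open>K\<close> open enlarges the event and makes it depend on the
      edges off \<open>K\<close> only; independence then replaces a positive correlation
      inequality.\<close>
    also have "\<dots> \<le> ?P ?F (\<lambda>\<omega>. ?B x (\<omega> \<inter> (?F - K) \<union> K))"
    proof (intro bexp_mono)
      fix \<omega> assume "\<omega> \<subseteq> ?F"
      then have "\<omega> \<subseteq> \<omega> \<inter> (?F - K) \<union> K" by auto
      then show "of_bool (?B x \<omega>) \<le> (of_bool (?B x (\<omega> \<inter> (?F - K) \<union> K)) :: real)"
        using mono by (auto simp: of_bool_def)
    qed (use p in auto)
    also have "\<dots> = ?P (?F - K) (\<lambda>\<omega>. ?B x (\<omega> \<union> K))"
      using finF by (intro bexp_restrict) auto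
    finally have 1: "1 - exp (p - p') \<le> ?P (?F - K) (\<lambda>\<omega>. ?B x (\<omega> \<union> K))" .
    have "?P K (\<lambda>\<omega>. K \<subseteq> \<omega>) = p' ^ card K"
      using K by (subst bprob_all_open) auto
    then have "?c \<le> ?P K (\<lambda>\<omega>. K \<subseteq> \<omega>) * ?P (?F - K) (\<lambda>\<omega>. ?B x (\<omega> \<union> K))"
      using 1 p by (auto intro!: mult_left_mono)
    also have "?P K (\<lambda>\<omega>. K \<subseteq> \<omega>) * ?P (?F - K) (\<lambda>\<omega>. ?B x (\<omega> \<union> K)) =
      bexp (\<lambda>_. p') ?F (\<lambda>\<omega>. of_bool (K \<subseteq> \<omega> \<inter> K) * of_bool (?B x (\<omega> \<inter> (?F - K) \<union> K)))"
      using finF by (intro bexp_indep[symmetric]) auto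
    also have "\<dots> \<le> ?P ?F (\<lambda>\<omega>. ?B o' (\<omega> \<inter> ?T))"
    proof (intro bexp_mono)
      fix \<omega> assume w: "\<omega> \<subseteq> ?F"
      have "?B o' (\<omega> \<inter> ?T)" if k: "K \<subseteq> \<omega>" and B: "?B x (\<omega> \<inter> (?F - K) \<union> K)"
      proof -
        have "?B x \<omega>" using B by (rule mono) (use k in auto)
        then obtain y where y: "y \<notin> ?L" "conn \<omega> x y" by auto
        have "conn \<omega> o' y" using y conn_mono[OF K(3) k] conn_trans by metis
        then show ?thesis using w K y by (intro escape_touching[of _ _ _ y]) (auto simp: touching_def)
      qed
      then show "of_bool (K \<subseteq> \<omega> \<inter> K) * of_bool (?B x (\<omega> \<inter> (?F - K) \<union> K)) \<le> (of_bool (?B o' (\<omega> \<inter> ?T)) :: real)"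
        by (auto simp: of_bool_def)
    qed (use p in auto)
    also have "\<dots> = ?P ?T (?B o')" using finF by (intro bexp_restrict) auto
    finally show ?thesis .
  qed
  have "(\<lambda>n. ?P (touching (nbhd n o') EE) (\<lambda>\<omega>. \<exists>y. y \<notin> nbhd n o' \<and> conn \<omega> o' y)) \<longlonglongrightarrow> 0"
    using p perc by (intro escape_limit_zero) auto
  then have "?c \<le> 0" by (rule LIMSEQ_le_const) (use bound in auto)
  then show False using c by simp
qed

text \<open>An automorphism carries edges inside \<open>S\<close> and boundary edges of
  \<open>S\<close> to those of the image, so the two sums match term by term. The inequality points
  from the orbit representative to its copy, the direction in which a small \<open>phi\<close> has
  to be transported.\<close>

lemma phi_automorphism:
  assumes p: "0 \<le> p" "p \<le> 1" and W: "\<And>e. e \<in> EE \<Longrightarrow> e \<subseteq> W"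
    and h: "bij_betw h W W" "\<And>u v. u \<in> W \<Longrightarrow> v \<in> W \<Longrightarrow> {h u, h v} \<in> EE \<longleftrightarrow> {u, v} \<in> EE"
    and S: "S \<subseteq> W" "x \<in> S"
  shows "phi p (h x) (h ` S) \<le> phi p x S" and "bd (h ` S) = map_prod h h ` bd S"
proof -
  have inj: "inj_on h W" and surj: "h ` W = W" using h by (auto simp: bij_betw_def)
  have injE: "inj_on ((`) h) (Pow W)" using inj by (rule inj_on_image_Pow)
  have two': "\<exists>a b. e = {a, b}" if "e \<in> EE" for e
    using two[OF that] by (auto simp: card_2_iff)
  \<comment> \<open>The hypothesis on \<open>h\<close> speaks of pairs; injectivity on
    \<open>W\<close> shows that a set whose image is an edge is itself a pair.\<close>
  have edge: "h ` e \<in> EE \<longleftrightarrow> e \<in> EE" if e: "e \<subseteq> W" for e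
  proof -
    have "\<exists>a b. e = {a, b}" if "h ` e \<in> EE"
    proof -
      have "inj_on h e" using inj e inj_on_subset by blast
      then have "card e = 2" using two[OF that] by (simp add: card_image)
      then show ?thesis by (auto simp: card_2_iff)
    qed
    then obtain a b where "h ` e \<in> EE \<or> e \<in> EE \<Longrightarrow> e = {a, b}" using two' by metis
    then show ?thesis using h(2)[of a b] e by fastforce
  qed
  have edges: "edges_in (h ` S) EE = (`) h ` edges_in S EE"
  proof (intro equalityI subsetI)
    fix e assume e: "e \<in> edges_in (h ` S) EE"
    then obtain e' where "e' \<subseteq> S" "e = h ` e'" by (auto simp: edges_in_def subset_image_iff)
    then show "e \<in> (`) h ` edges_in S EE" using e edge[of e'] S by (auto simp: edges_in_def)
  next
    fix e assume "e \<in> (`) h ` edges_in S EE"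
    then show "e \<in> edges_in (h ` S) EE" using edge S by (fastforce simp: edges_in_def)
  qed
  show bd: "bd (h ` S) = map_prod h h ` bd S"
  proof (intro equalityI subsetI)
    fix a assume a: "a \<in> bd (h ` S)"
    then obtain y z where yz: "a = (h y, z)" "y \<in> S" "z \<notin> h ` S" "{h y, z} \<in> EE" by (auto simp: bd_def)
    have "z \<in> W" using W[OF yz(4)] by auto
    then obtain z' where z': "z = h z'" "z' \<in> W" using surj by auto
    then have "(y, z') \<in> bd S" using yz h(2)[of y z'] S by (auto simp: bd_def)
    then show "a \<in> map_prod h h ` bd S" using yz z' by force
  next
    fix a assume "a \<in> map_prod h h ` bd S"
    then obtain y z where yz: "a = (h y, h z)" "y \<in> S" "z \<notin> S" "{y, z} \<in> EE" by (auto simp: bd_def)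
    have "z \<in> W" using W[OF yz(4)] by auto
    then have "h z \<notin> h ` S" using yz inj S by (auto dest: inj_onD)
    then show "a \<in> bd (h ` S)" using yz h(2)[of y z] S \<open>z \<in> W\<close> by (auto simp: bd_def)
  qed
  have conn_h: "conn \<omega> x y" if w: "\<omega> \<subseteq> edges_in S EE" and c: "conn ((`) h ` \<omega>) (h x) (h y)" and y: "y \<in> S" for \<omega> y
  proof -
    \<comment> \<open>The path in the image is lifted step by step; each edge used is the image of
      an edge inside \<open>S\<close>, and injectivity identifies the lifted endpoints.\<close>
    have "\<exists>u\<in>S. h y = h u \<and> conn \<omega> x u" using c
    proof (induction rule: conn_induct)
      case (step a b)
      then obtain u where u: "u \<in> S" "a = h u" "conn \<omega> x u" by auto
      obtain e where e: "e \<in> \<omega>" "{a, b} = h ` e" using step by auto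
      have eS: "e \<subseteq> S" using e w by (auto simp: edges_in_def)
      obtain v where v: "v \<in> e" "h v = b" using e by (metis image_iff insertI1 insert_commute)
      obtain u' where u': "u' \<in> e" "h u' = a" using e by (metis image_iff insertI1)
      have "u' = u" using u' u eS S inj by (metis inj_onD subsetD)
      have "e \<in> EE" using e w by (auto simp: edges_in_def)
      have "card (h ` e) = 2" using edge[of e] eS S two[of "h ` e"] \<open>e \<in> EE\<close> by auto
      then have "card {a, b} = 2" using e(2) by simp
      then have "a \<noteq> b" by auto
      then have "u' \<noteq> v" using u' v by auto
      have "e = {u, v}"
        using two'[OF \<open>e \<in> EE\<close>] u'(1) v(1) \<open>u' \<noteq> v\<close> \<open>u' = u\<close> by auto
      then have "conn \<omega> x v" using u e conn_trans conn_edge by metis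
      then show ?case using v eS by auto
    qed (use S in auto)
    then show ?thesis using inj S y by (metis inj_onD subsetD)
  qed
  have inj_bd: "inj_on (map_prod h h) (bd S)"
  proof -
    have "bd S \<subseteq> W \<times> W" using W S by (auto simp: bd_def)
    moreover have "inj_on (map_prod h h) (W \<times> W)" using inj by (simp add: map_prod_inj_on)
    ultimately show ?thesis using inj_on_subset by blast
  qed
  have "bprob (\<lambda>_. p) (edges_in (h ` S) EE) (\<lambda>\<omega>. conn \<omega> (h x) (h y)) \<le>
    bprob (\<lambda>_. p) (edges_in S EE) (\<lambda>\<omega>. conn \<omega> x y)" if "y \<in> S" for y
  proof -
    have "inj_on ((`) h) (edges_in S EE)"
      by (rule inj_on_subset[OF injE]) (use S in \<open>auto simp: edges_in_def\<close>)
    then have "bprob (\<lambda>_. p) (edges_in (h ` S) EE) (\<lambda>\<omega>. conn \<omega> (h x) (h y)) =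
      bprob (\<lambda>_. p) (edges_in S EE) (\<lambda>\<omega>. conn ((`) h ` \<omega>) (h x) (h y))"
      unfolding edges by (rule bexp_image)
    also have "\<dots> \<le> bprob (\<lambda>_. p) (edges_in S EE) (\<lambda>\<omega>. conn \<omega> x y)"
      using p conn_h that by (intro bexp_mono) (auto simp: of_bool_def)
    finally show ?thesis .
  qed
  then show "phi p (h x) (h ` S) \<le> phi p x S"
    unfolding phi_def bd sum.reindex[OF inj_bd] using p
    by (intro mult_left_mono sum_mono) (auto simp: bd_def)
qed

lemma nbhd_automorphism:
  assumes h: "\<And>u v. {u, v} \<in> EE \<Longrightarrow> {h u, h v} \<in> EE" and "y \<in> nbhd n x"
  shows "h y \<in> nbhd n (h x)"
proof -
  have "(h x, h y) \<in> adj_rel EE ^^ m" if "(x, y) \<in> adj_rel EE ^^ m" for m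
    using that by (induction m arbitrary: y) (use h in \<open>auto simp: adj_rel_def\<close>)
  then show ?thesis using assms by (auto simp: nbhd_def)
qed

end

section \<open>Good environments\<close>

text \<open>Arbitrary finite sets beyond \<open>N0\<close> are allowed because both uses sum over
  the distances of an irregular set of indices.\<close>

lemma summable_tail_half:
  fixes Q :: "nat \<Rightarrow> real"
  assumes "summable Q" "\<And>k. 0 \<le> Q k"
  obtains N0 where "\<And>K. finite K \<Longrightarrow> K \<subseteq> {N0..} \<Longrightarrow> sum Q K \<le> 1/2"
proof -
  obtain N0 where N0: "\<And>m n. m \<ge> N0 \<Longrightarrow> norm (sum Q {m..<n}) < 1/2"
    using assms(1) unfolding summable_Cauchy by (metis half_gt_zero zero_less_one)
  have "sum Q K \<le> 1/2" if "finite K" "K \<subseteq> {N0..}" for K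
  proof -
    have "K \<subseteq> {N0..<Suc (Max K)}" using that by (auto simp: less_Suc_eq_le)
    then have "sum Q K \<le> sum Q {N0..<Suc (Max K)}"
      using assms(2) by (intro sum_mono2) auto
    also have "\<dots> \<le> 1/2" using N0[of N0 "Suc (Max K)"] by auto
    finally show ?thesis .
  qed
  then show ?thesis by (rule that)
qed

context prob_space
begin

text \<open>The number of \<open>k\<close> with \<open>\<epsilon> * k < Y\<close> is at most
  \<open>Y / \<epsilon> + 1\<close>, and taking expectations bounds the partial sums. This is where
  a finite logarithmic moment becomes input for Borel-Cantelli.\<close>

lemma summable_tail_probabilities:
  fixes Y :: "'a \<Rightarrow> real"
  assumes int: "integrable M Y" and Y: "\<And>\<omega>. \<omega> \<in> space M \<Longrightarrow> 0 \<le> Y \<omega>" and \<epsilon>: "0 < \<epsilon>"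
  shows "summable (\<lambda>k. prob {\<omega>\<in>space M. Y \<omega> > \<epsilon> * real k})"
proof (rule summableI_nonneg_bounded)
  fix K :: nat
  let ?B = "\<lambda>k. {\<omega>\<in>space M. Y \<omega> > \<epsilon> * real k}"
  have [measurable]: "Y \<in> borel_measurable M" using int by auto
  have B: "?B k \<in> events" for k by measurable
  have "(\<Sum>k<K. prob (?B k)) = expectation (\<lambda>\<omega>. \<Sum>k<K. indicator (?B k) \<omega>)"
    using B by (subst Bochner_Integration.integral_sum) (auto simp: less_top[symmetric])
  also have "\<dots> \<le> expectation (\<lambda>\<omega>. Y \<omega> / \<epsilon> + 1)"
  proof (rule integral_mono)
    show "integrable M (\<lambda>\<omega>. \<Sum>k<K. indicator (?B k) \<omega> :: real)"
      using B by (intro Bochner_Integration.integrable_sum) (auto simp: less_top[symmetric])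
    show "integrable M (\<lambda>\<omega>. Y \<omega> / \<epsilon> + 1)" using int by auto
    fix \<omega> assume w: "\<omega> \<in> space M"
    have "(\<Sum>k<K. indicator (?B k) \<omega>) = real (card {k\<in>{..<K}. \<epsilon> * real k < Y \<omega>})"
      using w by (simp add: indicator_def of_bool_def sum.If_cases Int_def)
    also have "\<dots> \<le> real (card {..<nat \<lceil>Y \<omega> / \<epsilon>\<rceil>})"
    proof -
      have "{k\<in>{..<K}. \<epsilon> * real k < Y \<omega>} \<subseteq> {..<nat \<lceil>Y \<omega> / \<epsilon>\<rceil>}"
      proof
        fix k assume "k \<in> {k\<in>{..<K}. \<epsilon> * real k < Y \<omega>}"
        then have "real k < Y \<omega> / \<epsilon>" using \<epsilon> by (simp add: field_simps)
        then show "k \<in> {..<nat \<lceil>Y \<omega> / \<epsilon>\<rceil>}" by (simp add: less_ceiling_iff zless_nat_eq_int_zless)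
      qed
      then show ?thesis by (intro of_nat_mono card_mono) auto
    qed
    also have "\<dots> \<le> Y \<omega> / \<epsilon> + 1"
      using Y[OF w] \<epsilon> by (simp add: of_nat_nat)
    finally show "(\<Sum>k<K. indicator (?B k) \<omega>) \<le> Y \<omega> / \<epsilon> + 1" .
  qed
  finally show "(\<Sum>k<K. prob (?B k)) \<le> expectation (\<lambda>\<omega>. Y \<omega> / \<epsilon> + 1)" .
qed simp

lemma positive_atom:
  fixes X :: "'a \<Rightarrow> nat"
  assumes meas: "\<And>A. {\<omega>\<in>space M. X \<omega> \<in> A} \<in> events"
  shows "\<exists>m. 0 < prob {\<omega>\<in>space M. X \<omega> = m}"
proof (rule ccontr)
  have m: "{\<omega>\<in>space M. X \<omega> = m} \<in> events" for m using meas[of "{m}"] by simp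
  assume "\<not> ?thesis"
  then have "prob {\<omega>\<in>space M. X \<omega> = m} = 0" for m
    by (metis less_eq_real_def measure_nonneg)
  then have "AE \<omega> in M. X \<omega> \<noteq> m" for m
    using prob_eq_0[OF m] by (auto elim: eventually_mono)
  then have "AE \<omega> in M. \<forall>m. X \<omega> \<noteq> m" by (intro AE_all_countable[THEN iffD2] allI)
  then have "AE \<omega> in M. False" by (rule eventually_mono) blast
  then show False by simp
qed

text \<open>With probabilities bounded below the limit superior has probability at least
  \<open>\<delta>\<close>, and the zero-one law raises this to 1.\<close>

lemma borel_cantelli_infinite:
  fixes F :: "nat \<Rightarrow> 'a set"
  assumes "indep_events F UNIV" and \<delta>: "0 < \<delta>" "\<And>n. \<delta> \<le> prob (F n)"
  shows "AE \<omega> in M. infinite {n. \<omega> \<in> F n}"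
proof -
  have F: "F n \<in> events" for n using assms(1) by (auto simp: indep_events_def)
  let ?L = "\<Inter>n. \<Union>m\<in>{n..}. F m"
  have L: "?L \<in> events" using F by auto
  have "(\<lambda>n. prob (\<Union>m\<in>{n..}. F m)) \<longlonglongrightarrow> prob ?L"
    using F by (intro finite_Lim_measure_decseq decseq_SucI UN_mono) auto
  moreover have "\<delta> \<le> prob (\<Union>m\<in>{n..}. F m)" for n
    using \<delta>(2)[of n] F by (intro order_trans[OF \<delta>(2)[of n]] finite_measure_mono) auto
  ultimately have "\<delta> \<le> prob ?L" by (intro LIMSEQ_le_const) auto
  then have "prob ?L = 1" using borel_0_1_law[OF assms(1)] \<delta> by auto
  then have "AE \<omega> in M. \<omega> \<in> ?L" using L by (simp add: prob_eq_1)
  then show ?thesis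
    by (rule eventually_mono) (auto simp: infinite_nat_iff_unbounded_le)
qed

text \<open>Dyadic blocks: the block \<open>{2^i..<2^(i+1)}\<close> contains the window of \<open>N\<close> equal values at its
  upper end, and every index below the block is at distance at least its absolute value from
  the upper end, so that there a Borel--Cantelli bound suffices.\<close>

lemma good_blocks:
  fixes X :: "int \<Rightarrow> 'a \<Rightarrow> nat" and b :: "nat \<Rightarrow> real" and \<epsilon> :: real
  assumes meas: "\<And>j A. {\<omega>\<in>space M. X j \<omega> \<in> A} \<in> events"
    and prod: "\<And>J A. finite J \<Longrightarrow> prob {\<omega>\<in>space M. \<forall>j\<in>J. X j \<omega> \<in> A j} =
      (\<Prod>j\<in>J. prob {\<omega>\<in>space M. X 0 \<omega> \<in> A j})"
    and b: "\<And>k. 0 \<le> b k" and int: "integrable M (\<lambda>\<omega>. b (X 0 \<omega>))" and \<epsilon>: "0 < \<epsilon>"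
  shows "\<exists>m0 N0. \<forall>N\<ge>N0. AE \<omega> in M. \<forall>a. \<exists>n\<ge>a.
     (\<forall>j. n - int N < j \<and> j \<le> n \<longrightarrow> X j \<omega> = m0) \<and>
     (\<forall>j\<le>n - int N. b (X j \<omega>) \<le> \<epsilon> * real_of_int (n - j))"
proof -
  define Q where "Q k = prob {\<omega>\<in>space M. b (X 0 \<omega>) > \<epsilon> * real k}" for k :: nat
  have sumQ: "summable Q"
    unfolding Q_def using int b \<epsilon> by (intro summable_tail_probabilities) auto
  have Q01: "Q k \<in> {0..1}" for k by (simp add: Q_def)
  obtain m0 where m0: "0 < prob {\<omega>\<in>space M. X 0 \<omega> = m0}"
    using positive_atom[of "X 0"] meas by blast
  define \<pi> where "\<pi> = prob {\<omega>\<in>space M. X 0 \<omega> = m0}"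
  have \<pi>: "0 < \<pi>" "\<pi> \<le> 1" using m0 by (auto simp: \<pi>_def)
  \<comment> \<open>Windows of length at least \<open>N0\<close> leave only distances whose failure
    probabilities sum to at most 1/2.\<close>
  obtain N0 where tail: "\<And>K. finite K \<Longrightarrow> K \<subseteq> {N0..} \<Longrightarrow> sum Q K \<le> 1/2"
    using summable_tail_half[OF sumQ] Q01 by auto
  have probX: "prob {\<omega>\<in>space M. X j \<omega> \<in> A} = prob {\<omega>\<in>space M. X 0 \<omega> \<in> A}" for j A
    using prod[of "{j}" "\<lambda>_. A"] by simp
  have far: "AE \<omega> in M. eventually (\<lambda>k. b (X (f k) \<omega>) \<le> \<epsilon> * real k) sequentially" for f :: "nat \<Rightarrow> int"
  proof -
    let ?A = "\<lambda>k. {\<omega>\<in>space M. X (f k) \<omega> \<in> {v. b v > \<epsilon> * real k}}"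
    have "prob (?A k) = Q k" for k
      using probX[of "f k" "{v. b v > \<epsilon> * real k}"] by (simp add: Q_def)
    then have "AE \<omega> in M. eventually (\<lambda>k. \<omega> \<in> space M - ?A k) sequentially"
      using sumQ by (intro borel_cantelli_AE1 meas) (auto simp: emeasure_eq_measure)
    then show ?thesis
      by (rule eventually_mono) (auto elim!: eventually_mono)
  qed
  have main: "AE \<omega> in M. \<forall>a. \<exists>n\<ge>a.
     (\<forall>j. n - int N < j \<and> j \<le> n \<longrightarrow> X j \<omega> = m0) \<and>
     (\<forall>j\<le>n - int N. b (X j \<omega>) \<le> \<epsilon> * real_of_int (n - j))" if N: "N \<ge> N0" for N
  proof -
    define Bk where "Bk i = {2 ^ i..<2 ^ Suc i :: int}" for i :: nat
    define top where "top i = (2 ^ Suc i - 1 :: int)" for i :: nat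
    \<comment> \<open>The prescription for the value at index \<open>j\<close> of block
      \<open>i\<close>: the atom \<open>m0\<close> within the window, the linear bound elsewhere. It
      concerns indices of the block only, so the events \<open>H i\<close> are independent.\<close>
    define S where "S i j = (if top i - j < int N then {m0} else {v. b v \<le> \<epsilon> * real_of_int (top i - j)})" for i j
    define H where "H i = {\<omega>\<in>space M. \<forall>j\<in>Bk i. X j \<omega> \<in> S i j}" for i
    have finBk: "finite (Bk i)" for i by (simp add: Bk_def)
    have H_events: "H i \<in> events" for i
      unfolding H_def using meas finBk by (intro sets.sets_Collect_finite_All) auto
    have disj: "i = i'" if "j \<in> Bk i" "j \<in> Bk i'" for j i i'
    proof -
      have "(2::int) ^ i < 2 ^ Suc i'" "(2::int) ^ i' < 2 ^ Suc i" using that by (auto simp: Bk_def)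
      then have "i < Suc i'" "i' < Suc i"
        using power_less_imp_less_exp[of "2::int"] by (metis one_less_numeral_iff semiring_norm(76))+
      then show ?thesis by simp
    qed
    have ind: "indep_events H UNIV"
    proof (rule indep_eventsI)
      fix J :: "nat set" assume J: "finite J" "J \<noteq> {}"
      \<comment> \<open>The blocks are disjoint, so the prescriptions of several blocks merge into
        one set per index, the form in which the product formula applies.\<close>
      define S' where "S' j = {v. \<forall>i. j \<in> Bk i \<longrightarrow> v \<in> S i j}" for j
      have S': "S' j = S i j" if "j \<in> Bk i" for i j using disj that by (auto simp: S'_def)
      have "(\<Inter>i\<in>J. H i) = {\<omega>\<in>space M. \<forall>j\<in>(\<Union>i\<in>J. Bk i). X j \<omega> \<in> S' j}"
        using J S' by (auto simp: H_def)
      then have "prob (\<Inter>i\<in>J. H i) = (\<Prod>j\<in>(\<Union>i\<in>J. Bk i). prob {\<omega>\<in>space M. X 0 \<omega> \<in> S' j})"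
        using J finBk by (simp only:) (intro prod finite_UN_I)
      also have "\<dots> = (\<Prod>i\<in>J. \<Prod>j\<in>Bk i. prob {\<omega>\<in>space M. X 0 \<omega> \<in> S' j})"
        using J finBk disj by (intro prod.UNION_disjoint) auto
      also have "\<dots> = (\<Prod>i\<in>J. prob (H i))"
      proof (intro prod.cong refl)
        fix i
        have "(\<Prod>j\<in>Bk i. prob {\<omega>\<in>space M. X 0 \<omega> \<in> S' j}) = (\<Prod>j\<in>Bk i. prob {\<omega>\<in>space M. X 0 \<omega> \<in> S i j})"
          using S' by (intro prod.cong) auto
        then show "(\<Prod>j\<in>Bk i. prob {\<omega>\<in>space M. X 0 \<omega> \<in> S' j}) = prob (H i)"
          unfolding H_def using prod[OF finBk] by simp
      qed
      finally show "prob (\<Inter>i\<in>J. H i) = (\<Prod>i\<in>J. prob (H i))" .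
    qed (use H_events in auto)
    have lower: "\<pi> ^ N / 2 \<le> prob (H i)" for i
    proof -
      define J1 where "J1 = {j\<in>Bk i. top i - j < int N}"
      define J2 where "J2 = {j\<in>Bk i. \<not> top i - j < int N}"
      let ?r = "\<lambda>j. prob {\<omega>\<in>space M. X 0 \<omega> \<in> S i j}"
      have le: "j \<le> top i" if "j \<in> Bk i" for j using that by (simp add: Bk_def top_def)
      have fin: "finite J1" "finite J2" using finBk by (auto simp: J1_def J2_def)
      have "prob (H i) = prod ?r (Bk i)" unfolding H_def using prod[OF finBk] by simp
      also have "Bk i = J1 \<union> J2" by (auto simp: J1_def J2_def)
      also have "prod ?r (J1 \<union> J2) = prod ?r J1 * prod ?r J2"
        using fin by (intro prod.union_disjoint) (auto simp: J1_def J2_def)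
      finally have eq: "prob (H i) = prod ?r J1 * prod ?r J2" .
      have "prod ?r J1 = (\<Prod>j\<in>J1. \<pi>)"
        by (intro prod.cong) (auto simp: J1_def S_def \<pi>_def)
      also have "\<dots> = \<pi> ^ card J1" by simp
      \<comment> \<open>A block shorter than \<open>N\<close> contains only part of its window;
        fewer factors only increase the product, since \<open>\<pi> \<le> 1\<close>.\<close>
      also have "\<dots> \<ge> \<pi> ^ N"
      proof (rule power_decreasing)
        have "J1 \<subseteq> {top i - int N<..top i}" using le by (auto simp: J1_def)
        then have "card J1 \<le> card {top i - int N<..top i}" by (intro card_mono) auto
        then show "card J1 \<le> N" by simp
      qed (use \<pi> in auto)
      finally have 1: "\<pi> ^ N \<le> prod ?r J1" .
      let ?k = "\<lambda>j. nat (top i - j)"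
      have inj: "inj_on ?k J2" using le by (auto simp: inj_on_def J2_def)
      have "sum (\<lambda>j. Q (?k j)) J2 = sum Q (?k ` J2)" using inj by (simp add: sum.reindex)
      also have "\<dots> \<le> 1/2" using fin N by (intro tail) (auto simp: J2_def)
      finally have "1/2 \<le> 1 - sum (\<lambda>j. Q (?k j)) J2" by simp
      \<comment> \<open>The Weierstrass inequality keeps the product over the rest of the block
        above 1/2 whatever the length of the block.\<close>
      also have "\<dots> \<le> (\<Prod>j\<in>J2. 1 - Q (?k j))" using Q01 by (intro Weierstrass_prod_ineq) auto
      also have "\<dots> = prod ?r J2"
      proof (intro prod.cong refl)
        fix j assume j: "j \<in> J2"
        then have k: "real (?k j) = real_of_int (top i - j)" using le by (auto simp: J2_def)
        have "1 - Q (?k j) = prob (space M - {\<omega>\<in>space M. b (X 0 \<omega>) > \<epsilon> * real (?k j)})"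
          unfolding Q_def using meas[of 0 "{v. b v > \<epsilon> * real (?k j)}"] by (subst prob_compl) auto
        also have "space M - {\<omega>\<in>space M. b (X 0 \<omega>) > \<epsilon> * real (?k j)} = {\<omega>\<in>space M. X 0 \<omega> \<in> S i j}"
          using j k by (auto simp: S_def J2_def)
        finally show "1 - Q (?k j) = ?r j" .
      qed
      finally have 2: "1/2 \<le> prod ?r J2" .
      have "\<pi> ^ N * (1/2) \<le> prod ?r J1 * prod ?r J2"
        using 1 2 \<pi> by (intro mult_mono) (auto intro: prod_nonneg)
      then show ?thesis using eq by simp
    qed
    have inf: "AE \<omega> in M. infinite {i. \<omega> \<in> H i}"
      using ind lower \<pi> by (intro borel_cantelli_infinite[of H "\<pi> ^ N / 2"]) auto
    show ?thesis using inf far[of int] far[of "\<lambda>k. - int k"]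
    proof eventually_elim
      case (elim \<omega>)
      obtain k1 where k1: "\<And>k. k \<ge> k1 \<Longrightarrow> b (X (int k) \<omega>) \<le> \<epsilon> * real k"
        using elim(2) by (auto simp: eventually_sequentially)
      obtain k2 where k2: "\<And>k. k \<ge> k2 \<Longrightarrow> b (X (- int k) \<omega>) \<le> \<epsilon> * real k"
        using elim(3) by (auto simp: eventually_sequentially)
      define J0 where "J0 = max k1 k2"
      have far: "b (X j \<omega>) \<le> \<epsilon> * real_of_int \<bar>j\<bar>" if "\<bar>j\<bar> \<ge> int J0" for j
        using k1[of "nat j"] k2[of "nat (- j)"] that by (cases "j \<ge> 0") (auto simp: J0_def)
      \<comment> \<open>The finitely many values near the origin escape the Borel-Cantelli bound;
        their maximum is absorbed by the distance from a far window.\<close>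
      define c where "c = Max ((\<lambda>j. b (X j \<omega>)) ` {- int J0..int J0})"
      have c: "b (X j \<omega>) \<le> c" if "\<bar>j\<bar> < int J0" for j
        unfolding c_def using that by (intro Max_ge imageI) auto
      show ?case
      proof
        fix a :: int
        obtain m where m: "real m \<ge> c / \<epsilon>" using real_arch_simple by blast
        \<comment> \<open>Since \<open>i < 2 ^ i\<close>, the three summands put the window inside
          its block, make its upper end exceed \<open>a\<close>, and give
          \<open>c \<le> \<epsilon> * l\<close> for all distances
          \<open>l \<ge> 2 ^ i\<close>.\<close>
        obtain i where i: "i \<ge> N + nat a + m" "\<omega> \<in> H i"
          using elim(1) unfolding infinite_nat_iff_unbounded_le by auto
        have i2: "int i < 2 ^ i" using of_nat_less_iff[of i "2 ^ i", where ?'a = int] less_exp[of i] by simp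
        let ?n = "top i"
        have n: "?n \<ge> 2 ^ i" "?n = 2 * 2 ^ i - 1" by (auto simp: top_def)
        have cb: "c \<le> \<epsilon> * real_of_int l" if "l \<ge> 2 ^ i" for l
        proof -
          have "int m \<le> l" using i i2 that by linarith
          then have "real m \<le> real_of_int l" by linarith
          then have "c / \<epsilon> \<le> real_of_int l" using m by linarith
          then show ?thesis using \<epsilon> by (simp add: field_simps)
        qed
        have win: "X j \<omega> = m0" if j: "?n - int N < j" "j \<le> ?n" for j
        proof -
          have "int N \<le> int i" using i(1) by linarith
          then have "2 ^ i \<le> j" using j i2 n by linarith
          then have "j \<in> Bk i" using j n by (simp add: Bk_def)
          then have "X j \<omega> \<in> S i j" using i by (auto simp: H_def)
          then show ?thesis using j by (auto simp: S_def split: if_splits)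
        qed
        have rest: "b (X j \<omega>) \<le> \<epsilon> * real_of_int (?n - j)" if j: "j \<le> ?n - int N" for j
        proof (cases "j \<ge> 2 ^ i")
          case True
          then have "j \<in> Bk i" using j n by (auto simp: Bk_def)
          then have "X j \<omega> \<in> S i j" using i by (auto simp: H_def)
          then show ?thesis using j by (auto simp: S_def split: if_splits)
        next
          case False
          moreover have "(1::int) \<le> 2 ^ i" by simp
          ultimately have jn: "\<bar>j\<bar> \<le> ?n - j" "2 ^ i \<le> ?n - j" using n by linarith+
          show ?thesis
          proof (cases "\<bar>j\<bar> < int J0")
            case True
            then show ?thesis using c[of j] cb[OF jn(2)] by linarith
          next
            case False
            then have "b (X j \<omega>) \<le> \<epsilon> * real_of_int \<bar>j\<bar>" using far by auto
            also have "\<dots> \<le> \<epsilon> * real_of_int (?n - j)"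
              using jn(1) \<epsilon> by (intro mult_left_mono) (auto simp del: of_int_abs of_int_diff)
            finally show ?thesis .
          qed
        qed
        have "a \<le> ?n" using i i2 n by linarith
        then show "\<exists>n\<ge>a. (\<forall>j. n - int N < j \<and> j \<le> n \<longrightarrow> X j \<omega> = m0) \<and>
          (\<forall>j\<le>n - int N. b (X j \<omega>) \<le> \<epsilon> * real_of_int (n - j))"
          using win rest by (intro exI[of _ ?n]) auto
      qed
    qed
  qed
  then show ?thesis by blast
qed

end

section \<open>Blocking the stack\<close>

text \<open>If a path uses edges of \<open>F\<close>, its part after the last such edge starts at an
  endpoint of that edge.\<close>

lemma conn_avoid_or_hit:
  assumes "conn \<omega> x y"
  shows "conn (\<omega> - F) x y \<or> (\<exists>z\<in>\<Union>F. conn \<omega> z y)"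
  using assms
proof (induction rule: conn_induct)
  case (step u v)
  show ?case
  proof (cases "{u, v} \<in> F")
    case True
    then show ?thesis by (intro disjI2 bexI[of _ v]) auto
  next
    case False
    then have "{u, v} \<in> \<omega> - F" using step by auto
    then show ?thesis using step conn_trans conn_edge by metis
  qed
qed simp

lemma conn_in_Union:
  assumes "conn \<omega> x y" "x \<noteq> y"
  shows "x \<in> \<Union>\<omega>"
proof -
  have "conn \<omega> y x" using assms conn_sym by metis
  then have "x = y \<or> x \<in> \<Union>\<omega>" by (induction rule: conn_induct) auto
  then show ?thesis using assms by auto
qed

text \<open>One end of the stack, reduced to what blocking uses, so that the upper and the lower end
  are two instances, with \<open>ht\<close> the height or its negative. The box of index
  \<open>j\<close> lies between the levels \<open>t (j - 1)\<close> and \<open>t j\<close>. The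
  parameter \<open>q\<close> bounds all edge probabilities, also those outside the boxes, because
  every edge at a window has to be closed.\<close>

locale stack = lf_edges EE for EE :: "'b set set" +
  fixes W :: "'b set" and Bx :: "int \<Rightarrow> 'b set" and t :: "int \<Rightarrow> int" and ht :: "'b \<Rightarrow> int"
    and pr :: "'b set \<Rightarrow> real" and p q :: real and f :: "nat \<Rightarrow> real" and o' :: 'b
    and M :: nat and N :: int
  assumes W: "e \<in> EE \<Longrightarrow> e \<subseteq> W" and BxW: "Bx j \<subseteq> W" and finBx: "finite (Bx j)"
    and pr: "e \<in> EE \<Longrightarrow> 0 \<le> pr e \<and> pr e \<le> q" and q: "0 \<le> q" "q < 1"
    and out: "e \<in> EE \<Longrightarrow> \<not> e \<subseteq> (\<Union>j. Bx j) \<Longrightarrow> pr e = p"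
    and ht: "{u, v} \<in> EE \<Longrightarrow> \<bar>ht u - ht v\<bar> \<le> 1"
    and t_step: "t j + 2 \<le> t (j + 1)"
    and ht_Bx: "u \<in> Bx j \<Longrightarrow> t (j - 1) \<le> ht u \<and> ht u \<le> t j"
    and p: "0 \<le> p" "p \<le> 1"
    and decay: "x \<in> W \<Longrightarrow> finite F \<Longrightarrow> F \<subseteq> EE \<Longrightarrow>
      bprob (\<lambda>_. p) F (\<lambda>\<omega>. \<exists>y. ht y \<ge> ht x + int n \<and> conn \<omega> x y) \<le> f n"
    and f0: "f \<longlonglongrightarrow> 0"
    and N: "N \<ge> 1"
    and good: "\<exists>n\<ge>a. card (touching (\<Union>j\<in>{n - N<..n}. Bx j) EE) \<le> M \<and>
      (\<forall>J. finite J \<longrightarrow> J \<subseteq> {..n - N} \<longrightarrow> (\<Sum>j\<in>J. card (Bx j) * f (nat (n - j))) \<le> 1/2)"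
    and o': "o' \<in> Bx 0"
begin

definition up :: "int \<Rightarrow> 'b set" where "up a = (\<Union>k\<in>{a..}. Bx k)"

definition lower :: "int \<Rightarrow> 'b set" where "lower n = (\<Union>j\<in>{..n}. Bx j)"

definition reach :: "int \<Rightarrow> 'b \<Rightarrow> 'b set set \<Rightarrow> bool" where
  "reach a x \<omega> \<longleftrightarrow> (\<exists>y\<in>up a. conn \<omega> x y)"

lemma reach_mono: "reach a x \<omega> \<Longrightarrow> \<omega> \<subseteq> \<omega>' \<Longrightarrow> reach a x \<omega>'"
  unfolding reach_def by (blast intro: conn_mono)

lemma up_antimono: "a \<le> b \<Longrightarrow> up b \<subseteq> up a"
  unfolding up_def by (intro UN_mono) auto

lemma t_mono: "i \<le> j \<Longrightarrow> t i + 2 * (j - i) \<le> t j"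
proof (induction j rule: int_ge_induct)
  case (step j) then show ?case using t_step[of j] by simp
qed simp

lemma t_window: "t (n - N) + 2 * N \<le> t n"
  using t_mono[of "n - N" n] N by simp

lemma ht_up: "u \<in> up (n + 1) \<Longrightarrow> t n \<le> ht u"
proof -
  assume "u \<in> up (n + 1)"
  then obtain k where k: "k \<ge> n + 1" "u \<in> Bx k" by (auto simp: up_def)
  then have "t (k - 1) \<le> ht u" using ht_Bx by blast
  moreover have "t n + 2 * (k - 1 - n) \<le> t (k - 1)" using k by (intro t_mono) simp
  ultimately show ?thesis using k by simp
qed

lemma ht_lower: "u \<in> lower n \<Longrightarrow> ht u \<le> t n"
proof -
  assume "u \<in> lower n"
  then obtain k where k: "k \<le> n" "u \<in> Bx k" by (auto simp: lower_def)
  then have "ht u \<le> t k" using ht_Bx by blast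
  then show ?thesis using t_mono[OF k(1)] k by simp
qed

lemma f_nonneg: "0 \<le> f n"
proof -
  have "0 \<le> bprob (\<lambda>_. p) {} (\<lambda>\<omega>. \<exists>y. ht y \<ge> ht o' + int n \<and> conn \<omega> o' y)" by simp
  also have "\<dots> \<le> f n" using o' BxW by (intro decay) auto
  finally show ?thesis .
qed

lemma pr01: "e \<in> EE \<Longrightarrow> 0 \<le> pr e \<and> pr e \<le> 1"
  using pr q by force

text \<open>With the window closed, an open edge between vertices of the stack cannot lead from
  below the window to above it: an edge changes the height by at most 1, the window is at least
  \<open>2 * N\<close> high. So the path must pass by edges leaving the stack, starting at its last
  return to a lower box.\<close>

lemma crossing:
  assumes n: "0 \<le> n - N" and \<omega>: "\<omega> \<subseteq> EE" and closed: "\<omega> \<inter> touching (\<Union>j\<in>{n - N<..n}. Bx j) EE = {}"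
    and r: "reach (n + 1) o' \<omega>"
  shows "\<exists>x\<in>lower (n - N). reach (n + 1) x {e\<in>\<omega>. \<not> e \<subseteq> (\<Union>j. Bx j)}"
proof -
  let ?R = "\<Union>j. Bx j" and ?w = "{e\<in>\<omega>. \<not> e \<subseteq> (\<Union>j. Bx j)}"
  have split: "v \<in> lower (n - N) \<or> v \<in> up (n + 1)" if "{u, v} \<in> \<omega>" "v \<in> ?R" for u v
  proof -
    obtain k where k: "v \<in> Bx k" using \<open>v \<in> ?R\<close> by auto
    have "\<not> (n - N < k \<and> k \<le> n)"
    proof
      assume "n - N < k \<and> k \<le> n"
      then have "{u, v} \<in> touching (\<Union>j\<in>{n - N<..n}. Bx j) EE"
        using that k \<omega> by (auto simp: touching_def)
      then show False using closed that by auto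
    qed
    then show ?thesis using k by (fastforce simp: lower_def up_def)
  qed
  have gap: False if "u \<in> lower (n - N)" "v \<in> up (n + 1)" "{u, v} \<in> EE" for u v
    using ht[OF that(3)] ht_lower[OF that(1)] ht_up[OF that(2)] t_window[of n] N by linarith
  obtain y where y: "y \<in> up (n + 1)" "conn \<omega> o' y" using r by (auto simp: reach_def)
  \<comment> \<open>The vertex \<open>x\<close> is reset whenever the path uses an edge inside the
    stack, since both ends of that edge are then in lower boxes.\<close>
  have "(\<exists>x\<in>lower (n - N). conn ?w x y) \<or> (\<exists>x\<in>lower (n - N). reach (n + 1) x ?w)"
    using y(2)
  proof (induction rule: conn_induct)
    case refl
    have "o' \<in> lower (n - N)" using n o' by (auto simp: lower_def)
    then show ?case by (intro disjI1 bexI[of _ o']) auto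
  next
    case (step u v)
    show ?case
    proof (cases "\<exists>x\<in>lower (n - N). reach (n + 1) x ?w")
      case False
      then obtain x where x: "x \<in> lower (n - N)" "conn ?w x u" using step by auto
      show ?thesis
      proof (cases "{u, v} \<subseteq> ?R")
        case True
        have vu: "{v, u} \<in> \<omega>" using step by (simp add: insert_commute)
        have "u \<notin> up (n + 1)" using False x by (auto simp: reach_def)
        then have "u \<in> lower (n - N)" using split[OF vu] True by auto
        then have "v \<in> lower (n - N)" using split[OF step(2)] gap[of u v] True step \<omega> by auto
        then show ?thesis by (intro disjI1 bexI[of _ v]) auto
      next
        case out: False
        then have "{u, v} \<in> ?w" using step by auto
        then have "conn ?w x v" by (rule conn_trans[OF x(2) conn_edge])
        then show ?thesis using x(1) by blast
      qed
    qed auto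
  qed
  then show ?thesis using y by (auto simp: reach_def)
qed

lemma reach_prob_le:
  assumes "x \<in> W" "finite F" "F \<subseteq> EE" "ht x + int k \<le> t n"
  shows "bprob (\<lambda>_. p) F (reach (n + 1) x) \<le> f k"
proof -
  have "bprob (\<lambda>_. p) F (reach (n + 1) x) \<le> bprob (\<lambda>_. p) F (\<lambda>\<omega>. \<exists>y. ht y \<ge> ht x + int k \<and> conn \<omega> x y)"
  proof (rule bexp_mono)
    fix \<omega>
    have "reach (n + 1) x \<omega> \<Longrightarrow> \<exists>y. ht y \<ge> ht x + int k \<and> conn \<omega> x y"
      using ht_up assms(4) by (force simp: reach_def)
    then show "of_bool (reach (n + 1) x \<omega>) \<le> (of_bool (\<exists>y. ht y \<ge> ht x + int k \<and> conn \<omega> x y) :: real)"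
      by auto
  qed (use p in auto)
  also have "\<dots> \<le> f k" using assms by (intro decay) auto
  finally show ?thesis .
qed

text \<open>A union bound over the vertices below the window, grouped by boxes. Each box has height
  at least 2, so a difference of indices bounds the difference of heights from below and the decay
  function can be evaluated at the former.\<close>

lemma jump_prob_le:
  assumes F: "finite F" "F \<subseteq> EE"
    and half: "\<And>J. finite J \<Longrightarrow> J \<subseteq> {..n - N} \<Longrightarrow> (\<Sum>j\<in>J. card (Bx j) * f (nat (n - j))) \<le> 1/2"
  shows "bprob (\<lambda>_. p) F (\<lambda>\<omega>. \<exists>x\<in>lower (n - N). reach (n + 1) x \<omega>) \<le> 1/2"
proof -
  \<comment> \<open>The lower boxes have infinitely many vertices in total, but the start of a
    nontrivial path lies on an edge of \<open>F\<close>.\<close>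
  let ?X = "lower (n - N) \<inter> \<Union>F"
  have finX: "finite ?X" using finite_Union_edges[OF F] by auto
  have "\<forall>x\<in>?X. \<exists>j. j \<le> n - N \<and> x \<in> Bx j" by (auto simp: lower_def)
  then obtain J where J: "\<And>x. x \<in> ?X \<Longrightarrow> J x \<le> n - N \<and> x \<in> Bx (J x)" by metis
  have "bprob (\<lambda>_. p) F (\<lambda>\<omega>. \<exists>x\<in>lower (n - N). reach (n + 1) x \<omega>) \<le>
    bexp (\<lambda>_. p) F (\<lambda>\<omega>. \<Sum>x\<in>?X. of_bool (reach (n + 1) x \<omega>))"
  proof (rule bexp_mono)
    fix \<omega> assume w: "\<omega> \<subseteq> F"
    have "x \<in> ?X" if x: "x \<in> lower (n - N)" and r: "reach (n + 1) x \<omega>" for x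
    proof -
      obtain y where y: "y \<in> up (n + 1)" "conn \<omega> x y" using r by (auto simp: reach_def)
      have "x \<noteq> y" using ht_lower[OF x] ht_up[OF y(1)] t_window[of n] N by auto
      then show ?thesis using conn_in_Union[OF y(2)] w x by auto
    qed
    then have "of_bool (\<exists>x\<in>lower (n - N). reach (n + 1) x \<omega>) \<le>
        (of_bool (\<exists>x\<in>?X. reach (n + 1) x \<omega>) :: real)"
      by (intro of_bool_leI) blast
    also have "\<dots> \<le> (\<Sum>x\<in>?X. of_bool (reach (n + 1) x \<omega>))" by (rule of_bool_bex_le_sum[OF finX])
    finally show "of_bool (\<exists>x\<in>lower (n - N). reach (n + 1) x \<omega>) \<le>
        (\<Sum>x\<in>?X. of_bool (reach (n + 1) x \<omega>) :: real)" .
  qed (use p in auto)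
  also have "\<dots> = (\<Sum>x\<in>?X. bprob (\<lambda>_. p) F (reach (n + 1) x))" by (rule bexp_sum)
  also have "\<dots> \<le> (\<Sum>x\<in>?X. f (nat (n - J x)))"
  proof (rule sum_mono)
    fix x assume x: "x \<in> ?X"
    have "ht x \<le> t (J x)" using J[OF x] ht_Bx by blast
    then show "bprob (\<lambda>_. p) F (reach (n + 1) x) \<le> f (nat (n - J x))"
      using J[OF x] BxW F N t_mono[of "J x" n] by (intro reach_prob_le) (auto simp: subset_iff)
  qed
  also have "\<dots> = (\<Sum>j\<in>J ` ?X. \<Sum>x | x \<in> ?X \<and> J x = j. f (nat (n - J x)))"
    by (rule sum.image_gen[OF finX])
  also have "\<dots> \<le> (\<Sum>j\<in>J ` ?X. card (Bx j) * f (nat (n - j)))"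
  proof (rule sum_mono)
    fix j
    have "(\<Sum>x | x \<in> ?X \<and> J x = j. f (nat (n - J x))) = (\<Sum>x | x \<in> ?X \<and> J x = j. f (nat (n - j)))"
      by (intro sum.cong) auto
    also have "\<dots> = card {x. x \<in> ?X \<and> J x = j} * f (nat (n - j))" by simp
    also have "\<dots> \<le> card (Bx j) * f (nat (n - j))"
      using J finBx f_nonneg by (intro mult_right_mono of_nat_mono card_mono) auto
    finally show "(\<Sum>x | x \<in> ?X \<and> J x = j. f (nat (n - J x))) \<le> card (Bx j) * f (nat (n - j))" .
  qed
  also have "\<dots> \<le> 1/2" using finX J by (intro half) auto
  finally show ?thesis .
qed

text \<open>The probability in infinite volume that \<open>o'\<close> is joined to
  \<open>up a\<close>, expressed through finite edge sets so that the recursion stays among finite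
  sums.\<close>

definition u :: "int \<Rightarrow> real" where
  "u a = (SUP F\<in>{F. finite F \<and> F \<subseteq> EE}. bprob pr F (reach a o'))"

lemma bdd: "bdd_above ((\<lambda>F. bprob pr F (reach a o')) ` {F. finite F \<and> F \<subseteq> EE})"
  using pr01 by (intro bdd_aboveI2[of _ _ 1] bprob_le_1) auto

lemma u_upper: "finite F \<Longrightarrow> F \<subseteq> EE \<Longrightarrow> bprob pr F (reach a o') \<le> u a"
  unfolding u_def using bdd by (intro cSUP_upper) auto

lemma u_nonneg: "0 \<le> u a"
  using u_upper[of "{}" a] by (auto intro: order_trans[rotated])

text \<open>A finite set \<open>F0\<close> almost realises \<open>u a\<close>. A good window beyond
  \<open>F0\<close> has closed edges and no jump past it with probability at least
  \<open>(1 - q) ^ M / 2\<close>, independently of the state of \<open>F0\<close>. In that case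
  reaching \<open>a\<close> within \<open>F0\<close> does not lead past the window, except by a path
  outside the stack that starts at a vertex of \<open>F0\<close>; this is improbable because
  \<open>F0\<close> is far away.\<close>

lemma u_decrease:
  assumes \<eta>: "0 < \<eta>"
  shows "\<exists>b. u b \<le> (1 - (1 - q) ^ M / 2) * u a + \<eta>"
proof -
  let ?\<delta> = "(1 - q) ^ M / 2"
  have q0: "0 \<le> 1 - q" "0 < 1 - q" using q by auto
  have \<delta>0: "0 < ?\<delta>" using q0 by simp
  \<comment> \<open>The defect is multiplied by \<open>?\<delta>\<close> at the end and then
    contributes \<open>\<eta> / 2\<close>.\<close>
  obtain F0 where F0: "finite F0" "F0 \<subseteq> EE" "u a - \<eta> / (2 * ?\<delta>) < bprob pr F0 (reach a o')"
  proof -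
    have "\<exists>F. finite F \<and> F \<subseteq> EE \<and> u a - \<eta> / (2 * ?\<delta>) < bprob pr F (reach a o')"
    proof (rule ccontr)
      assume neg: "\<not> ?thesis"
      define c where "c = u a - \<eta> / (2 * ?\<delta>)"
      have "bprob pr F (reach a o') \<le> c" if "finite F" "F \<subseteq> EE" for F
        using neg that unfolding c_def[symmetric] not_ex not_less de_Morgan_conj by blast
      then have "u a \<le> c" unfolding u_def by (intro cSUP_least) auto
      moreover have "0 < \<eta> / (2 * ?\<delta>)" using \<eta> \<delta>0 by simp
      ultimately show False unfolding c_def by linarith
    qed
    then show ?thesis using that by blast
  qed
  have finV: "finite (\<Union>F0)" by (rule finite_Union_edges[OF F0(1,2)])
  define hm where "hm = Max (insert 0 (ht ` \<Union>F0))"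
  have hm: "0 \<le> hm" "\<And>z. z \<in> \<Union>F0 \<Longrightarrow> ht z \<le> hm"
    unfolding hm_def using finV by (auto intro!: Max_ge)
  \<comment> \<open>The allowance per vertex of \<open>F0\<close> for the exceptional paths, of
    total at most \<open>\<eta> / 2\<close>; the summand 1 keeps the denominator positive.\<close>
  let ?c = "\<eta> / (2 * (card (\<Union>F0) + 1))"
  have "0 < ?c" using \<eta> by simp
  then obtain k0 where k0: "\<And>k. k \<ge> k0 \<Longrightarrow> f k < ?c"
  proof -
    obtain k0 where "\<And>k. k \<ge> k0 \<Longrightarrow> norm (f k - 0) < ?c" using LIMSEQ_D[OF f0 \<open>0 < ?c\<close>] by blast
    then show ?thesis using that[of k0] abs_ge_self by (metis diff_zero le_less_trans real_norm_def)
  qed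
  \<comment> \<open>Heights grow by at least 2 per index from \<open>t 0\<close>, so this
    \<open>n\<close> places the bottom of the window above all vertices of \<open>F0\<close> and its
    top at least \<open>k0\<close> higher than them; moreover \<open>a \<le> n\<close> and
    \<open>0 \<le> n - N\<close>.\<close>
  obtain n where n: "n \<ge> N + \<bar>t 0\<bar> + hm + int k0 + \<bar>a\<bar> + 1"
    and card: "card (touching (\<Union>j\<in>{n - N<..n}. Bx j) EE) \<le> M"
    and half: "\<And>J. finite J \<Longrightarrow> J \<subseteq> {..n - N} \<Longrightarrow> (\<Sum>j\<in>J. card (Bx j) * f (nat (n - j))) \<le> 1/2"
    using good[of "N + \<bar>t 0\<bar> + hm + int k0 + \<bar>a\<bar> + 1"] by blast
  have nN: "0 \<le> n - N" "a \<le> n" using n hm(1) N by linarith+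
  have tn: "hm < t (n - N)" "hm + int k0 \<le> t n"
    using n hm(1) t_mono[OF nN(1)] t_window[of n] N nN by (simp_all add: abs_if split: if_splits)
  define K where "K = touching (\<Union>j\<in>{n - N<..n}. Bx j) EE"
  have finK: "finite K" unfolding K_def using finBx by (intro finite_touching) auto
  have KEE: "K \<subseteq> EE" by (auto simp: K_def touching_def)
  \<comment> \<open>The boxes of the window lie strictly above all vertices of
    \<open>F0\<close>.\<close>
  have KF0: "F0 \<inter> K = {}"
  proof (rule ccontr)
    assume "F0 \<inter> K \<noteq> {}"
    then obtain e z j where e: "e \<in> F0" "z \<in> e" "n - N < j" "z \<in> Bx j" by (auto simp: K_def touching_def)
    then have "t (j - 1) \<le> ht z" "ht z \<le> hm" using ht_Bx hm by auto
    moreover have "t (n - N) + 2 * (j - 1 - (n - N)) \<le> t (j - 1)" using e by (intro t_mono) simp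
    ultimately show False using tn e by simp
  qed
  have main: "bprob pr F (reach (n + 1) o') \<le> (1 - ?\<delta>) * u a + \<eta>" if F: "finite F" "F \<subseteq> EE" for F
  proof -
    define F' where "F' = F \<union> F0 \<union> K"
    define Fp where "Fp = {e\<in>F'. \<not> e \<subseteq> (\<Union>j. Bx j)}"
    \<comment> \<open>Removing \<open>F0\<close> and \<open>K\<close> from the edges off the stack
      makes the jump event independent of both; paths that do use \<open>F0\<close> are charged to
      the error sum.\<close>
    define F1 where "F1 = Fp - F0 - K"
    define jump where "jump \<omega> \<longleftrightarrow> (\<exists>x\<in>lower (n - N). reach (n + 1) x \<omega>)" for \<omega>
    have F': "finite F'" "F' \<subseteq> EE" using F F0 finK KEE by (auto simp: F'_def)
    have F1: "finite F1" "F1 \<subseteq> EE" "F1 \<subseteq> F'" "F1 \<inter> K = {}" "F1 \<inter> F0 = {}"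
      using F' by (auto simp: F1_def Fp_def)
    have Fp: "finite Fp" "Fp \<subseteq> EE" "Fp \<subseteq> F'" using F' by (auto simp: Fp_def)
    have outp: "pr e = p" if "e \<in> Fp" for e
    proof (rule out)
      show "e \<in> EE" "\<not> e \<subseteq> (\<Union>j. Bx j)" using that F' unfolding Fp_def by blast+
    qed
    have pr': "e \<in> F' \<Longrightarrow> 0 \<le> pr e \<and> pr e \<le> 1" for e using pr01 F' by auto
    have jump_mono: "jump \<omega> \<Longrightarrow> \<omega> \<subseteq> \<omega>' \<Longrightarrow> jump \<omega>'" for \<omega> \<omega>'
      unfolding jump_def by (blast intro: reach_mono)
    \<comment> \<open>Both terms on the left are 1 only if a path passes the closed window without a
      jump in \<open>F1\<close>; it then contains an edge of \<open>F0\<close>, and the sum on the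
      right is at least 1.\<close>
    have pointwise: "of_bool (reach (n + 1) o' \<omega>) + of_bool (reach a o' (\<omega> \<inter> F0)) *
        (of_bool (\<omega> \<inter> K = {}) * of_bool (\<not> jump (\<omega> \<inter> F1))) \<le>
        of_bool (reach a o' \<omega>) + (\<Sum>z\<in>\<Union>F0. of_bool (reach (n + 1) z (\<omega> \<inter> Fp)) :: real)"
      if w: "\<omega> \<subseteq> F'" for \<omega>
    proof -
      have 1: "reach (n + 1) o' \<omega> \<Longrightarrow> reach a o' \<omega>" using up_antimono[of a "n + 1"] nN by (auto simp: reach_def)
      have 2: "reach a o' (\<omega> \<inter> F0) \<Longrightarrow> reach a o' \<omega>" by (erule reach_mono) auto
      have 3: "1 \<le> (\<Sum>z\<in>\<Union>F0. of_bool (reach (n + 1) z (\<omega> \<inter> Fp)) :: real)"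
        if r: "reach (n + 1) o' \<omega>" and k: "\<omega> \<inter> K = {}" and j: "\<not> jump (\<omega> \<inter> F1)"
      proof -
        have eq: "{e\<in>\<omega>. \<not> e \<subseteq> (\<Union>j. Bx j)} = \<omega> \<inter> Fp" using w by (auto simp: Fp_def)
        have "\<exists>x\<in>lower (n - N). reach (n + 1) x (\<omega> \<inter> Fp)"
          using crossing[of n \<omega>] nN w F' k r unfolding K_def eq by auto
        then obtain x y where x: "x \<in> lower (n - N)" "y \<in> up (n + 1)" "conn (\<omega> \<inter> Fp) x y" by (auto simp: reach_def)
        have "\<not> conn (\<omega> \<inter> Fp - F0) x y"
        proof
          assume "conn (\<omega> \<inter> Fp - F0) x y"
          then have "conn (\<omega> \<inter> F1) x y" by (rule conn_mono) (use k in \<open>auto simp: F1_def\<close>)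
          then show False using j x by (auto simp: jump_def reach_def)
        qed
        then obtain z where z: "z \<in> \<Union>F0" "conn (\<omega> \<inter> Fp) z y" using conn_avoid_or_hit[OF x(3), of F0] by blast
        then have "1 \<le> (of_bool (reach (n + 1) z (\<omega> \<inter> Fp)) :: real)" using x by (auto simp: reach_def)
        also have "\<dots> \<le> (\<Sum>z\<in>\<Union>F0. of_bool (reach (n + 1) z (\<omega> \<inter> Fp)))"
          using finV z by (intro member_le_sum) auto
        finally show ?thesis .
      qed
      have 4: "0 \<le> (\<Sum>z\<in>\<Union>F0. of_bool (reach (n + 1) z (\<omega> \<inter> Fp)) :: real)" by (simp add: sum_nonneg)
      show ?thesis using 1 2 3 4
        by (cases "reach (n + 1) o' \<omega>"; cases "reach a o' (\<omega> \<inter> F0)"; cases "\<omega> \<inter> K = {}"; cases "jump (\<omega> \<inter> F1)") auto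
    qed
    have indep: "bexp pr F' (\<lambda>\<omega>. of_bool (reach a o' (\<omega> \<inter> F0)) *
        (of_bool (\<omega> \<inter> K = {}) * of_bool (\<not> jump (\<omega> \<inter> F1)))) =
      bprob pr F0 (reach a o') * (bprob pr K (\<lambda>\<omega>. \<omega> = {}) * bprob pr F1 (\<lambda>\<omega>. \<not> jump \<omega>))"
    proof -
      have "bexp pr F' (\<lambda>\<omega>. of_bool (reach a o' (\<omega> \<inter> F0)) *
        (of_bool (\<omega> \<inter> K = {}) * of_bool (\<not> jump (\<omega> \<inter> F1)))) =
       bexp pr F' (\<lambda>\<omega>. of_bool (reach a o' (\<omega> \<inter> F0)) *
        (\<lambda>\<omega>. of_bool (\<omega> \<inter> K = {}) * of_bool (\<not> jump (\<omega> \<inter> F1))) (\<omega> \<inter> (K \<union> F1)))"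
        by (simp add: Int_assoc Int_absorb1)
      also have "\<dots> = bprob pr F0 (reach a o') * bexp pr (K \<union> F1) (\<lambda>\<omega>. of_bool (\<omega> \<inter> K = {}) * of_bool (\<not> jump (\<omega> \<inter> F1)))"
        using F' F1 KF0 by (intro bexp_indep) (auto simp: F'_def)
      also have "bexp pr (K \<union> F1) (\<lambda>\<omega>. of_bool (\<omega> \<inter> K = {}) * of_bool (\<not> jump (\<omega> \<inter> F1))) =
        bprob pr K (\<lambda>\<omega>. \<omega> = {}) * bprob pr F1 (\<lambda>\<omega>. \<not> jump \<omega>)"
        using finK F1 by (intro bexp_indep[where f = "\<lambda>\<omega>. of_bool (\<omega> = {})" and g = "\<lambda>\<omega>. of_bool (\<not> jump \<omega>)"]) auto
      finally show ?thesis .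
    qed
    have "bprob pr K (\<lambda>\<omega>. \<omega> = {}) = bprob pr K (\<lambda>\<omega>. \<omega> \<inter> K = {})"
      by (intro bexp_cong) auto
    also have "\<dots> = (\<Prod>e\<in>K. 1 - pr e)" using finK by (intro bprob_all_closed) auto
    also have "\<dots> \<ge> (\<Prod>e\<in>K. 1 - q)"
      using pr KEE q by (intro prod_mono) (auto simp: subset_iff)
    finally have "(1 - q) ^ card K \<le> bprob pr K (\<lambda>\<omega>. \<omega> = {})" by simp
    moreover have "(1 - q) ^ M \<le> (1 - q) ^ card K"
      using card q by (intro power_decreasing) (auto simp: K_def)
    ultimately have Kclosed: "(1 - q) ^ M \<le> bprob pr K (\<lambda>\<omega>. \<omega> = {})" by simp
    have "bprob pr F1 (\<lambda>\<omega>. \<not> jump \<omega>) = 1 - bprob pr F1 jump" using F1 by (simp add: bprob_not)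
    also have "bprob pr F1 jump = bprob (\<lambda>_. p) F1 jump"
      by (intro bexp_cong outp) (auto simp: F1_def)
    also have "1 - \<dots> \<ge> 1/2"
      using jump_prob_le[OF F1(1,2) half] by (simp add: jump_def[abs_def])
    finally have nojump: "1/2 \<le> bprob pr F1 (\<lambda>\<omega>. \<not> jump \<omega>)" .
    have low: "bprob pr F0 (reach a o') * ?\<delta> \<le> bprob pr F0 (reach a o') * (bprob pr K (\<lambda>\<omega>. \<omega> = {}) * bprob pr F1 (\<lambda>\<omega>. \<not> jump \<omega>))"
    proof (rule mult_left_mono)
      have "(1 - q) ^ M * (1/2) \<le> bprob pr K (\<lambda>\<omega>. \<omega> = {}) * bprob pr F1 (\<lambda>\<omega>. \<not> jump \<omega>)"
        using Kclosed nojump q0 by (intro mult_mono) (auto intro: order_trans[rotated])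
      then show "?\<delta> \<le> bprob pr K (\<lambda>\<omega>. \<omega> = {}) * bprob pr F1 (\<lambda>\<omega>. \<not> jump \<omega>)" by simp
      show "0 \<le> bprob pr F0 (reach a o')" using F0 pr01 by (intro bexp_nonneg) auto
    qed
    have T: "bexp pr F' (\<lambda>\<omega>. \<Sum>z\<in>\<Union>F0. of_bool (reach (n + 1) z (\<omega> \<inter> Fp))) \<le> \<eta> / 2"
    proof -
      have "bexp pr F' (\<lambda>\<omega>. \<Sum>z\<in>\<Union>F0. of_bool (reach (n + 1) z (\<omega> \<inter> Fp))) =
        (\<Sum>z\<in>\<Union>F0. bprob pr F' (\<lambda>\<omega>. reach (n + 1) z (\<omega> \<inter> Fp)))" by (rule bexp_sum)
      also have "\<dots> \<le> (\<Sum>z\<in>\<Union>F0. ?c)"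
      proof (rule sum_mono)
        fix z assume z: "z \<in> \<Union>F0"
        have "bprob pr F' (\<lambda>\<omega>. reach (n + 1) z (\<omega> \<inter> Fp)) = bprob pr Fp (reach (n + 1) z)"
          using F' Fp by (intro bexp_restrict) auto
        also have "\<dots> = bprob (\<lambda>_. p) Fp (reach (n + 1) z)"
          by (intro bexp_cong outp) auto
        also have "\<dots> \<le> f k0"
          using z F0 W Fp hm(2)[OF z] tn by (intro reach_prob_le) auto
        also have "\<dots> \<le> ?c" using k0[of k0] by simp
        finally show "bprob pr F' (\<lambda>\<omega>. reach (n + 1) z (\<omega> \<inter> Fp)) \<le> ?c" .
      qed
      also have "\<dots> = card (\<Union>F0) * ?c" by simp
      also have "\<dots> \<le> \<eta> / 2" using \<eta> by (simp add: field_simps)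
      finally show ?thesis .
    qed
    have "bprob pr F (reach (n + 1) o') \<le> bprob pr F' (reach (n + 1) o')"
      using F' pr' by (intro bprob_mono_edges) (auto simp: F'_def intro: reach_mono)
    also have "\<dots> + bexp pr F' (\<lambda>\<omega>. of_bool (reach a o' (\<omega> \<inter> F0)) *
        (of_bool (\<omega> \<inter> K = {}) * of_bool (\<not> jump (\<omega> \<inter> F1)))) \<le>
      bprob pr F' (reach a o') + bexp pr F' (\<lambda>\<omega>. \<Sum>z\<in>\<Union>F0. of_bool (reach (n + 1) z (\<omega> \<inter> Fp)))"
      unfolding bexp_add[symmetric] using pr' pointwise by (intro bexp_mono) auto
    finally have "bprob pr F (reach (n + 1) o') + bprob pr F0 (reach a o') * ?\<delta> \<le> u a + \<eta> / 2"
      using low indep T u_upper[OF F', of a] by linarith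
    moreover have "(u a - \<eta> / (2 * ?\<delta>)) * ?\<delta> \<le> bprob pr F0 (reach a o') * ?\<delta>"
      using F0 \<delta>0 by (intro mult_right_mono) auto
    moreover have "(u a - \<eta> / (2 * ?\<delta>)) * ?\<delta> = u a * ?\<delta> - \<eta> / 2"
      using q0 by (simp add: field_simps)
    ultimately show ?thesis by (simp add: algebra_simps)
  qed
  have "u (n + 1) \<le> (1 - ?\<delta>) * u a + \<eta>"
    unfolding u_def[of "n + 1"] using main by (intro cSUP_least) auto
  then show ?thesis by blast
qed

text \<open>Letting the error in the recursion vanish bounds the infimum of \<open>u\<close> by
  \<open>1 - ?\<delta>\<close> times every \<open>u a\<close>, hence by \<open>1 - ?\<delta>\<close>
  times itself; so it is 0.\<close>

lemma no_infinite_crossing: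
  assumes "0 < \<eta>"
  shows "\<exists>a. \<forall>F. finite F \<longrightarrow> F \<subseteq> EE \<longrightarrow> bprob pr F (reach a o') \<le> \<eta>"
proof -
  let ?\<delta> = "(1 - q) ^ M / 2"
  let ?u = "INF a. u a"
  have \<delta>0: "0 < ?\<delta>" using q by simp
  have bb: "bdd_below (range u)" using u_nonneg by (intro bdd_belowI2) auto
  have le: "?u \<le> (1 - ?\<delta>) * u a" for a
  proof (rule field_le_epsilon)
    fix e :: real assume "0 < e"
    then obtain b where "u b \<le> (1 - ?\<delta>) * u a + e" using u_decrease by blast
    moreover have "?u \<le> u b" using bb by (intro cINF_lower) auto
    ultimately show "?u \<le> (1 - ?\<delta>) * u a + e" by simp
  qed
  have "\<exists>a. u a < \<eta>"
  proof (rule ccontr)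
    assume "\<not> ?thesis"
    then have "\<eta> \<le> ?u" by (intro cINF_greatest) (auto simp: not_less)
    then have pos: "0 < ?u" using assms by simp
    have "u a \<ge> ?u" for a using bb by (intro cINF_lower) auto
    have "1 - ?\<delta> > 0" using le[of 0] pos u_nonneg[of 0] by (metis less_le_trans mult_nonpos_nonneg not_less)
    then have "?u / (1 - ?\<delta>) \<le> u a" for a using le[of a] by (simp add: field_simps)
    then have "?u / (1 - ?\<delta>) \<le> ?u" by (intro cINF_greatest) auto
    then have "?u \<le> ?u * (1 - ?\<delta>)" using \<open>1 - ?\<delta> > 0\<close> by (simp add: pos_divide_le_eq)
    then have "?\<delta> * ?u \<le> 0" by (simp add: algebra_simps)
    then show False using \<delta>0 pos by (meson mult_pos_pos not_less)
  qed
  then obtain a where "u a < \<eta>" by blast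
  then show ?thesis using u_upper[of _ a] by (meson less_imp_le order_trans)
qed

end

section \<open>Exponential decay on the product graph\<close>

context lf_edges
begin

text \<open>A ball that does not grow in one step is already the whole cluster. The resulting bound
  lets the size of a ball control the height of the box over it.\<close>

lemma card_nbhd_ge:
  assumes "infinite {y. conn EE x y}"
  shows "n + 1 \<le> card (nbhd n x)"
proof (induction n)
  case 0
  have "card {x} \<le> card (nbhd 0 x)" by (intro card_mono finite_nbhd) auto
  then show ?case by simp
next
  case (Suc n)
  have "\<not> nbhd (Suc n) x \<subseteq> nbhd n x"
  proof
    assume sub: "nbhd (Suc n) x \<subseteq> nbhd n x"
    have "y \<in> nbhd n x" if "conn EE x y" for y
      using that
    proof (induction rule: conn_induct)
      case (step u v)
      then show ?case using sub nbhd_step[of u n x v] by blast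
    qed simp
    then have "{y. conn EE x y} \<subseteq> nbhd n x" by auto
    then show False using assms finite_nbhd finite_subset by blast
  qed
  then have "nbhd n x \<subset> nbhd (Suc n) x" using nbhd_mono[of n "Suc n" x] by auto
  then have "card (nbhd n x) < card (nbhd (Suc n) x)" by (intro psubset_card_mono finite_nbhd)
  then show ?case using Suc by simp
qed

end

lemma bexp_zero: "finite F \<Longrightarrow> bexp (\<lambda>_. 0) F f = f {}"
  by (induction F rule: finite_induct) (auto simp: bexp_insert)

lemma graph_ball_iff: "v \<in> graph_ball V E v\<^sub>0 r \<longleftrightarrow> v \<in> V \<and> (\<exists>n\<le>r. (v\<^sub>0, v) \<in> adj_rel E ^^ n)"
proof -
  have "graph_dist E v\<^sub>0 v \<le> enat r \<longleftrightarrow> (\<exists>n\<le>r. (v\<^sub>0, v) \<in> adj_rel E ^^ n)"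
  proof
    assume le: "graph_dist E v\<^sub>0 v \<le> enat r"
    show "\<exists>n\<le>r. (v\<^sub>0, v) \<in> adj_rel E ^^ n"
    proof (rule ccontr)
      assume "\<not> ?thesis"
      then have "enat (Suc r) \<le> graph_dist E v\<^sub>0 v"
        unfolding graph_dist_def by (intro INF_greatest) (auto simp: not_le Suc_le_eq)
      then have "enat (Suc r) \<le> enat r" using le by (rule order_trans)
      then show False by simp
    qed
  next
    assume "\<exists>n\<le>r. (v\<^sub>0, v) \<in> adj_rel E ^^ n"
    then obtain n where n: "n \<le> r" "(v\<^sub>0, v) \<in> adj_rel E ^^ n" by auto
    then have "graph_dist E v\<^sub>0 v \<le> enat n" unfolding graph_dist_def by (intro INF_lower) auto
    then show "graph_dist E v\<^sub>0 v \<le> enat r" using n by (metis enat_ord_simps(1) order_trans)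
  qed
  then show ?thesis by (simp add: graph_ball_def)
qed

section \<open>The product graph, its automorphisms and its critical point\<close>

locale base_graph =
  fixes V :: "'a set" and E :: "'a set set" and v\<^sub>0 :: 'a
  assumes simple: "simple_graph V E" and locfin_V: "locally_finite_graph V E"
    and inf: "infinite V" and connected: "connected_graph V E" and quasi: "quasi_transitive V E"
    and v\<^sub>0: "v\<^sub>0 \<in> V"
begin

abbreviation P :: "('a \<times> int) set set" where "P \<equiv> prod_Z_edges V E"
abbreviation W :: "('a \<times> int) set" where "W \<equiv> V \<times> UNIV"
abbreviation root :: "'a \<times> int" where "root \<equiv> (v\<^sub>0, 0)"

lemma edge_V: "{u, v} \<in> E \<Longrightarrow> u \<in> V \<and> v \<in> V \<and> u \<noteq> v"
  using simple by (force simp: simple_graph_def card_2_iff)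

sublocale G: lf_edges E
proof
  show "card e = 2" if "e \<in> E" for e using simple that by (auto simp: simple_graph_def)
  fix v show "finite {e\<in>E. v \<in> e}"
  proof -
    have "{e\<in>E. v \<in> e} \<subseteq> (\<lambda>w. {v, w}) ` {w\<in>V. v \<in> V \<and> {v, w} \<in> E}"
    proof
      fix e assume e: "e \<in> {e\<in>E. v \<in> e}"
      then obtain a b where "e = {a, b}" using simple by (auto simp: simple_graph_def card_2_iff)
      then obtain w where w: "e = {v, w}" using e by auto
      then show "e \<in> (\<lambda>w. {v, w}) ` {w\<in>V. v \<in> V \<and> {v, w} \<in> E}" using e edge_V[of v w] by auto
    qed
    moreover have "finite {w\<in>V. v \<in> V \<and> {v, w} \<in> E}"
      using locfin_V by (cases "v \<in> V") (auto simp: locally_finite_graph_def)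
    ultimately show ?thesis using finite_subset by blast
  qed
qed

definition deg :: "'a \<Rightarrow> nat" where "deg v = card {w. {v, w} \<in> E}"

lemma prod_edge_cases:
  assumes "e \<in> P" "(v, h) \<in> e"
  shows "e \<in> (\<lambda>w. {(v, h), w}) ` ({(v, h + 1), (v, h - 1)} \<union> {w. {v, w} \<in> E} \<times> {h})"
proof -
  obtain v1 v2 w1 w2 where e: "e = {(v1, v2), (w1, w2)}"
    "v1 = w1 \<and> \<bar>v2 - w2\<bar> = 1 \<or> {v1, w1} \<in> E \<and> v2 = w2"
    using assms(1) unfolding prod_Z_edges_def by auto
  define a where "a = (if (v, h) = (v1, v2) then (w1, w2) else (v1, v2))"
  have "e = {(v, h), a}" using e(1) assms(2) by (auto simp: a_def)
  moreover have "a \<in> {(v, h + 1), (v, h - 1)} \<union> {w. {v, w} \<in> E} \<times> {h}"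
    using e assms(2) by (auto simp: a_def insert_commute split: if_splits)
  ultimately show ?thesis by blast
qed

lemma prod_edge_W: "e \<in> P \<Longrightarrow> e \<subseteq> W"
  by (auto simp: prod_Z_edges_def)

lemma prod_edges_at:
  "finite {e\<in>P. (v, h) \<in> e}" "card {e\<in>P. (v, h) \<in> e} \<le> 2 + deg v"
proof -
  let ?N = "{(v, h + 1), (v, h - 1)} \<union> {w. {v, w} \<in> E} \<times> {h}"
  have sub: "{e\<in>P. (v, h) \<in> e} \<subseteq> (\<lambda>w. {(v, h), w}) ` ?N" using prod_edge_cases by blast
  have fin: "finite ?N" using G.finite_neighbours by auto
  then show "finite {e\<in>P. (v, h) \<in> e}" using sub finite_subset by blast
  have "card {e\<in>P. (v, h) \<in> e} \<le> card ((\<lambda>w. {(v, h), w}) ` ?N)"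
    using sub fin by (intro card_mono) auto
  also have "\<dots> \<le> card ?N" using fin by (rule card_image_le)
  also have "\<dots> \<le> card {(v, h + 1), (v, h - 1)} + card ({w. {v, w} \<in> E} \<times> {h})" by (rule card_Un_le)
  also have "\<dots> \<le> 2 + deg v" by (auto simp: deg_def card_insert_if card_cartesian_product)
  finally show "card {e\<in>P. (v, h) \<in> e} \<le> 2 + deg v" .
qed

sublocale Z: lf_edges P
proof
  show "card e = 2" if eP: "e \<in> P" for e
  proof -
    obtain v1 v2 w1 w2 where "e = {(v1, v2), (w1, w2)}" "v1 = w1 \<and> \<bar>v2 - w2\<bar> = 1 \<or> {v1, w1} \<in> E \<and> v2 = w2"
      using eP unfolding prod_Z_edges_def by blast
    moreover from this have "(v1, v2) \<noteq> (w1, w2)" using edge_V[of v1 w1] by auto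
    ultimately show ?thesis by simp
  qed
  fix v show "finite {e\<in>P. v \<in> e}" using prod_edges_at(1)[of "fst v" "snd v"] by simp
qed

lemma conn_horizontal:
  assumes "conn E u v" "u \<in> V" shows "conn P (u, h) (v, h)"
  using assms(1)
proof (induction rule: conn_induct)
  case (step a b)
  then have "{(a, h), (b, h)} \<in> P" using edge_V[of a b] by (simp add: prod_Z_edges_iff)
  then show ?case using step conn_trans conn_edge by metis
qed simp

lemma conn_vertical: "v \<in> V \<Longrightarrow> conn P (v, h) (v, h + int k)"
proof (induction k)
  case (Suc k)
  then have "{(v, h + int k), (v, h + int (Suc k))} \<in> P" by (simp add: prod_Z_edges_iff)
  then show ?case using Suc conn_trans conn_edge by metis
qed simp

lemma connE: "u \<in> V \<Longrightarrow> v \<in> V \<Longrightarrow> conn E u v"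
  using connected by (simp add: connected_graph_def conn_def)

lemma connP: assumes "x \<in> W" "y \<in> W" shows "conn P x y"
proof -
  have *: "conn P root z" if zW: "z \<in> W" for z
  proof -
    obtain v h where z: "z = (v, h)" "v \<in> V" using zW by auto
    have 1: "conn P root (v, 0)" using connE[OF v\<^sub>0 z(2)] conn_horizontal v\<^sub>0 by auto
    have 2: "conn P (v, 0) (v, h)"
    proof (cases "0 \<le> h")
      case True then show ?thesis using conn_vertical[OF z(2), of 0 "nat h"] by simp
    next
      case False then show ?thesis using conn_vertical[OF z(2), of h "nat (- h)"] conn_sym by force
    qed
    show ?thesis using conn_trans[OF 1 2] z by simp
  qed
  show ?thesis using *[OF assms(1)] *[OF assms(2)] conn_sym conn_trans by metis
qed

lemma conn_W: assumes "conn P x y" "x \<in> W" shows "y \<in> W"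
  using assms by (induction rule: conn_induct) (use prod_edge_W in auto)

lemma nbhd_W: "x \<in> W \<Longrightarrow> Z.nbhd n x \<subseteq> W"
  using conn_W Z.conn_iff_nbhd by blast

text \<open>The vertex type is arbitrary; countability comes from connectedness, which makes finite
  balls exhaust the graph.\<close>

lemma countable_P: "countable P"
proof -
  have "P \<subseteq> (\<Union>n. touching (Z.nbhd n root) P)"
  proof
    fix e assume e: "e \<in> P"
    then obtain x where x: "x \<in> e" "x \<in> W" using prod_edge_W Z.two[OF e] by (fastforce simp: card_2_iff)
    then have "conn P root x" using v\<^sub>0 by (intro connP) auto
    then obtain n where "x \<in> Z.nbhd n root" using Z.conn_iff_nbhd by auto
    then show "e \<in> (\<Union>n. touching (Z.nbhd n root) P)" using e x by (auto simp: touching_def)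
  qed
  moreover have "countable (\<Union>n. touching (Z.nbhd n root) P)"
    using Z.finite_touching Z.finite_nbhd by (intro countable_UN) (auto intro: countable_finite)
  ultimately show ?thesis by (rule countable_subset)
qed

lemma nbhd_height: "y \<in> Z.nbhd n x \<Longrightarrow> \<bar>snd y - snd x\<bar> \<le> int n"
proof -
  have "(x, y) \<in> adj_rel P ^^ m \<Longrightarrow> \<bar>snd y - snd x\<bar> \<le> int m" for m
  proof (induction m arbitrary: y)
    case (Suc m)
    then obtain z where z: "(x, z) \<in> adj_rel P ^^ m" "{z, y} \<in> P" by (auto simp: adj_rel_def)
    have "\<bar>snd z - snd y\<bar> \<le> 1"
      using z(2) prod_Z_edges_iff[of "fst z" "snd z" "fst y" "snd y" V E] by auto
    then show ?case using Suc.IH[OF z(1)] by simp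
  qed simp
  moreover assume "y \<in> Z.nbhd n x"
  ultimately show ?thesis by (fastforce simp: Z.nbhd_def)
qed

text \<open>Without open edges nothing is reached. Its use is that the set whose supremum is the
  critical point is nonempty.\<close>

lemma theta_0: "theta V E v\<^sub>0 0 = 0"
proof -
  define M where "M = percolation_measure P (\<lambda>_. 0)"
  interpret prob_space M unfolding M_def by (rule prob_space_percolation)
  let ?A = "\<lambda>\<omega>. \<exists>y. y \<noteq> root \<and> conn \<omega> root y"
  have nA: "\<not> ?A {}" using conn_in_Union by fastforce
  have A_mono: "?A \<omega> \<Longrightarrow> ?A \<omega>'" if "\<omega> \<subseteq> \<omega>'" for \<omega> \<omega>'
    using conn_mono[OF _ that] by blast
  have A_fin: "\<exists>F. finite F \<and> F \<subseteq> \<omega> \<and> ?A F" if "?A \<omega>" for \<omega>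
  proof -
    obtain y where "y \<noteq> root" "conn \<omega> root y" using \<open>?A \<omega>\<close> by auto
    then show ?thesis using conn_finitary[of \<omega> root y] by blast
  qed
  have A_zero: "bprob (\<lambda>_. 0) F ?A \<le> 0" if "finite F" for F using that nA by (simp only: bexp_zero) simp
  have A: "{\<omega>\<in>space M. ?A {e\<in>P. \<omega> e}} \<in> sets M" "measure M {\<omega>\<in>space M. ?A {e\<in>P. \<omega> e}} \<le> 0"
    unfolding M_def
    by (rule finitary_event_measure_le[where A = ?A and \<eta> = 0, OF countable_P _ A_mono A_fin A_zero]; auto)+
  have "{\<omega>\<in>space M. infinite_open_path_from P root \<omega>} \<subseteq> {\<omega>\<in>space M. ?A {e\<in>P. \<omega> e}}"
  proof
    fix \<omega> assume "\<omega> \<in> {\<omega>\<in>space M. infinite_open_path_from P root \<omega>}"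
    then obtain \<gamma> :: "nat \<Rightarrow> 'a \<times> int" where \<gamma>: "\<gamma> 0 = root" "inj \<gamma>" "\<forall>i. {\<gamma> i, \<gamma> (Suc i)} \<in> P \<and> \<omega> {\<gamma> i, \<gamma> (Suc i)}" "\<omega> \<in> space M"
      unfolding infinite_open_path_from_def by blast
    have "{\<gamma> 0, \<gamma> (Suc 0)} \<in> {e\<in>P. \<omega> e}" using \<gamma>(3) by blast
    then have "conn {e\<in>P. \<omega> e} (\<gamma> 0) (\<gamma> (Suc 0))" by (rule conn_edge)
    then have "conn {e\<in>P. \<omega> e} root (\<gamma> 1)" using \<gamma>(1) by simp
    moreover    have "\<gamma> 1 \<noteq> root" using \<gamma>(1,2) by (metis injD zero_neq_one)
    ultimately show "\<omega> \<in> {\<omega>\<in>space M. ?A {e\<in>P. \<omega> e}}" using \<gamma>(4) by blast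
  qed
  then have "measure M {\<omega>\<in>space M. infinite_open_path_from P root \<omega>} \<le> 0"
    by (intro order_trans[OF finite_measure_mono A(2)] A(1))
  then show ?thesis
    unfolding theta_def percolation_prob_def M_def[symmetric] by (intro order_antisym measure_nonneg)
qed

lemma p_crit_le_1: "p_crit V E v\<^sub>0 \<le> 1"
proof -
  have "0 \<in> {p \<in> {0..1}. theta V E v\<^sub>0 p = 0}" using theta_0 by simp
  then have "{p \<in> {0..1}. theta V E v\<^sub>0 p = 0} \<noteq> {}" by blast
  then show ?thesis unfolding p_crit_def by (intro cSup_least) auto
qed

text \<open>Quasi-transitivity moves a vertex to its representative; copying a set from the
  representative needs the inverse, combined here with a vertical shift to the required
  height.\<close>

lemma product_automorphism:
  fixes m :: int
  assumes "graph_automorphism V E \<tau>"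
  defines "h \<equiv> (\<lambda>(u, k). (inv_into V \<tau> u, k + m))"
  shows "bij_betw h W W" and "\<And>x y. x \<in> W \<Longrightarrow> y \<in> W \<Longrightarrow> {h x, h y} \<in> P \<longleftrightarrow> {x, y} \<in> P"
proof -
  have bij: "bij_betw \<tau> V V" and ed: "\<And>u v. u \<in> V \<Longrightarrow> v \<in> V \<Longrightarrow> {\<tau> u, \<tau> v} \<in> E \<longleftrightarrow> {u, v} \<in> E"
    using assms by (auto simp: graph_automorphism_def)
  let ?s = "inv_into V \<tau>"
  have sbij: "bij_betw ?s V V" using bij by (rule bij_betw_inv_into)
  have s: "?s u \<in> V" "\<tau> (?s u) = u" if "u \<in> V" for u
    using that bij sbij by (auto simp: bij_betw_inv_into_right bij_betwE)
  have sed: "{?s u, ?s v} \<in> E \<longleftrightarrow> {u, v} \<in> E" if "u \<in> V" "v \<in> V" for u v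
    using ed[of "?s u" "?s v"] s that by simp
  have sinj: "?s u = ?s v \<longleftrightarrow> u = v" if "u \<in> V" "v \<in> V" for u v
    using s that by metis
  have "bij_betw (map_prod ?s (\<lambda>k. k + m)) (V \<times> UNIV) (V \<times> UNIV)"
    by (intro bij_betw_map_prod sbij bij_betwI[where g = "\<lambda>k. k - m"]) auto
  moreover have "h = map_prod ?s (\<lambda>k. k + m)" by (auto simp: h_def)
  ultimately show "bij_betw h W W" by simp
  fix x y :: "'a \<times> int" assume "x \<in> W" "y \<in> W"
  then show "{h x, h y} \<in> P \<longleftrightarrow> {x, y} \<in> P"
    by (cases x; cases y) (simp add: h_def prod_Z_edges_iff s sed sinj)
qed

lemma exponential_decay:
  assumes p: "0 \<le> p" "p < p_crit V E v\<^sub>0"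
  shows "\<exists>C r. 0 < r \<and> r < 1 \<and> 0 \<le> C \<and> (\<forall>x F n. x \<in> W \<longrightarrow> finite F \<longrightarrow> F \<subseteq> P \<longrightarrow>
    bprob (\<lambda>_. p) F (\<lambda>\<omega>. \<exists>w. w \<notin> Z.nbhd n x \<and> conn \<omega> x w) \<le> C * r ^ n)"
proof -
  have "0 \<in> {p \<in> {0..1}. theta V E v\<^sub>0 p = 0}" using theta_0 by simp
  then have "{p \<in> {0..1}. theta V E v\<^sub>0 p = 0} \<noteq> {}" by blast
  \<comment> \<open>The differential inequality needs room between \<open>p\<close> and a
    non-percolating parameter; below the supremum there is such a \<open>p'\<close>.\<close>
  then obtain p' where p': "p < p'" "p' \<le> 1" "theta V E v\<^sub>0 p' = 0"
    using p(2) unfolding p_crit_def by (auto elim!: less_cSupE)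
  have p1: "p \<le> 1" using p' by simp
  obtain V0 where V0: "finite V0" "V0 \<subseteq> V" "\<And>w. w \<in> V \<Longrightarrow> \<exists>x\<in>V0. \<exists>\<tau>. graph_automorphism V E \<tau> \<and> \<tau> w = x"
    using quasi unfolding quasi_transitive_def by auto
  have "\<exists>S L. finite S \<and> S \<subseteq> W \<and> (r, 0) \<in> S \<and> S \<union> snd ` Z.bd S \<subseteq> Z.nbhd L (r, 0) \<and> Z.phi p (r, 0) S < 1"
    if r: "r \<in> V0" for r
  proof -
    have rW: "(r, 0) \<in> W" using r V0 by auto
    have "\<exists>n S. S \<subseteq> Z.nbhd n root \<and> (r, 0) \<in> S \<and> Z.phi p (r, 0) S < 1"
      using p' p rW v\<^sub>0 by (intro Z.phi_less_1_of_no_percolation[of p p'] connP) (auto simp: theta_def)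
    then obtain n S where S: "S \<subseteq> Z.nbhd n root" "(r, 0) \<in> S" "Z.phi p (r, 0) S < 1" by auto
    have fin: "finite S" using S Z.finite_nbhd finite_subset by blast
    have SW: "S \<subseteq> W" using S nbhd_W[of root n] v\<^sub>0 by auto
    have "snd ` Z.bd S \<subseteq> W" using prod_edge_W by (fastforce simp: Z.bd_def)
    then have "\<exists>L. S \<union> snd ` Z.bd S \<subseteq> Z.nbhd L (r, 0)"
      using fin SW rW Z.finite_bd[OF fin] by (intro Z.finite_subset_nbhd connP) auto
    then show ?thesis using fin SW S by blast
  qed
  then obtain Sf Lf where SL: "\<And>r. r \<in> V0 \<Longrightarrow> finite (Sf r) \<and> Sf r \<subseteq> W \<and> (r, 0) \<in> Sf r \<and>
      Sf r \<union> snd ` Z.bd (Sf r) \<subseteq> Z.nbhd (Lf r) (r, 0) \<and> Z.phi p (r, 0) (Sf r) < 1"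
    by metis
  \<comment> \<open>The inserted 1 here and 1/2 in the next line give \<open>L \<ge> 1\<close> and
    \<open>\<rho> > 0\<close>, needed for \<open>n div L\<close>, the root and the factor
    \<open>1 / \<rho>\<close>.\<close>
  define L where "L = Max (insert 1 (Lf ` V0))"
  define \<rho> where "\<rho> = Max (insert (1/2) ((\<lambda>r. Z.phi p (r, 0) (Sf r)) ` V0))"
  have L: "1 \<le> L" "\<And>r. r \<in> V0 \<Longrightarrow> Lf r \<le> L" unfolding L_def using V0 by (auto intro!: Max_ge)
  have \<rho>: "1/2 \<le> \<rho>" "\<And>r. r \<in> V0 \<Longrightarrow> Z.phi p (r, 0) (Sf r) \<le> \<rho>"
    unfolding \<rho>_def using V0(1) by (intro Max_ge; simp)+
  have "\<rho> < 1" unfolding \<rho>_def using V0 SL by auto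
  have step: "\<exists>S. finite S \<and> x \<in> S \<and> S \<subseteq> Z.nbhd L x \<and> (\<forall>(y, z)\<in>Z.bd S. z \<in> Z.nbhd L x) \<and> Z.phi p x S \<le> \<rho>"
    if x: "x \<in> W" for x
  proof -
    obtain v m where v: "x = (v, m)" "v \<in> V" using x by auto
    obtain r \<tau> where r: "r \<in> V0" "graph_automorphism V E \<tau>" "\<tau> v = r" using V0(3)[OF v(2)] by auto
    define h where "h = (\<lambda>(u, k). (inv_into V \<tau> u, k + m))"
    have h: "bij_betw h W W" "\<And>x y. x \<in> W \<Longrightarrow> y \<in> W \<Longrightarrow> {h x, h y} \<in> P \<longleftrightarrow> {x, y} \<in> P"
      unfolding h_def using product_automorphism[OF r(2)] by auto
    have "inv_into V \<tau> r = v"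
      using r v by (metis bij_betw_def graph_automorphism_def inv_into_f_f)
    then have hx: "h (r, 0) = x" using v by (simp add: h_def)
    have S: "finite (Sf r)" "Sf r \<subseteq> W" "(r, 0) \<in> Sf r" "Sf r \<union> snd ` Z.bd (Sf r) \<subseteq> Z.nbhd (Lf r) (r, 0)"
      using SL[OF r(1)] by auto
    have phi: "Z.phi p x (h ` Sf r) \<le> Z.phi p (r, 0) (Sf r)" and bd: "Z.bd (h ` Sf r) = map_prod h h ` Z.bd (Sf r)"
      using Z.phi_automorphism[OF p(1) p1 prod_edge_W h S(2,3)] hx by auto
    have hed: "{h u, h w} \<in> P" if "{u, w} \<in> P" for u w using h(2)[of u w] prod_edge_W[OF that] that by auto
    have nb: "h y \<in> Z.nbhd L x" if "y \<in> Sf r \<union> snd ` Z.bd (Sf r)" for y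
    proof -
      have "y \<in> Z.nbhd (Lf r) (r, 0)" using S that by blast
      then have "h y \<in> Z.nbhd (Lf r) (h (r, 0))" by (rule Z.nbhd_automorphism[rotated]) (rule hed)
      then show ?thesis unfolding hx using Z.nbhd_mono[OF L(2)[OF r(1)]] by blast
    qed
    show ?thesis
    proof (intro exI[of _ "h ` Sf r"] conjI)
      show "finite (h ` Sf r)" using S by simp
      show "x \<in> h ` Sf r" using S hx by force
      show "h ` Sf r \<subseteq> Z.nbhd L x" using nb by auto
      show "\<forall>(y, z)\<in>Z.bd (h ` Sf r). z \<in> Z.nbhd L x" unfolding bd using nb by force
      show "Z.phi p x (h ` Sf r) \<le> \<rho>" using phi \<rho>(2)[OF r(1)] by simp
    qed
  qed
  \<comment> \<open>The rate per unit of distance: \<open>r ^ L = \<rho>\<close>. The constant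
    \<open>1 / \<rho>\<close> pays for the incomplete last step of length \<open>L\<close>.\<close>
  define r where "r = \<rho> powr (1 / real L)"
  have r: "0 < r" "r < 1" using \<rho>(1) \<open>\<rho> < 1\<close> L by (auto simp: r_def powr01_less_one)
  have rL: "r ^ L = \<rho>" using \<rho>(1) L by (simp add: r_def powr_powr flip: powr_realpow)
  have "bprob (\<lambda>_. p) F (\<lambda>\<omega>. \<exists>w. w \<notin> Z.nbhd n x \<and> conn \<omega> x w) \<le> (1 / \<rho>) * r ^ n"
    if x: "x \<in> W" and F: "finite F" "F \<subseteq> P" for x F n
  proof -
    let ?k = "n div L"
    have nb: "Z.nbhd (?k * L) x \<subseteq> Z.nbhd n x" by (intro Z.nbhd_mono) (metis div_times_less_eq_dividend)
    have "bprob (\<lambda>_. p) F (\<lambda>\<omega>. \<exists>w. w \<notin> Z.nbhd n x \<and> conn \<omega> x w) \<le>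
      bprob (\<lambda>_. p) F (\<lambda>\<omega>. \<exists>w. w \<notin> Z.nbhd (?k * L) x \<and> conn \<omega> x w)"
    proof (intro bexp_mono)
      fix \<omega>
      have "(\<exists>w. w \<notin> Z.nbhd n x \<and> conn \<omega> x w) \<Longrightarrow> (\<exists>w. w \<notin> Z.nbhd (?k * L) x \<and> conn \<omega> x w)"
        using nb by auto
      then show "of_bool (\<exists>w. w \<notin> Z.nbhd n x \<and> conn \<omega> x w) \<le> (of_bool (\<exists>w. w \<notin> Z.nbhd (?k * L) x \<and> conn \<omega> x w) :: real)"
        by (simp only: of_bool_def split: if_splits) auto
    qed (use p p1 in auto)
    also have "\<dots> \<le> \<rho> ^ ?k"
    proof (rule Z.decay_iterate[where W = W])
      fix y z assume "y \<in> W" "{y, z} \<in> P" then show "z \<in> W" using prod_edge_W by blast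
    qed (use p p1 \<rho>(1) step x F in auto)
    also have "\<dots> = (1 / \<rho>) * \<rho> ^ Suc ?k" using \<rho>(1) by simp
    also have "\<rho> ^ Suc ?k = r ^ (L * Suc ?k)" unfolding rL[symmetric] by (rule power_mult[symmetric])
    also have "(1 / \<rho>) * r ^ (L * Suc ?k) \<le> (1 / \<rho>) * r ^ n"
    proof (intro mult_left_mono power_decreasing)
      show "n \<le> L * Suc ?k" using dividend_less_times_div[of L n] L by (simp add: algebra_simps)
    qed (use r \<rho>(1) in auto)
    finally show ?thesis .
  qed
  then show ?thesis using r \<rho>(1) by (intro exI[of _ "1 / \<rho>"] exI[of _ r]) auto
qed

end

section \<open>The Stack Model\<close>

text \<open>The recursion hidden in the definition by cases: the centres of consecutive boxes differ
  by the sum of their radii, so the boxes share exactly one level. The two cases next to 0 glue the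
  positive and negative formulas.\<close>

lemma stack_center_step: "stack_center \<Lambda> (n + 1) = stack_center \<Lambda> n + int (\<Lambda> n) + int (\<Lambda> (n + 1))"
proof -
  consider "n \<ge> 1" | "n = 0" | "n = -1" | "n \<le> -2" by linarith
  then show ?thesis
  proof cases
    case 1
    then have "{1..n} = insert n {1..n - 1}" by auto
    then show ?thesis using 1 by (simp add: stack_center_def)
  next
    case 4
    then have "stack_center \<Lambda> n = - int (\<Lambda> 0) - 2 * (\<Sum>i\<in>{1..- n - 1}. int (\<Lambda> (- i))) - int (\<Lambda> n)"
      by (simp add: stack_center_def)
    moreover have "stack_center \<Lambda> (n + 1) =
        - int (\<Lambda> 0) - 2 * (\<Sum>i\<in>{1..- (n + 1) - 1}. int (\<Lambda> (- i))) - int (\<Lambda> (n + 1))"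
      using 4 by (simp add: stack_center_def)
    moreover have "{1..- n - 1} = insert (- n - 1) {1..- (n + 1) - 1}" using 4 by auto
    then have "(\<Sum>i\<in>{1..- n - 1}. int (\<Lambda> (- i))) = int (\<Lambda> (- (- n - 1))) + (\<Sum>i\<in>{1..- (n + 1) - 1}. int (\<Lambda> (- i)))"
      by (simp only:) (rule sum.insert; simp)
    moreover have "- (- n - 1) = n + 1" by simp
    ultimately show ?thesis by presburger
  qed (simp_all add: stack_center_def)
qed

text \<open>With \<open>\<sigma> = -1\<close> the stack is turned upside down, so that both ends of it are treated alike;
  \<open>stack_top\<close> is the height of the common level of consecutive boxes.\<close>

definition stack_top :: "(int \<Rightarrow> nat) \<Rightarrow> int \<Rightarrow> int \<Rightarrow> int" where
  "stack_top \<Lambda> \<sigma> j = \<sigma> * stack_center \<Lambda> (\<sigma> * j) + int (\<Lambda> (\<sigma> * j))"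

lemma stack_top_bottom:
  assumes "\<sigma> \<in> {1, -1}"
  shows "stack_top \<Lambda> \<sigma> (j - 1) = \<sigma> * stack_center \<Lambda> (\<sigma> * j) - int (\<Lambda> (\<sigma> * j))"
  using assms stack_center_step[of \<Lambda> "j - 1"] stack_center_step[of \<Lambda> "- j"]
  by (auto simp: stack_top_def)

lemma stack_top_step:
  assumes "\<sigma> \<in> {1, -1}"
  shows "stack_top \<Lambda> \<sigma> j = stack_top \<Lambda> \<sigma> (j - 1) + 2 * int (\<Lambda> (\<sigma> * j))"
  unfolding stack_top_bottom[OF assms] by (simp add: stack_top_def)

lemma stack_top_mono:
  assumes "\<sigma> \<in> {1, -1}" "i \<le> j"
  shows "stack_top \<Lambda> \<sigma> i \<le> stack_top \<Lambda> \<sigma> j"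
  using assms(2)
proof (induction j rule: int_ge_induct)
  case (step j) then show ?case using stack_top_step[OF assms(1), of \<Lambda> "j + 1"] by simp
qed simp

section \<open>Quenched estimates and almost every environment\<close>

context base_graph
begin

text \<open>The countable family of slopes allows the environment to be fixed before
  \<open>p\<close>, whose decay rate selects \<open>m\<close>. The size \<open>m0\<close> and the
  length \<open>N0\<close> come before \<open>N\<close> and \<open>a\<close>, so the edges of a
  window are bounded uniformly along the stack.\<close>

definition good_env :: "(int \<Rightarrow> nat) \<Rightarrow> int \<Rightarrow> bool" where
  "good_env \<Lambda> \<sigma> \<longleftrightarrow> (\<forall>m. \<exists>m0 N0. \<forall>N\<ge>N0. \<forall>a. \<exists>n\<ge>a.
     (\<forall>j. n - int N < j \<and> j \<le> n \<longrightarrow> \<Lambda> (\<sigma> * j) = m0) \<and>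
     (\<forall>j\<le>n - int N. ln (card (graph_ball V E v\<^sub>0 (\<Lambda> (\<sigma> * j)))) \<le> inverse (real (Suc m)) * real_of_int (n - j)))"

lemma graph_ball_nbhd: "graph_ball V E v\<^sub>0 r = G.nbhd r v\<^sub>0"
proof -
  have "v \<in> V" if "v \<in> G.nbhd r v\<^sub>0" for v
  proof -
    have "conn E v\<^sub>0 v" using that G.conn_iff_nbhd by auto
    then show ?thesis by (induction rule: conn_induct) (use v\<^sub>0 edge_V in auto)
  qed
  then show ?thesis unfolding set_eq_iff graph_ball_iff G.nbhd_def mem_Collect_eq by blast
qed

lemma finite_ball: "finite (graph_ball V E v\<^sub>0 r)"
  unfolding graph_ball_nbhd by (rule G.finite_nbhd)

lemma card_ball_ge: "r + 1 \<le> card (graph_ball V E v\<^sub>0 r)"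
proof -
  have "V \<subseteq> {y. conn E v\<^sub>0 y}" using connE v\<^sub>0 by auto
  then show ?thesis unfolding graph_ball_nbhd using inf finite_subset by (intro G.card_nbhd_ge) blast
qed

abbreviation box :: "(int \<Rightarrow> nat) \<Rightarrow> int \<Rightarrow> int \<Rightarrow> ('a \<times> int) set" where
  "box \<Lambda> \<sigma> j \<equiv> prod_box V E v\<^sub>0 (stack_center \<Lambda> (\<sigma> * j)) (\<Lambda> (\<sigma> * j))"

lemma box_height:
  assumes "\<sigma> \<in> {1, -1}" "u \<in> box \<Lambda> \<sigma> j"
  shows "stack_top \<Lambda> \<sigma> (j - 1) \<le> \<sigma> * snd u \<and> \<sigma> * snd u \<le> stack_top \<Lambda> \<sigma> j"
  unfolding stack_top_bottom[OF assms(1)] unfolding stack_top_def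
  using assms by (auto simp: prod_box_def)

text \<open>The box has \<open>2 * r + 1\<close> levels, at most twice the size of the ball; so the
  logarithmic moment of the ball controls the whole box, with doubled exponent.\<close>

lemma card_box_le:
  shows "real (card (prod_box V E v\<^sub>0 a r)) \<le> 2 * (real (card (graph_ball V E v\<^sub>0 r)))\<^sup>2"
proof -
  let ?b = "real (card (graph_ball V E v\<^sub>0 r))"
  have "real (r + 1) \<le> ?b" using card_ball_ge[of r] by (intro of_nat_mono)
  then have "real (2 * r + 1) \<le> 2 * ?b" by simp
  have "card (prod_box V E v\<^sub>0 a r) = card (graph_ball V E v\<^sub>0 r) * (2 * r + 1)"
    by (simp add: prod_box_def card_cartesian_product nat_add_distrib nat_mult_distrib)
  then have "real (card (prod_box V E v\<^sub>0 a r)) = ?b * real (2 * r + 1)" by (simp only: of_nat_mult)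
  also have "\<dots> \<le> ?b * (2 * ?b)" using \<open>real (2 * r + 1) \<le> 2 * ?b\<close> by (intro mult_left_mono) auto
  finally show ?thesis by (simp add: power2_eq_square)
qed

lemma card_touching_le:
  assumes "finite B" "finite I" "U \<subseteq> B \<times> I"
  shows "card (touching U P) \<le> card I * (\<Sum>v\<in>B. 2 + deg v)"
proof -
  have "touching U P \<subseteq> (\<Union>x\<in>B \<times> I. {e\<in>P. x \<in> e})" using assms by (auto simp: touching_def)
  moreover have "finite (\<Union>x\<in>B \<times> I. {e\<in>P. x \<in> e})" using assms prod_edges_at(1) by auto
  ultimately have "card (touching U P) \<le> card (\<Union>x\<in>B \<times> I. {e\<in>P. x \<in> e})" by (rule card_mono[rotated])
  also have "\<dots> \<le> (\<Sum>x\<in>B \<times> I. card {e\<in>P. x \<in> e})" using assms by (intro card_UN_le) auto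
  also have "\<dots> \<le> (\<Sum>(v, h)\<in>B \<times> I. 2 + deg v)"
    using prod_edges_at(2) by (intro sum_mono) auto
  also have "\<dots> = card I * (\<Sum>v\<in>B. 2 + deg v)"
    using assms by (simp flip: sum.cartesian_product add: sum_distrib_left)
  finally show ?thesis .
qed

lemma stack_region_box: "\<sigma> \<in> {1, -1} \<Longrightarrow> stack_region V E v\<^sub>0 \<Lambda> = (\<Union>j. box \<Lambda> \<sigma> j)"
proof -
  assume "\<sigma> \<in> {1, -1}"
  then have \<sigma>: "\<sigma> * (\<sigma> * n) = n" for n by auto
  show ?thesis
  proof (intro equalityI subsetI)
    fix v assume "v \<in> stack_region V E v\<^sub>0 \<Lambda>"
    then obtain n where "v \<in> box \<Lambda> \<sigma> (\<sigma> * n)" unfolding stack_region_def \<sigma> by blast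
    then show "v \<in> (\<Union>j. box \<Lambda> \<sigma> j)" by blast
  qed (auto simp: stack_region_def)
qed

lemma no_crossing_to_infinity:
  assumes \<Lambda>: "\<And>n. 1 \<le> \<Lambda> n" and \<sigma>: "\<sigma> \<in> {1, -1}" and env: "good_env \<Lambda> \<sigma>"
    and p: "0 \<le> p" "p < p_crit V E v\<^sub>0" and q: "0 \<le> q" "q < 1" and \<eta>: "0 < \<eta>"
  shows "\<exists>a. \<forall>F. finite F \<longrightarrow> F \<subseteq> P \<longrightarrow>
    bprob (\<lambda>e. if e \<subseteq> stack_region V E v\<^sub>0 \<Lambda> then q else p) F
      (\<lambda>\<omega>. \<exists>y\<in>(\<Union>k\<in>{a..}. box \<Lambda> \<sigma> k). conn \<omega> root y) \<le> \<eta>"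
proof -
  have p1: "p < 1" using p p_crit_le_1 by simp
  let ?pr = "\<lambda>e. if e \<subseteq> stack_region V E v\<^sub>0 \<Lambda> then q else p"
  obtain C r where r: "0 < r" "r < 1" "0 \<le> C" and dec: "\<And>x F n. x \<in> W \<Longrightarrow> finite F \<Longrightarrow> F \<subseteq> P \<Longrightarrow>
    bprob (\<lambda>_. p) F (\<lambda>\<omega>. \<exists>w. w \<notin> Z.nbhd n x \<and> conn \<omega> x w) \<le> C * r ^ n"
    using exponential_decay[OF p] by blast
  \<comment> \<open>A height gain of \<open>n = Suc k\<close> only excludes the ball of radius
    \<open>k\<close>, which costs the factor \<open>1 / r\<close>; the summand 1 covers
    \<open>n = 0\<close>.\<close>
  define C' where "C' = C / r + 1"
  define f where "f n = C' * r ^ n" for n :: nat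
  have C': "1 \<le> C'" using r by (simp add: C'_def)
  \<comment> \<open>The slope is below half of \<open>- ln r\<close> because the box size involves
    the square of the ball; thus \<open>s = exp (2 * \<epsilon>) * r\<close> is below 1.\<close>
  obtain m where m: "inverse (real (Suc m)) < - ln r / 2"
    using reals_Archimedean[of "- ln r / 2"] r by auto
  define \<epsilon> where "\<epsilon> = inverse (real (Suc m))"
  define s where "s = exp (2 * \<epsilon>) * r"
  have s: "0 < s" "s < 1"
  proof -
    show "0 < s" using r by (simp add: s_def)
    have "2 * \<epsilon> < - ln r" using m by (simp add: \<epsilon>_def)
    then have "exp (2 * \<epsilon>) < exp (- ln r)" by simp
    also have "\<dots> = 1 / r" using r by (simp add: exp_minus field_simps)
    finally show "s < 1" using r by (simp add: s_def field_simps)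
  qed
  have "summable (\<lambda>k. 2 * C' * s ^ k)" using s by (intro summable_mult summable_geometric) auto
  then obtain N1 where N1: "\<And>K. finite K \<Longrightarrow> K \<subseteq> {N1..} \<Longrightarrow> (\<Sum>k\<in>K. 2 * C' * s ^ k) \<le> 1/2"
    by (rule summable_tail_half) (use s C' in auto)
  obtain m0 N0 where env': "\<And>N a. N \<ge> N0 \<Longrightarrow> \<exists>n\<ge>a.
     (\<forall>j. n - int N < j \<and> j \<le> n \<longrightarrow> \<Lambda> (\<sigma> * j) = m0) \<and>
     (\<forall>j\<le>n - int N. ln (card (graph_ball V E v\<^sub>0 (\<Lambda> (\<sigma> * j)))) \<le> \<epsilon> * real_of_int (n - j))"
    using env unfolding good_env_def \<epsilon>_def by meson
  \<comment> \<open>Long enough for the environment to supply windows and for the jump series with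
    ratio \<open>s\<close> to have tail at most 1/2.\<close>
  define N where "N = max N0 (max N1 1)"
  have N: "N \<ge> N0" "N \<ge> N1" "N \<ge> 1" by (auto simp: N_def)
  let ?t = "stack_top \<Lambda> \<sigma>" and ?ht = "\<lambda>u :: 'a \<times> int. \<sigma> * snd u"
  \<comment> \<open>The number of levels of a window of \<open>N\<close> boxes of radius
    \<open>m0\<close>, times the sum of product degrees over the ball; it does not depend on the
    position of the window.\<close>
  define M where "M = (2 * m0 * N + 1) * (\<Sum>v\<in>graph_ball V E v\<^sub>0 m0. 2 + deg v)"
  have finBx: "finite (box \<Lambda> \<sigma> j)" for j by (auto simp: prod_box_def finite_ball)
  have lip: "\<bar>?ht u - ?ht v\<bar> \<le> 1" if "{u, v} \<in> P" for u v
    using that prod_Z_edges_iff[of "fst u" "snd u" "fst v" "snd v" V E] \<sigma> by auto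
  have decay: "bprob (\<lambda>_. p) F (\<lambda>\<omega>. \<exists>y. ?ht y \<ge> ?ht x + int n \<and> conn \<omega> x y) \<le> f n"
    if x: "x \<in> W" and F: "finite F" "F \<subseteq> P" for x F n
  proof (cases n)
    case 0
    have "bprob (\<lambda>_. p) F (\<lambda>\<omega>. \<exists>y. ?ht y \<ge> ?ht x + int n \<and> conn \<omega> x y) \<le> 1"
      using F p p1 by (intro bprob_le_1) auto
    then show ?thesis using 0 C' by (simp add: f_def)
  next
    case (Suc k)
    have "bprob (\<lambda>_. p) F (\<lambda>\<omega>. \<exists>y. ?ht y \<ge> ?ht x + int n \<and> conn \<omega> x y) \<le>
      bprob (\<lambda>_. p) F (\<lambda>\<omega>. \<exists>w. w \<notin> Z.nbhd k x \<and> conn \<omega> x w)"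
    proof (intro bexp_mono)
      fix \<omega>
      have "y \<notin> Z.nbhd k x" if "?ht y \<ge> ?ht x + int n" for y
        using nbhd_height[of y k x] that Suc \<sigma> by auto
      then show "of_bool (\<exists>y. ?ht y \<ge> ?ht x + int n \<and> conn \<omega> x y) \<le> (of_bool (\<exists>w. w \<notin> Z.nbhd k x \<and> conn \<omega> x w) :: real)"
        by (intro of_bool_leI) blast
    qed (use p p1 in auto)
    also have "\<dots> \<le> C * r ^ k" using dec x F by blast
    also have "\<dots> = C / r * r ^ n" using r Suc by simp
    also have "\<dots> \<le> f n" unfolding f_def C'_def using r by (intro mult_right_mono) auto
    finally show ?thesis .
  qed
  have good: "\<exists>n\<ge>a. card (touching (\<Union>j\<in>{n - int N<..n}. box \<Lambda> \<sigma> j) P) \<le> M \<and>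
      (\<forall>J. finite J \<longrightarrow> J \<subseteq> {..n - int N} \<longrightarrow> (\<Sum>j\<in>J. card (box \<Lambda> \<sigma> j) * f (nat (n - j))) \<le> 1/2)" for a
  proof -
    obtain n where n: "n \<ge> a" and win: "\<And>j. n - int N < j \<Longrightarrow> j \<le> n \<Longrightarrow> \<Lambda> (\<sigma> * j) = m0"
      and rest: "\<And>j. j \<le> n - int N \<Longrightarrow> ln (card (graph_ball V E v\<^sub>0 (\<Lambda> (\<sigma> * j)))) \<le> \<epsilon> * real_of_int (n - j)"
      using env'[OF N(1), of a] by blast
    let ?U = "\<Union>j\<in>{n - int N<..n}. box \<Lambda> \<sigma> j"
    let ?I = "(\<lambda>h. \<sigma> * h) ` {?t (n - int N)..?t n}"
    have top: "?t n = ?t (n - int k) + 2 * int m0 * int k" if "k \<le> N" for k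
      using that
    proof (induction k)
      case (Suc k)
      then have "\<Lambda> (\<sigma> * (n - int k)) = m0" by (intro win) auto
      then show ?case using Suc stack_top_step[OF \<sigma>, of \<Lambda> "n - int k"] by (simp add: algebra_simps)
    qed simp
    have "?U \<subseteq> graph_ball V E v\<^sub>0 m0 \<times> ?I"
    proof
      fix u assume "u \<in> ?U"
      then obtain j where j: "n - int N < j" "j \<le> n" "u \<in> box \<Lambda> \<sigma> j" by auto
      have "?t (n - int N) \<le> ?t (j - 1)" "?t j \<le> ?t n" using j by (auto intro!: stack_top_mono \<sigma>)
      then have "?ht u \<in> {?t (n - int N)..?t n}" using box_height[OF \<sigma> j(3)] by auto
      then have "\<sigma> * ?ht u \<in> ?I" by blast
      then have "snd u \<in> ?I" using \<sigma> by auto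
      moreover have "fst u \<in> graph_ball V E v\<^sub>0 m0" using j win by (auto simp: prod_box_def)
      ultimately show "u \<in> graph_ball V E v\<^sub>0 m0 \<times> ?I" by (cases u) auto
    qed
    then have "card (touching ?U P) \<le> card ?I * (\<Sum>v\<in>graph_ball V E v\<^sub>0 m0. 2 + deg v)"
      by (intro card_touching_le finite_ball) auto
    also have "\<dots> \<le> M"
    proof -
      have "card ?I \<le> card {?t (n - int N)..?t n}" by (intro card_image_le) auto
      also have "\<dots> = 2 * m0 * N + 1" using top[of N] by (simp add: nat_add_distrib nat_mult_distrib)
      finally show ?thesis unfolding M_def by (intro mult_right_mono) auto
    qed
    finally have cardM: "card (touching ?U P) \<le> M" .
    have "(\<Sum>j\<in>J. card (box \<Lambda> \<sigma> j) * f (nat (n - j))) \<le> 1/2" if J: "finite J" "J \<subseteq> {..n - int N}" for J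
    proof -
      let ?k = "\<lambda>j. nat (n - j)"
      have "(\<Sum>j\<in>J. card (box \<Lambda> \<sigma> j) * f (?k j)) \<le> (\<Sum>j\<in>J. 2 * C' * s ^ ?k j)"
      proof (rule sum_mono)
        fix j assume j: "j \<in> J"
        let ?b = "real (card (graph_ball V E v\<^sub>0 (\<Lambda> (\<sigma> * j))))"
        have jn: "j \<le> n - int N" using j J by auto
        have k: "real_of_int (n - j) = real (?k j)" using jn by auto
        have b: "1 \<le> ?b" using card_ball_ge[of "\<Lambda> (\<sigma> * j)"] by simp
        have "?b = exp (ln ?b)" using b by simp
        also have "\<dots> \<le> exp (\<epsilon> * real (?k j))" unfolding k[symmetric] using rest[OF jn] by (simp only: exp_le_cancel_iff)
        finally have "?b ^ 2 \<le> exp (\<epsilon> * real (?k j)) ^ 2" using b by (intro power_mono) auto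
        also have "\<dots> = exp (2 * \<epsilon>) ^ ?k j"
          by (simp add: exp_of_nat_mult[symmetric] power2_eq_square exp_add[symmetric] algebra_simps)
        finally have "real (card (box \<Lambda> \<sigma> j)) \<le> 2 * exp (2 * \<epsilon>) ^ ?k j"
          using card_box_le[of "stack_center \<Lambda> (\<sigma> * j)" "\<Lambda> (\<sigma> * j)"] by linarith
        then have "real (card (box \<Lambda> \<sigma> j)) * f (?k j) \<le> 2 * exp (2 * \<epsilon>) ^ ?k j * f (?k j)"
          using r C' by (intro mult_right_mono) (auto simp: f_def)
        then show "real (card (box \<Lambda> \<sigma> j)) * f (?k j) \<le> 2 * C' * s ^ ?k j"
          by (simp add: f_def s_def power_mult_distrib algebra_simps)
      qed
      also have "\<dots> = (\<Sum>k\<in>?k ` J. 2 * C' * s ^ k)"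
      proof -
        have "inj_on ?k J"
        proof (rule inj_onI)
          fix i j assume ij: "i \<in> J" "j \<in> J" "?k i = ?k j"
          then have "i \<le> n - int N" "j \<le> n - int N" using J by auto
          then show "i = j" using ij(3) by simp
        qed
        then show ?thesis by (simp add: sum.reindex)
      qed
      also have "\<dots> \<le> 1/2" using J N by (intro N1) fastforce+
      finally show ?thesis .
    qed
    then show ?thesis using n cardM by blast
  qed
  \<comment> \<open>The bound \<open>max p q\<close> covers the edges at a window on both sides of
    the boundary of the stack.\<close>
  interpret stack P W "box \<Lambda> \<sigma>" ?t ?ht ?pr p "max p q" f root M "int N"
  proof
    show "e \<subseteq> W" if "e \<in> P" for e using prod_edge_W[OF that] .
    show "box \<Lambda> \<sigma> j \<subseteq> W" for j by (auto simp: prod_box_def graph_ball_def)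
    show "finite (box \<Lambda> \<sigma> j)" for j by (rule finBx)
    show "0 \<le> ?pr e \<and> ?pr e \<le> max p q" for e using p q by auto
    show "0 \<le> max p q" "max p q < 1" using p p1 q by auto
    show "?pr e = p" if "\<not> e \<subseteq> (\<Union>j. box \<Lambda> \<sigma> j)" for e
      using that unfolding stack_region_box[OF \<sigma>] by simp
    show "\<bar>?ht u - ?ht v\<bar> \<le> 1" if "{u, v} \<in> P" for u v by (rule lip[OF that])
    show "?t j + 2 \<le> ?t (j + 1)" for j
      using stack_top_step[OF \<sigma>, of \<Lambda> "j + 1"] \<Lambda>[of "\<sigma> * (j + 1)"] by simp
    show "?t (j - 1) \<le> ?ht u \<and> ?ht u \<le> ?t j" if "u \<in> box \<Lambda> \<sigma> j" for u j
      by (rule box_height[OF \<sigma> that])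
    show "0 \<le> p" "p \<le> 1" using p p1 by auto
    show "bprob (\<lambda>_. p) F (\<lambda>\<omega>. \<exists>y. ?ht y \<ge> ?ht x + int n \<and> conn \<omega> x y) \<le> f n"
      if "x \<in> W" "finite F" "F \<subseteq> P" for x F n by (rule decay[OF that])
    have "(\<lambda>n. r ^ n) \<longlonglongrightarrow> 0" using r by (intro LIMSEQ_realpow_zero) auto
    then show "f \<longlonglongrightarrow> 0" unfolding f_def by (rule tendsto_mult_right_zero)
    show "1 \<le> int N" using N by simp
    show "\<exists>n\<ge>a. card (touching (\<Union>j\<in>{n - int N<..n}. box \<Lambda> \<sigma> j) P) \<le> M \<and>
      (\<forall>J. finite J \<longrightarrow> J \<subseteq> {..n - int N} \<longrightarrow> (\<Sum>j\<in>J. card (box \<Lambda> \<sigma> j) * f (nat (n - j))) \<le> 1/2)" for a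
      by (rule good)
    show "root \<in> box \<Lambda> \<sigma> 0"
      by (simp add: prod_box_def stack_center_def graph_ball_nbhd)
  qed
  show ?thesis using no_infinite_crossing[OF \<eta>] by (simp add: reach_def[abs_def] up_def)
qed

text \<open>An infinite path falls under one of three events, each of probability at most
  \<open>\<eta>\<close>: it meets a far box above, a far box below, or it leaves the finite middle
  part \<open>X\<close> for good and goes far outside the stack.\<close>

lemma quenched_no_percolation:
  assumes \<Lambda>: "\<And>n. 1 \<le> \<Lambda> n" and env: "good_env \<Lambda> 1" "good_env \<Lambda> (-1)"
    and p: "0 \<le> p" "p < p_crit V E v\<^sub>0" and q: "0 \<le> q" "q < 1"
  shows "stack_theta V E v\<^sub>0 \<Lambda> p q = 0"
proof -
  have p1: "p < 1" using p p_crit_le_1 by simp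
  let ?R = "stack_region V E v\<^sub>0 \<Lambda>"
  define pr where "pr e = (if e \<subseteq> ?R then q else p)" for e
  have pr01: "0 \<le> pr e \<and> pr e \<le> 1" for e using p p1 q by (auto simp: pr_def)
  define M where "M = percolation_measure P pr"
  interpret prob_space M unfolding M_def by (rule prob_space_percolation)
  let ?D = "{\<omega>\<in>space M. infinite_open_path_from P root \<omega>}"
  obtain C r where r: "0 < r" "r < 1" "0 \<le> C" and dec: "\<And>x F n. x \<in> W \<Longrightarrow> finite F \<Longrightarrow> F \<subseteq> P \<Longrightarrow>
    bprob (\<lambda>_. p) F (\<lambda>\<omega>. \<exists>w. w \<notin> Z.nbhd n x \<and> conn \<omega> x w) \<le> C * r ^ n"
    using exponential_decay[OF p] by blast
  have reach_event: "{\<omega>\<in>space M. \<exists>y\<in>Y. conn {e\<in>P. \<omega> e} root y} \<in> events \<and>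
      prob {\<omega>\<in>space M. \<exists>y\<in>Y. conn {e\<in>P. \<omega> e} root y} \<le> \<eta>"
    if bound: "\<And>F. finite F \<Longrightarrow> F \<subseteq> P \<Longrightarrow> bprob pr F (\<lambda>\<omega>. \<exists>y\<in>Y. conn \<omega> root y) \<le> \<eta>" for Y \<eta>
  proof -
    let ?A = "\<lambda>\<omega>. \<exists>y\<in>Y. conn \<omega> root y"
    have mono: "?A \<omega> \<Longrightarrow> ?A \<omega>'" if "\<omega> \<subseteq> \<omega>'" for \<omega> \<omega>' using conn_mono[OF _ that] by blast
    have fin: "\<exists>F. finite F \<and> F \<subseteq> \<omega> \<and> ?A F" if A: "?A \<omega>" for \<omega>
    proof -
      obtain y where y: "y \<in> Y" "conn \<omega> root y" using A by blast
      then show ?thesis using conn_finitary[OF y(2)] by blast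
    qed
    show ?thesis unfolding M_def
      using finitary_event_measure_le[where A = ?A, OF countable_P pr01 mono fin bound] by simp
  qed
  have D_le: "prob ?D \<le> 3 * \<eta>" if \<eta>: "0 < \<eta>" for \<eta>
  proof -
    obtain a where a: "\<And>F. finite F \<Longrightarrow> F \<subseteq> P \<Longrightarrow>
      bprob pr F (\<lambda>\<omega>. \<exists>y\<in>(\<Union>k\<in>{a..}. box \<Lambda> 1 k). conn \<omega> root y) \<le> \<eta>"
      using no_crossing_to_infinity[OF \<Lambda> _ env(1) p q \<eta>] unfolding pr_def[abs_def, symmetric] by blast
    obtain b where b: "\<And>F. finite F \<Longrightarrow> F \<subseteq> P \<Longrightarrow>
      bprob pr F (\<lambda>\<omega>. \<exists>y\<in>(\<Union>k\<in>{b..}. box \<Lambda> (-1) k). conn \<omega> root y) \<le> \<eta>"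
      using no_crossing_to_infinity[OF \<Lambda> _ env(2) p q \<eta>] unfolding pr_def[abs_def, symmetric] by blast
    define Y1 where "Y1 = (\<Union>k\<in>{a..}. box \<Lambda> 1 k)"
    define Y2 where "Y2 = (\<Union>k\<in>{b..}. box \<Lambda> (-1) k)"
    define X where "X = (\<Union>k\<in>{-b<..<a}. box \<Lambda> 1 k)"
    have finX: "finite X" unfolding X_def by (auto simp: prod_box_def finite_ball)
    have XW: "X \<subseteq> W" unfolding X_def by (auto simp: prod_box_def graph_ball_def)
    have cover: "?R \<subseteq> Y1 \<union> Y2 \<union> X"
    proof
      fix v assume "v \<in> ?R"
      then obtain k where k: "v \<in> box \<Lambda> 1 k" by (auto simp: stack_region_def)
      then have k': "v \<in> box \<Lambda> (-1) (- k)" by simp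
      consider "k \<ge> a" | "- k \<ge> b" | "- b < k" "k < a" by linarith
      then show "v \<in> Y1 \<union> Y2 \<union> X"
      proof cases
        case 1
        have "v \<in> Y1" unfolding Y1_def using k \<open>a \<le> k\<close> by (intro UN_I[of k]) simp_all
        then show ?thesis by blast
      next
        case 2
        have "v \<in> Y2" unfolding Y2_def using k' \<open>b \<le> - k\<close> by (intro UN_I[of "- k"]) simp_all
        then show ?thesis by blast
      next
        case 3
        have "v \<in> X" unfolding X_def using k \<open>- b < k\<close> \<open>k < a\<close> by (intro UN_I[of k]) simp_all
        then show ?thesis by blast
      qed
    qed
    have rootX: "root \<in> ?R" unfolding stack_region_def
      by (intro UN_I[of 0]) (auto simp: prod_box_def stack_center_def graph_ball_nbhd)
    \<comment> \<open>The radius is chosen after \<open>X\<close>, so that a union bound over all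
      exit vertices is affordable.\<close>
    have "(\<lambda>n. card X * (C * r ^ n)) \<longlonglongrightarrow> 0"
      using r by (intro tendsto_mult_right_zero LIMSEQ_realpow_zero) auto
    then obtain n where n: "card X * (C * r ^ n) < \<eta>"
      using order_tendstoD(2)[OF _ \<eta>] by (metis (no_types, lifting) eventually_happens sequentially_bot)
    define out where "out \<omega> = {e\<in>\<omega>. \<not> e \<subseteq> ?R}" for \<omega>
    define B where "B x \<omega> \<longleftrightarrow> (\<exists>w. w \<notin> Z.nbhd n x \<and> conn \<omega> x w)" for x \<omega>
    let ?A = "\<lambda>\<omega>. \<exists>x\<in>X. B x (out \<omega>)"
    have B_mono: "B x \<omega> \<Longrightarrow> B x \<omega>'" if "\<omega> \<subseteq> \<omega>'" for x \<omega> \<omega>'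
      unfolding B_def using conn_mono[OF _ that] by blast
    have A_mono: "?A \<omega> \<Longrightarrow> ?A \<omega>'" if "\<omega> \<subseteq> \<omega>'" for \<omega> \<omega>'
    proof -
      have "out \<omega> \<subseteq> out \<omega>'" using that by (auto simp: out_def)
      then show "?A \<omega> \<Longrightarrow> ?A \<omega>'" using B_mono by blast
    qed
    have A_fin: "\<exists>F. finite F \<and> F \<subseteq> \<omega> \<and> ?A F" if A: "?A \<omega>" for \<omega>
    proof -
      obtain x w where xw: "x \<in> X" "w \<notin> Z.nbhd n x" "conn (out \<omega>) x w" using A unfolding B_def by blast
      obtain F where F: "finite F" "F \<subseteq> out \<omega>" "conn F x w" using conn_finitary[OF xw(3)] by blast
      have "out F = F" "F \<subseteq> \<omega>" using F(2) by (auto simp: out_def)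
      moreover have "B x F" unfolding B_def using xw F by blast
      ultimately show ?thesis using F(1) xw(1) by metis
    qed
    have A_bound: "bprob pr F ?A \<le> \<eta>" if F: "finite F" "F \<subseteq> P" for F
    proof -
      have sub: "out F \<subseteq> F" by (auto simp: out_def)
      have "bprob pr F ?A = bprob pr F (\<lambda>\<omega>. \<exists>x\<in>X. B x (\<omega> \<inter> out F))"
      proof (intro bexp_cong refl)
        fix \<omega> assume "\<omega> \<subseteq> F"
        then have "out \<omega> = \<omega> \<inter> out F" by (auto simp: out_def)
        then show "(of_bool (?A \<omega>) :: real) = of_bool (\<exists>x\<in>X. B x (\<omega> \<inter> out F))" by simp
      qed
      also have "\<dots> = bprob pr (out F) (\<lambda>\<omega>. \<exists>x\<in>X. B x \<omega>)"
        using F sub by (intro bexp_restrict)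
      also have "\<dots> = bprob (\<lambda>_. p) (out F) (\<lambda>\<omega>. \<exists>x\<in>X. B x \<omega>)"
        by (intro bexp_cong) (auto simp: pr_def out_def)
      also have "\<dots> \<le> bexp (\<lambda>_. p) (out F) (\<lambda>\<omega>. \<Sum>x\<in>X. of_bool (B x \<omega>))"
        using p p1 finX by (intro bexp_mono of_bool_bex_le_sum) auto
      also have "\<dots> = (\<Sum>x\<in>X. bprob (\<lambda>_. p) (out F) (B x))"
        by (rule bexp_sum)
      also have "\<dots> \<le> (\<Sum>x\<in>X. C * r ^ n)"
        unfolding B_def[abs_def] using F XW sub by (intro sum_mono dec) (auto dest: finite_subset)
      also have "\<dots> \<le> \<eta>" using n by simp
      finally show ?thesis .
    qed
    have A_event: "{\<omega>\<in>space M. ?A {e\<in>P. \<omega> e}} \<in> events" "prob {\<omega>\<in>space M. ?A {e\<in>P. \<omega> e}} \<le> \<eta>"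
      unfolding M_def
      using finitary_event_measure_le[where A = ?A, OF countable_P pr01 A_mono A_fin A_bound] by simp_all
    define E1 where "E1 = {\<omega>\<in>space M. \<exists>y\<in>Y1. conn {e\<in>P. \<omega> e} root y}"
    define E2 where "E2 = {\<omega>\<in>space M. \<exists>y\<in>Y2. conn {e\<in>P. \<omega> e} root y}"
    define E3 where "E3 = {\<omega>\<in>space M. ?A {e\<in>P. \<omega> e}}"
    have E: "E1 \<in> events" "prob E1 \<le> \<eta>" "E2 \<in> events" "prob E2 \<le> \<eta>" "E3 \<in> events" "prob E3 \<le> \<eta>"
      using reach_event[OF a] reach_event[OF b] A_event unfolding E1_def E2_def E3_def Y1_def Y2_def by blast+
    have "?D \<subseteq> E1 \<union> E2 \<union> E3"
    proof
      fix \<omega> assume "\<omega> \<in> ?D"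
      then obtain \<gamma> :: "nat \<Rightarrow> 'a \<times> int" where \<gamma>: "\<gamma> 0 = root" "inj \<gamma>"
        "\<forall>i. {\<gamma> i, \<gamma> (Suc i)} \<in> P \<and> \<omega> {\<gamma> i, \<gamma> (Suc i)}" "\<omega> \<in> space M"
        unfolding infinite_open_path_from_def by blast
      let ?w = "{e\<in>P. \<omega> e}"
      have step: "{\<gamma> i, \<gamma> (Suc i)} \<in> ?w" for i using \<gamma>(3) by simp
      have conn0: "conn ?w root (\<gamma> i)" for i using Z.path_conn[of \<gamma> ?w 0 i, OF step] \<gamma>(1) by simp
      show "\<omega> \<in> E1 \<union> E2 \<union> E3"
      proof (cases "\<exists>i. \<gamma> i \<in> Y1 \<union> Y2")
        case True
        then show ?thesis using conn0 \<gamma>(4) unfolding E1_def E2_def by blast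
      next
        case False
        then have RX: "\<gamma> i \<in> X" if "\<gamma> i \<in> ?R" for i using cover that by blast
        let ?S = "{i. \<gamma> i \<in> ?R}"
        have "?S \<subseteq> \<gamma> -` X" using RX by auto
        then have finS: "finite ?S" using finX \<gamma>(2) finite_vimageI finite_subset by blast
        have S0: "0 \<in> ?S" using \<gamma>(1) rootX by simp
        \<comment> \<open>The time of the last visit to the stack. The visits are finite in number
          because an injective path meets the finite \<open>X\<close> finitely often, and time 0 is
          one of them.\<close>
        define i0 where "i0 = Max ?S"
        have i0: "\<gamma> i0 \<in> ?R" using Max_in[OF finS] S0 unfolding i0_def by blast
        have after: "\<gamma> i \<notin> ?R" if "i > i0" for i
          using Max_ge[OF finS, of i] that unfolding i0_def by auto
        have outstep: "{\<gamma> (i0 + i), \<gamma> (i0 + Suc i)} \<in> out ?w" for i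
          using step[of "i0 + i"] after[of "i0 + Suc i"] by (auto simp: out_def)
        have conn1: "conn (out ?w) (\<gamma> i0) (\<gamma> (i0 + i))" for i
          using Z.path_conn[of "\<lambda>i. \<gamma> (i0 + i)" "out ?w" 0 i, OF outstep] by simp
        obtain i where i: "i \<ge> i0" "\<gamma> i \<notin> Z.nbhd n (\<gamma> i0)"
          using Z.injective_sequence_leaves[OF \<gamma>(2) Z.finite_nbhd] by blast
        have "conn (out ?w) (\<gamma> i0) (\<gamma> i)" using conn1[of "i - i0"] i by simp
        then have "?A ?w" using RX[OF i0] i unfolding B_def by blast
        then show ?thesis using \<gamma>(4) unfolding E3_def by blast
      qed
    qed
    then have "prob ?D \<le> prob (E1 \<union> E2 \<union> E3)" using E by (intro finite_measure_mono) auto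
    also have "\<dots> \<le> prob (E1 \<union> E2) + prob E3" using E by (intro measure_Un_le) auto
    also have "\<dots> \<le> prob E1 + prob E2 + prob E3"
      using measure_Un_le[OF E(1,3)] by simp
    finally show ?thesis using E by linarith
  qed
  have "prob ?D \<le> 0 + e" if "0 < e" for e
    using D_le[of "e / 3"] that by simp
  then have "prob ?D \<le> 0" by (rule field_le_epsilon)
  then have "prob ?D = 0" by (simp add: order_antisym)
  then show ?thesis
    unfolding stack_theta_def percolation_prob_def M_def pr_def[abs_def] by simp
qed

text \<open>The reflected sequence is again independent with the same law, so the block construction
  applies to both directions. For each slope \<open>m0\<close> and \<open>N0\<close> are
  deterministic, which leaves a countable union of null sets over \<open>N\<close> and
  \<open>m\<close>.\<close>

lemma AE_good_env:
  assumes iid: "iid_environment \<nu>"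
    and int: "integrable \<nu> (\<lambda>\<Lambda>. ln (real (card (graph_ball V E v\<^sub>0 (\<Lambda> 0)))))"
    and \<sigma>: "\<sigma> \<in> {1, -1}"
  shows "AE \<Lambda> in \<nu>. good_env \<Lambda> \<sigma>"
proof -
  interpret prob_space \<nu> using iid by (simp add: iid_environment_def)
  let ?b = "\<lambda>k. ln (real (card (graph_ball V E v\<^sub>0 k)))"
  have sets: "sets \<nu> = sets env_space" and
    ind: "indep_vars (\<lambda>n. count_space {1..}) (\<lambda>n \<Lambda>. \<Lambda> n) UNIV" and
    id: "distr \<nu> (count_space {1..}) (\<lambda>\<Lambda>. \<Lambda> n) = distr \<nu> (count_space {1..}) (\<lambda>\<Lambda>. \<Lambda> 0)" for n :: int
    using iid by (auto simp: iid_environment_def)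
  have rv: "(\<lambda>\<Lambda>. \<Lambda> n) \<in> measurable \<nu> (count_space {1..})" for n :: int
    using ind by (auto simp: indep_vars_def)
  have sp: "\<Lambda> n \<in> {1..}" if "\<Lambda> \<in> space \<nu>" for \<Lambda> and n :: int
    using measurable_space[OF rv that, of n] by simp
  have eq: "{\<Lambda>\<in>space \<nu>. \<Lambda> n \<in> A} = (\<lambda>\<Lambda>. \<Lambda> n) -` (A \<inter> {1..}) \<inter> space \<nu>" for n :: int and A
    using sp by auto
  have meas: "{\<Lambda>\<in>space \<nu>. \<Lambda> n \<in> A} \<in> events" for n :: int and A
    unfolding eq using rv by (rule measurable_sets) auto
  have same: "prob {\<Lambda>\<in>space \<nu>. \<Lambda> n \<in> A} = prob {\<Lambda>\<in>space \<nu>. \<Lambda> 0 \<in> A}" for n :: int and A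
  proof -
    have "prob {\<Lambda>\<in>space \<nu>. \<Lambda> m \<in> A} = measure (distr \<nu> (count_space {1..}) (\<lambda>\<Lambda>. \<Lambda> m)) (A \<inter> {1..})" for m :: int
      unfolding eq by (rule measure_distr[OF rv, symmetric]) simp
    note * = this
    show ?thesis unfolding * id[of n] by (rule refl)
  qed
  have prod: "prob {\<Lambda>\<in>space \<nu>. \<forall>j\<in>J. \<Lambda> (\<sigma> * j) \<in> A j} = (\<Prod>j\<in>J. prob {\<Lambda>\<in>space \<nu>. \<Lambda> (\<sigma> * 0) \<in> A j})"
    if J: "finite J" for J :: "int set" and A
  proof (cases "J = {}")
    case True then show ?thesis by (simp add: prob_space)
  next
    case False
    let ?A = "\<lambda>i. A (\<sigma> * i) \<inter> {1..}"
    have ss: "\<sigma> * (\<sigma> * j) = j" for j using \<sigma> by auto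
    have inj: "inj_on ((*) \<sigma>) J" using \<sigma> by (auto simp: inj_on_def)
    have "{\<Lambda>\<in>space \<nu>. \<forall>j\<in>J. \<Lambda> (\<sigma> * j) \<in> A j} = (\<Inter>i\<in>(*) \<sigma> ` J. (\<lambda>\<Lambda>. \<Lambda> i) -` ?A i \<inter> space \<nu>)"
      using False sp by (auto simp: ss)
    also have "prob \<dots> = (\<Prod>i\<in>(*) \<sigma> ` J. prob ((\<lambda>\<Lambda>. \<Lambda> i) -` ?A i \<inter> space \<nu>))"
      using J False by (intro indep_varsD[OF ind]) auto
    also have "\<dots> = (\<Prod>j\<in>J. prob {\<Lambda>\<in>space \<nu>. \<Lambda> (\<sigma> * j) \<in> A j})"
      unfolding eq using inj by (simp add: prod.reindex ss)
    also have "\<dots> = (\<Prod>j\<in>J. prob {\<Lambda>\<in>space \<nu>. \<Lambda> (\<sigma> * 0) \<in> A j})"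
      by (intro prod.cong refl) (simp only: mult_zero_right, rule same)
    finally show ?thesis .
  qed
  have b0: "0 \<le> ?b k" for k using card_ball_ge[of k] by simp
  have "AE \<Lambda> in \<nu>. \<exists>m0 N0. \<forall>N\<ge>N0. \<forall>a. \<exists>n\<ge>a.
     (\<forall>j. n - int N < j \<and> j \<le> n \<longrightarrow> \<Lambda> (\<sigma> * j) = m0) \<and>
     (\<forall>j\<le>n - int N. ?b (\<Lambda> (\<sigma> * j)) \<le> inverse (real (Suc m)) * real_of_int (n - j))"
    (is "AE \<Lambda> in \<nu>. \<exists>m0 N0. \<forall>N\<ge>N0. ?good m0 N \<Lambda>") for m
  proof -
    have "\<exists>m0 N0. \<forall>N\<ge>N0. AE \<Lambda> in \<nu>. ?good m0 N \<Lambda>"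
      by (rule good_blocks[where X = "\<lambda>j \<Lambda>. \<Lambda> (\<sigma> * j)" and b = ?b, OF meas prod b0]) (use int in simp_all)
    then obtain m0 N0 where "\<And>N. N \<ge> N0 \<Longrightarrow> AE \<Lambda> in \<nu>. ?good m0 N \<Lambda>" by blast
    then have "AE \<Lambda> in \<nu>. \<forall>N. N \<ge> N0 \<longrightarrow> ?good m0 N \<Lambda>"
      by (subst AE_all_countable) (intro allI AE_impI)
    then show ?thesis by (rule eventually_mono) blast
  qed
  then show ?thesis unfolding good_env_def by (intro AE_all_countable[THEN iffD2] allI)
qed

end

theorem theorem2:
  fixes V :: "'a set" and E :: "'a set set" and v\<^sub>0 :: 'a
    and \<nu> :: "(int \<Rightarrow> nat) measure"
  assumes "simple_graph V E" and "locally_finite_graph V E"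
    and "infinite V" and "connected_graph V E" and "quasi_transitive V E"
    and "v\<^sub>0 \<in> V"
    and "iid_environment \<nu>"
    and "integrable \<nu> (\<lambda>\<Lambda>. ln (real (card (graph_ball V E v\<^sub>0 (\<Lambda> 0)))))"
  shows "AE \<Lambda> in \<nu>. \<forall>p\<in>{0..<p_crit V E v\<^sub>0}. \<forall>q\<in>{0..<1}. stack_theta V E v\<^sub>0 \<Lambda> p q = 0"
proof -
  interpret base_graph V E v\<^sub>0 using assms by unfold_locales
  have "space \<nu> = space env_space"
    using assms(7) sets_eq_imp_space_eq unfolding iid_environment_def by blast
  then have "AE \<Lambda> in \<nu>. \<forall>n. 1 \<le> \<Lambda> n"
    by (intro AE_I2) (auto simp: env_space_def space_PiM)
  moreover have "AE \<Lambda> in \<nu>. good_env \<Lambda> 1" "AE \<Lambda> in \<nu>. good_env \<Lambda> (-1)"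
    using assms by (intro AE_good_env; simp)+
  \<comment> \<open>The exceptional set comes from the two goodness conditions, which mention
    neither \<open>p\<close> nor \<open>q\<close>; so the quantifiers over the parameters stay
    inside.\<close>
  ultimately show ?thesis
    by eventually_elim (auto intro!: quenched_no_percolation)
qed

end
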